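(* A spectral measure over $\mathbb{T}^2$ for the group $\mathrm{E}=\Sigma(36\times3)\subset SU(3)$ (of order 108) is $$\mathrm{d}\varepsilon=\frac{1}{48\pi^4}J^2\,\mathrm{d}^{(4)}+\frac{1}{108\pi^4}J^2\,\mathrm{d}^{(3)}+\frac13\,\mathrm{d}^{(2)}-\frac1{18}\,\mathrm{d}^{(1)}.$$
   Context: Let $\omega=e^{2\pi i/3}$ and $\sqrt{-3}=i\sqrt3$. $\mathrm{E}=\Sigma(36\times3)$ is the subgroup of $SU(3)$ of order 108 generated by $S_1=\mathrm{diag}(1,\omega,\omega^2)$, $S_2=\mathrm{diag}(\omega,\omega,\omega)$, $T=\begin{pmatrix}0&1&0\\0&0&1\\1&0&0\end{pmatrix}$ and $V=\frac{1}{\sqrt{-3}}\begin{pmatrix}1&1&1\\1&\omega&\omega^2\\1&\omega^2&\omega\end{pmatrix}$. For a finite subgroup $\Gamma\subset SU(3)$ let $\rho$ be the 3-dimensional representation given by the inclusion. The McKay graph $\mathcal{G}_\Gamma$ has as vertices the irreducible representations of $\Gamma$ (up to isomorphism), with adjacency matrix $\Delta_{\sigma,\sigma'}$ = multiplicity of $\sigma'$ in $\rho\otimes\sigma$; $\Delta$ is normal. Let $e_1$ be the basis vector of the trivial representation. With $\mathbb{T}$ the unit circle and $R_{m,n}(\omega_1,\omega_2)=(\omega_1+\omega_2^{-1}+\omega_1^{-1}\omega_2)^{m}(\omega_1^{-1}+\omega_2+\omega_1\omega_2^{-1})^{n}$, a measure $\varepsilon$ on $\mathbb{T}^2$ is called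 a spectral measure over $\mathbb{T}^2$ of $\Gamma$ if $\int_{\mathbb{T}^2}R_{m,n}\,\mathrm{d}\varepsilon=\langle\Delta^{m}(\Delta^\ast)^{n} e_1,e_1\rangle$ for all integers $m,n\ge0$. For $N\in\mathbb{N}$, $\mathrm{d}^{(N)}$ is the uniform probability measure on $D_N=\{(e^{2\pi iq_1/3N},e^{2\pi iq_2/3N}) : q_1,q_2\in\{0,\dots,3N-1\},\ q_1+q_2\equiv0 \bmod 3\}$. $J$ is the function on $\mathbb{T}^2$ given at $(e^{2\pi i\theta_1},e^{2\pi i\theta_2})$ by $J=4\pi^2\big(\sin(2\pi(\theta_1+\theta_2))-\sin(2\pi(2\theta_1-\theta_2))-\sin(2\pi(2\theta_2-\theta_1))\big)$, and $J^2\mathrm{d}^{(N)}$ is the measure with density $J^2$ with respect to $\mathrm{d}^{(N)}$. *)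

theory Defs
  imports
    "HOL-Probability.Probability"
    "HOL-Algebra.Generated_Groups"
    "Jordan_Normal_Form.Matrix"
    "Jordan_Normal_Form.Determinant"
    "Jordan_Normal_Form.VS_Connect"
    "Jordan_Normal_Form.Schur_Decomposition"
begin

section \<open>Complex matrix representations\<close>

definition GL :: "nat \<Rightarrow> complex mat monoid" where
  "GL n = \<lparr>carrier = {A \<in> carrier_mat n n. invertible_mat A}, mult = (*), one = 1\<^sub>m n\<rparr>"

text \<open>A representation is a function on the type of group elements; only its values on the
  carrier matter, and all notions below are insensitive to the other values.\<close>

definition rep_degree :: "('g, 'b) monoid_scheme \<Rightarrow> ('g \<Rightarrow> complex mat) \<Rightarrow> nat" where
  "rep_degree G R = dim_row (R \<one>\<^bsub>G\<^esub>)"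

definition is_rep :: "('g, 'b) monoid_scheme \<Rightarrow> ('g \<Rightarrow> complex mat) \<Rightarrow> bool" where
  "is_rep G R \<longleftrightarrow> R \<in> hom G (GL (rep_degree G R))"

definition invariant_subspace ::
  "('g, 'b) monoid_scheme \<Rightarrow> ('g \<Rightarrow> complex mat) \<Rightarrow> complex vec set \<Rightarrow> bool" where
  "invariant_subspace G R W \<longleftrightarrow>
     subspace class_ring W (module_vec TYPE(complex) (rep_degree G R)) \<and>
     (\<forall>g\<in>carrier G. \<forall>v\<in>W. R g *\<^sub>v v \<in> W)"

definition irreducible_rep :: "('g, 'b) monoid_scheme \<Rightarrow> ('g \<Rightarrow> complex mat) \<Rightarrow> bool" where
  "irreducible_rep G R \<longleftrightarrow> is_rep G R \<and> rep_degree G R > 0 \<and>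
     (\<forall>W. invariant_subspace G R W \<longrightarrow>
        W = {0\<^sub>v (rep_degree G R)} \<or> W = carrier_vec (rep_degree G R))"

definition rep_iso ::
  "('g, 'b) monoid_scheme \<Rightarrow> ('g \<Rightarrow> complex mat) \<Rightarrow> ('g \<Rightarrow> complex mat) \<Rightarrow> bool" where
  "rep_iso G R S \<longleftrightarrow> rep_degree G R = rep_degree G S \<and>
     (\<exists>P \<in> carrier_mat (rep_degree G R) (rep_degree G R).
        invertible_mat P \<and> (\<forall>g\<in>carrier G. P * R g = S g * P))"

definition direct_sum_rep :: "('g \<Rightarrow> complex mat) list \<Rightarrow> 'g \<Rightarrow> complex mat" where
  "direct_sum_rep Rs g = diag_block_mat (map (\<lambda>R. R g) Rs)"

text \<open>Kronecker product: the basis vector \<open>e\<^sub>i \<otimes> e\<^sub>k\<close> is number \<open>i * dim B + k\<close>.\<close>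

definition kronecker :: "complex mat \<Rightarrow> complex mat \<Rightarrow> complex mat" where
  "kronecker A B = Matrix.mat (dim_row A * dim_row B) (dim_col A * dim_col B)
     (\<lambda>(i, j). A $$ (i div dim_row B, j div dim_col B) * B $$ (i mod dim_row B, j mod dim_col B))"

definition tensor_rep ::
  "('g \<Rightarrow> complex mat) \<Rightarrow> ('g \<Rightarrow> complex mat) \<Rightarrow> 'g \<Rightarrow> complex mat" where
  "tensor_rep R S g = kronecker (R g) (S g)"

definition trivial_rep :: "'g \<Rightarrow> complex mat" where
  "trivial_rep g = 1\<^sub>m 1"

text \<open>The multiplicity of an irreducible \<open>S\<close> in \<open>R\<close>: the number of summands isomorphic to \<open>S\<close> in
  a decomposition of \<open>R\<close> into irreducibles. The description operator is justified, for finite groups,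
  by complete reducibility and uniqueness of the decomposition up to isomorphism.\<close>

definition multiplicity_rep ::
  "('g, 'b) monoid_scheme \<Rightarrow> ('g \<Rightarrow> complex mat) \<Rightarrow> ('g \<Rightarrow> complex mat) \<Rightarrow> nat" where
  "multiplicity_rep G S R = (THE k. \<exists>Rs.
     (\<forall>Q\<in>set Rs. irreducible_rep G Q) \<and> rep_iso G R (direct_sum_rep Rs) \<and>
     k = length (filter (rep_iso G S) Rs))"

definition irrep_classes :: "('g, 'b) monoid_scheme \<Rightarrow> ('g \<Rightarrow> complex mat) set set" where
  "irrep_classes G = {R. irreducible_rep G R} //
     {(R, S). irreducible_rep G R \<and> irreducible_rep G S \<and> rep_iso G R S}"

section \<open>McKay graphs of finite subgroups of \<open>SU(3)\<close>\<close>

definition SU3 :: "complex mat monoid" where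
  "SU3 = \<lparr>carrier = {A \<in> carrier_mat 3 3. A * mat_adjoint A = 1\<^sub>m 3 \<and> Determinant.det A = 1},
          mult = (*), one = 1\<^sub>m 3\<rparr>"

abbreviation subgroup_SU3 :: "complex mat set \<Rightarrow> complex mat monoid" where
  "subgroup_SU3 \<Gamma> \<equiv> SU3\<lparr>carrier := \<Gamma>\<rparr>"

definition inclusion_rep :: "complex mat \<Rightarrow> complex mat" where
  "inclusion_rep g = g"

type_synonym vertex = "(complex mat \<Rightarrow> complex mat) set"

definition mckay_vertices :: "complex mat set \<Rightarrow> vertex set" where
  "mckay_vertices \<Gamma> = irrep_classes (subgroup_SU3 \<Gamma>)"

text \<open>Multiplicities depend only on isomorphism classes, so any representatives may be chosen.\<close>

definition mckay_adjacency :: "complex mat set \<Rightarrow> vertex \<Rightarrow> vertex \<Rightarrow> nat" where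
  "mckay_adjacency \<Gamma> C D =
     multiplicity_rep (subgroup_SU3 \<Gamma>) (SOME S. S \<in> D) (tensor_rep inclusion_rep (SOME R. R \<in> C))"

definition mckay_op :: "complex mat set \<Rightarrow> (vertex \<Rightarrow> complex) \<Rightarrow> vertex \<Rightarrow> complex" where
  "mckay_op \<Gamma> x C = (\<Sum>D\<in>mckay_vertices \<Gamma>. of_nat (mckay_adjacency \<Gamma> C D) * x D)"

definition mckay_op_adj :: "complex mat set \<Rightarrow> (vertex \<Rightarrow> complex) \<Rightarrow> vertex \<Rightarrow> complex" where
  "mckay_op_adj \<Gamma> x C = (\<Sum>D\<in>mckay_vertices \<Gamma>. cnj (of_nat (mckay_adjacency \<Gamma> D C)) * x D)"

definition trivial_basis_vec :: "vertex \<Rightarrow> complex" where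
  "trivial_basis_vec C = (if trivial_rep \<in> C then 1 else 0)"

definition vertex_inner ::
  "complex mat set \<Rightarrow> (vertex \<Rightarrow> complex) \<Rightarrow> (vertex \<Rightarrow> complex) \<Rightarrow> complex" where
  "vertex_inner \<Gamma> x y = (\<Sum>C\<in>mckay_vertices \<Gamma>. x C * cnj (y C))"

definition mckay_moment :: "complex mat set \<Rightarrow> nat \<Rightarrow> nat \<Rightarrow> complex" where
  "mckay_moment \<Gamma> m n = vertex_inner \<Gamma>
     ((mckay_op \<Gamma> ^^ m) ((mckay_op_adj \<Gamma> ^^ n) trivial_basis_vec)) trivial_basis_vec"

section \<open>Measures on the torus\<close>

definition torus2 :: "(complex \<times> complex) set" where
  "torus2 = sphere 0 1 \<times> sphere 0 1"

definition torus2_borel :: "(complex \<times> complex) measure" where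
  "torus2_borel = restrict_space borel torus2"

definition R_fun :: "nat \<Rightarrow> nat \<Rightarrow> complex \<times> complex \<Rightarrow> complex" where
  "R_fun m n = (\<lambda>(w1, w2).
     (w1 + inverse w2 + inverse w1 * w2) ^ m * (inverse w1 + w2 + w1 * inverse w2) ^ n)"

definition spectral_measure_T2 :: "complex mat set \<Rightarrow> (complex \<times> complex) measure \<Rightarrow> bool" where
  "spectral_measure_T2 \<Gamma> \<epsilon> \<longleftrightarrow> sets \<epsilon> = sets torus2_borel \<and>
     (\<forall>m n. has_bochner_integral \<epsilon> (R_fun m n) (mckay_moment \<Gamma> m n))"

definition J_angle :: "real \<Rightarrow> real \<Rightarrow> real" where
  "J_angle t1 t2 = 4 * pi\<^sup>2 * (sin (2 * pi * (t1 + t2))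
     - sin (2 * pi * (2 * t1 - t2)) - sin (2 * pi * (2 * t2 - t1)))"

text \<open>Any angles may be used in place of the arguments chosen here: see \<open>J_fun_cis\<close>.\<close>

definition J_fun :: "complex \<times> complex \<Rightarrow> real" where
  "J_fun = (\<lambda>(w1, w2). J_angle (Arg w1 / (2 * pi)) (Arg w2 / (2 * pi)))"

lemma J_fun_unit:
  assumes "norm z = 1" "norm w = 1"
  shows "J_fun (z, w) = 4 * pi\<^sup>2 * (Im (z * w) - Im (z\<^sup>2 * cnj w) - Im (w\<^sup>2 * cnj z))"
proof -
  define a b where "a = Arg z" and "b = Arg w"
  have "z \<noteq> 0" "w \<noteq> 0"
    using assms by auto
  then have z: "z = cis a" and w: "w = cis b"
    using assms cis_Arg[of z] cis_Arg[of w] by (simp_all add: sgn_div_norm a_def b_def)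
  have "Im (z * w) = sin (a + b)"
    by (simp add: z w cis_mult)
  moreover have "Im (z\<^sup>2 * cnj w) = sin (2 * a - b)"
    unfolding z w cis_cnj Complex.DeMoivre cis_mult by simp
  moreover have "Im (w\<^sup>2 * cnj z) = sin (2 * b - a)"
    unfolding z w cis_cnj Complex.DeMoivre cis_mult by simp
  moreover have "2 * pi * (a / (2 * pi) + b / (2 * pi)) = a + b"
    "2 * pi * (2 * (a / (2 * pi)) - b / (2 * pi)) = 2 * a - b"
    "2 * pi * (2 * (b / (2 * pi)) - a / (2 * pi)) = 2 * b - a"
    by (simp_all add: field_simps)
  ultimately show ?thesis
    unfolding J_fun_def J_angle_def prod.case a_def[symmetric] b_def[symmetric] by presburger
qed

lemma J_fun_cis: "J_fun (cis (2 * pi * t1), cis (2 * pi * t2)) = J_angle t1 t2"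
  by (subst J_fun_unit)
     (simp_all only: norm_cis cis_cnj Complex.DeMoivre cis_mult cis.sel J_angle_def,
      simp add: algebra_simps)

definition torus_grid :: "nat \<Rightarrow> (complex \<times> complex) set" where
  "torus_grid N = {(cis (2 * pi * real q1 / (3 * real N)), cis (2 * pi * real q2 / (3 * real N))) |
     q1 q2. q1 < 3 * N \<and> q2 < 3 * N \<and> 3 dvd (q1 + q2)}"

definition d_measure :: "nat \<Rightarrow> (complex \<times> complex) measure" where
  "d_measure N = distr (measure_pmf (pmf_of_set (torus_grid N))) torus2_borel (\<lambda>x. x)"

definition J2d_measure :: "nat \<Rightarrow> (complex \<times> complex) measure" where
  "J2d_measure N = density (d_measure N) (\<lambda>x. ennreal ((J_fun x)\<^sup>2))"

section \<open>The group \<open>\<Sigma>(36\<times>3)\<close>\<close>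

definition omega :: complex where
  "omega = cis (2 * pi / 3)"

definition S1_mat :: "complex mat" where
  "S1_mat = mat_of_rows_list 3 [[1, 0, 0], [0, omega, 0], [0, 0, omega\<^sup>2]]"

definition S2_mat :: "complex mat" where
  "S2_mat = mat_of_rows_list 3 [[omega, 0, 0], [0, omega, 0], [0, 0, omega]]"

definition T_mat :: "complex mat" where
  "T_mat = mat_of_rows_list 3 [[0, 1, 0], [0, 0, 1], [1, 0, 0]]"

definition V_mat :: "complex mat" where
  "V_mat = (1 / (\<i> * of_real (sqrt 3))) \<cdot>\<^sub>m
     mat_of_rows_list 3 [[1, 1, 1], [1, omega, omega\<^sup>2], [1, omega\<^sup>2, omega]]"

definition E_group :: "complex mat set" where
  "E_group = generate SU3 {S1_mat, S2_mat, T_mat, V_mat}"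

end

theory Submission
  imports Defs "Jordan_Normal_Form.Spectral_Radius"
begin

text \<open>
  Expand a vector on the vertices of the McKay graph in irreducible characters. Applying \<open>\<Delta>\<^sup>*\<close> multiplies
  the expansion by the character \<open>\<chi>\<close> of the inclusion, because \<open>\<rho> \<otimes> \<sigma>\<close> decomposes with the multiplicities
  \<open>\<Delta>\<close>; and \<open>e\<^sub>1\<close> expands to the constant 1. Orthogonality of characters therefore turns the moment
  \<open>\<langle>\<Delta>\<^sup>m (\<Delta>\<^sup>*)\<^sup>n e\<^sub>1, e\<^sub>1\<rangle>\<close> into the average of \<open>\<chi>\<^sup>m \<chi>\<^sup>*\<^sup>n\<close> over the group, that is, into a moment of the
  distribution of traces. On the torus, \<open>R\<^sub>m\<^sub>,\<^sub>n\<close> is the same monomial in the trace of the diagonal matrix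
  with eigenvalues \<open>\<omega>\<^sub>1, \<omega>\<^sub>2\<^sup>-\<^sup>1, \<omega>\<^sub>1\<^sup>-\<^sup>1 \<omega>\<^sub>2\<close>, and \<open>J\<^sup>2\<close> is up to a constant the discriminant of these
  eigenvalues. Among the 108 elements each \<open>3\<omega>\<^sup>c\<close> occurs once as a trace, 0 occurs 24 times, each \<open>\<omega>\<^sup>c\<close>
  18 times and each \<open>- \<omega>\<^sup>c\<close> 9 times; the four grids produce the same distribution, since \<open>J\<close> leaves only the
  points of trace \<open>\<omega>\<^sup>c\<close> in the fourth and those of trace 0 in the third.
\<close>

section \<open>Complex matrices\<close>

text \<open>Constants: if x1, x2, x3 are the eigenvalues, J^2 is 4 pi^4 times |x1-x2|^2 |x2-x3|^2
  |x3-x1|^2. Up to a common cube root of unity, the only triple of distinct eigenvalues is {1, i,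
  -i} in the fourth grid, where J^2 = 64 pi^4, and {1, omega, omega^2} in the third, where J^2 = 108
  pi^4. Each occurs in six orders; averaging over 48 and 27 points explains 1/(48 pi^4) and 1/(108
  pi^4). The factor 1/3 gives each - omega^c its mass 9/108, but puts 3/108 instead of 1/108 on each
  central point; the negative term removes the excess. Obstacles: multiplicities are given by a
  description operator, and a sum over an infinite vertex set would be 0, so uniqueness of
  decompositions and finiteness of the set of classes come before any use of the adjacency matrix.
  Irreducible representations are not assumed unitary, so orthogonality is phrased with inverses in
  place of complex conjugates. The group is given by generators only; it is enumerated through the
  normal form omega^c S1^a T^b V^k.\<close>

definition mat_trace :: "complex mat \<Rightarrow> complex" where
  "mat_trace A = (\<Sum>i<dim_row A. A $$ (i, i))"

lemma mult_mat_index_sum: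
  fixes A B :: "'a :: semiring_0 mat"
  assumes "A \<in> carrier_mat n k" "B \<in> carrier_mat k m" "i < n" "j < m"
  shows "(A * B) $$ (i, j) = (\<Sum>l<k. A $$ (i, l) * B $$ (l, j))"
  using assms by (auto simp: scalar_prod_def atLeast0LessThan intro!: sum.cong)

lemma mult_mat_vec_index_sum:
  fixes A :: "'a :: semiring_0 mat"
  assumes "A \<in> carrier_mat n k" "v \<in> carrier_vec k" "i < n"
  shows "vec_index (A *\<^sub>v v) i = (\<Sum>l<k. A $$ (i, l) * vec_index v l)"
  using assms by (auto simp: scalar_prod_def atLeast0LessThan intro!: sum.cong)

lemma mat_trace_mult_comm:
  assumes "A \<in> carrier_mat n k" "B \<in> carrier_mat k n"
  shows "mat_trace (A * B) = mat_trace (B * A)"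
proof -
  have "mat_trace (A * B) = (\<Sum>i<n. \<Sum>l<k. A $$ (i, l) * B $$ (l, i))"
    using assms by (auto simp: mat_trace_def mult_mat_index_sum[OF assms] simp del: index_mult_mat(1) intro!: sum.cong)
  also have "\<dots> = (\<Sum>l<k. \<Sum>i<n. B $$ (l, i) * A $$ (i, l))"
    by (subst sum.swap) (simp add: mult.commute)
  also have "\<dots> = mat_trace (B * A)"
    using assms by (auto simp: mat_trace_def mult_mat_index_sum[OF assms(2,1)] simp del: index_mult_mat(1) intro!: sum.cong)
  finally show ?thesis .
qed

lemma mat_trace_one [simp]: "mat_trace (1\<^sub>m n) = of_nat n"
  by (simp add: mat_trace_def)

lemma mat_trace_smult:
  "mat_trace (c \<cdot>\<^sub>m A) = c * mat_trace A" if "A \<in> carrier_mat n n"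
  using that by (auto simp: mat_trace_def sum_distrib_left intro!: sum.cong)

lemma mat_trace_similar:
  assumes "P \<in> carrier_mat n n" "Q \<in> carrier_mat n n" "Q * P = 1\<^sub>m n"
    and "A \<in> carrier_mat n n" "B \<in> carrier_mat n n" "P * A = B * P"
  shows "mat_trace A = mat_trace B"
proof -
  have "P * Q = 1\<^sub>m n"
    using assms mat_mult_left_right_inverse by blast
  then have "B = P * A * Q"
    using assms assoc_mult_mat[OF assms(5,1,2)] by simp
  then have "mat_trace B = mat_trace (Q * (P * A))"
    using mat_trace_mult_comm[of "P * A" n n Q] assms by simp
  also have "\<dots> = mat_trace A"
    using assms assoc_mult_mat[OF assms(2,1,4)] by simp
  finally show ?thesis ..
qed

text \<open>The trace compares the sizes: \<open>A * B\<close> and \<open>B * A\<close> have the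
  same trace, which is \<open>n\<close> for the one and \<open>k\<close> for the other.\<close>

lemma inverse_mat_dims_eq:
  fixes A B :: "complex mat"
  assumes "A \<in> carrier_mat n k" "B \<in> carrier_mat k n" "A * B = 1\<^sub>m n" "B * A = 1\<^sub>m k"
  shows "n = k"
proof -
  have "(of_nat n :: complex) = of_nat k"
    using mat_trace_mult_comm[OF assms(1,2)] assms(3,4) by simp
  then show ?thesis by simp
qed

lemma eq_mat_mult_vecI:
  fixes A B :: "'a :: semiring_1 mat"
  assumes "A \<in> carrier_mat n k" "B \<in> carrier_mat n k"
    and "\<And>v. v \<in> carrier_vec k \<Longrightarrow> A *\<^sub>v v = B *\<^sub>v v"
  shows "A = B"
proof (rule mat_col_eqI)
  fix j assume j: "j < dim_col B"
  have "col A j = A *\<^sub>v unit_vec k j" "col B j = B *\<^sub>v unit_vec k j"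
    using assms(1,2) j by (auto intro!: eq_vecI)
  then show "col A j = col B j"
    using assms(3)[of "unit_vec k j"] by simp
qed (use assms in auto)

text \<open>\<open>invertible_mat\<close> leaves the shape of the inverse open; its dimensions are
  recovered from those of the two identity matrices.\<close>

lemma invertible_mat_iff:
  fixes A :: "'a :: field mat"
  assumes "A \<in> carrier_mat n n"
  shows "invertible_mat A \<longleftrightarrow> (\<exists>B\<in>carrier_mat n n. A * B = 1\<^sub>m n \<and> B * A = 1\<^sub>m n)"
proof
  assume "invertible_mat A"
  then obtain B where B: "A * B = 1\<^sub>m (dim_row A)" "B * A = 1\<^sub>m (dim_row B)"
    by (auto simp: invertible_mat_def inverts_mat_def)
  have "dim_col B = n"
    using assms B(1) by (metis carrier_matD(1) index_mult_mat(3) index_one_mat(3))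
  moreover have "dim_row B = n"
    using assms B(2) by (metis carrier_matD(2) index_mult_mat(3) index_one_mat(3))
  ultimately show "\<exists>B\<in>carrier_mat n n. A * B = 1\<^sub>m n \<and> B * A = 1\<^sub>m n"
    using assms B by (intro bexI[of _ B]) auto
next
  assume "\<exists>B\<in>carrier_mat n n. A * B = 1\<^sub>m n \<and> B * A = 1\<^sub>m n"
  then show "invertible_mat A"
    using assms by (auto simp: invertible_mat_def inverts_mat_def)
qed

lemma mat_adjoint_carrier [simp]:
  "A \<in> carrier_mat n k \<Longrightarrow> mat_adjoint A \<in> carrier_mat k n"
  by (auto simp: mat_adjoint_def)

lemma mat_adjoint_index:
  fixes A :: "complex mat"
  assumes "A \<in> carrier_mat n k" "i < k" "j < n"
  shows "mat_adjoint A $$ (i, j) = cnj (A $$ (j, i))"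
  using assms by (auto simp: mat_adjoint_def mat_of_rows_def)

section \<open>Orthonormal bases of subspaces and splitting of idempotents\<close>

lemma subspace_module_vec_iff:
  "VectorSpace.subspace class_ring W (module_vec TYPE(complex) n) \<longleftrightarrow>
     W \<subseteq> carrier_vec n \<and> 0\<^sub>v n \<in> W \<and> (\<forall>v\<in>W. \<forall>w\<in>W. v + w \<in> W) \<and> (\<forall>c. \<forall>v\<in>W. c \<cdot>\<^sub>v v \<in> W)"
  using vec_vs[of n, where ?'a = complex] vec_module[of n, where ?'a = complex]
  by (auto simp: VectorSpace.subspace_def submodule_def module_vec_simps class_ring_simps)

lemma orthonormal_family_le:
  fixes e :: "nat \<Rightarrow> nat \<Rightarrow> complex"
  assumes "\<And>j l. j < k \<Longrightarrow> l < k \<Longrightarrow> (\<Sum>i<n. cnj (e j i) * e l i) = (if j = l then 1 else 0)"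
  shows "k \<le> n"
proof (rule ccontr)
  assume "\<not> k \<le> n"
  then have nk: "n < k" by simp
  \<comment> \<open>Padded with zero rows, the matrix of the family would be square with a left inverse,
    hence invertible, although its last row vanishes.\<close>
  define A where "A = Matrix.mat k k (\<lambda>(i, j). if i < n then e j i else 0)"
  define B where "B = Matrix.mat k k (\<lambda>(j, i). if i < n then cnj (e j i) else 0)"
  have carr: "A \<in> carrier_mat k k" "B \<in> carrier_mat k k"
    by (auto simp: A_def B_def)
  have "B * A = 1\<^sub>m k"
  proof (rule eq_matI)
    fix j l assume "j < dim_row (1\<^sub>m k)" "l < dim_col (1\<^sub>m k)"
    then have jl: "j < k" "l < k" by auto
    have "(B * A) $$ (j, l) = (\<Sum>i<k. if i < n then cnj (e j i) * e l i else 0)"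
      by (subst mult_mat_index_sum[OF carr(2,1) jl]) (auto simp: A_def B_def jl intro!: sum.cong)
    also have "\<dots> = (\<Sum>i<n. cnj (e j i) * e l i)"
      using nk by (intro sum.mono_neutral_cong_right) auto
    finally show "(B * A) $$ (j, l) = 1\<^sub>m k $$ (j, l)"
      using assms jl by simp
  qed (auto simp: A_def B_def)
  then have "A * B = 1\<^sub>m k"
    using carr mat_mult_left_right_inverse by blast
  then have "(A * B) $$ (n, n) = 1" using nk by simp
  moreover have "(A * B) $$ (n, n) = 0"
    by (subst mult_mat_index_sum[OF carr nk nk]) (auto simp: A_def nk)
  ultimately show False by simp
qed

text \<open>The columns of \<open>L\<close> are an orthonormal family in \<open>W\<close> of
  greatest length; \<open>orthonormal_family_le\<close> bounds the lengths, so one exists. If some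
  \<open>v\<close> in \<open>W\<close> differed from its projection, the normalised difference could
  be appended. In this matrix form the orthogonal projection onto \<open>W\<close> is
  \<open>L * mat_adjoint L\<close>.\<close>

lemma subspace_orthonormal_basis:
  fixes W :: "complex Matrix.vec set"
  assumes "VectorSpace.subspace class_ring W (module_vec TYPE(complex) n)"
  obtains k L where "L \<in> carrier_mat n k" "mat_adjoint L * L = 1\<^sub>m k"
    "\<And>v. v \<in> W \<Longrightarrow> L *\<^sub>v (mat_adjoint L *\<^sub>v v) = v" "\<And>v. v \<in> carrier_vec k \<Longrightarrow> L *\<^sub>v v \<in> W"
proof -
  have W: "W \<subseteq> carrier_vec n" "0\<^sub>v n \<in> W" "\<And>v w. v \<in> W \<Longrightarrow> w \<in> W \<Longrightarrow> v + w \<in> W"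
    "\<And>c v. v \<in> W \<Longrightarrow> c \<cdot>\<^sub>v v \<in> W"
    using assms by (auto simp: subspace_module_vec_iff)
  define orth where "orth k e \<longleftrightarrow> (\<forall>j<k. Matrix.vec n (e j) \<in> W) \<and>
      (\<forall>j<k. \<forall>l<k. (\<Sum>i<n. cnj (e j i) * e l i) = (if j = l then 1 else 0))"
    for k :: nat and e :: "nat \<Rightarrow> nat \<Rightarrow> complex"
  have orth_le: "k \<le> n" if "orth k e" for k e
    using that orthonormal_family_le[where e = e and k = k and n = n] by (auto simp: orth_def)
  have ex0: "\<exists>e. orth 0 e" by (simp add: orth_def)
  obtain k where k: "\<exists>e. orth k e" and kmax: "\<And>l. \<exists>e. orth l e \<Longrightarrow> l \<le> k"
    using Nat.ex_has_greatest_nat[of "\<lambda>k. \<exists>e. orth k e" 0 n] ex0 orth_le by blast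
  then obtain e where e: "orth k e" by blast
  define L where "L = Matrix.mat n k (\<lambda>(i, j). e j i)"
  have L: "L \<in> carrier_mat n k" by (simp add: L_def)
  note L' = mat_adjoint_carrier[OF L]
  have Li: "L $$ (i, j) = e j i" "mat_adjoint L $$ (j, i) = cnj (e j i)" if "i < n" "j < k" for i j
    using that mat_adjoint_index[OF L, of j i] by (auto simp: L_def)
  have LL: "mat_adjoint L * L = 1\<^sub>m k"
  proof (rule eq_matI)
    fix j l assume "j < dim_row (1\<^sub>m k)" "l < dim_col (1\<^sub>m k)"
    then show "(mat_adjoint L * L) $$ (j, l) = 1\<^sub>m k $$ (j, l)"
      using e by (subst mult_mat_index_sum[OF L' L]) (auto simp: Li orth_def)
  qed (use carrier_matD[OF L] carrier_matD[OF L'] in auto)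
  have in_W: "L *\<^sub>v v \<in> W" if v: "v \<in> carrier_vec k" for v
  proof -
    have "m \<le> k \<Longrightarrow> Matrix.vec n (\<lambda>i. \<Sum>j<m. e j i * vec_index v j) \<in> W" for m
    proof (induction m)
      case 0
      have "Matrix.vec n (\<lambda>i. \<Sum>j<0. e j i * vec_index v j) = 0\<^sub>v n" by auto
      then show ?case using W(2) by simp
    next
      case (Suc m)
      have "Matrix.vec n (\<lambda>i. \<Sum>j<Suc m. e j i * vec_index v j) =
          Matrix.vec n (\<lambda>i. \<Sum>j<m. e j i * vec_index v j) + vec_index v m \<cdot>\<^sub>v Matrix.vec n (e m)"
        by (rule eq_vecI) auto
      moreover have "Matrix.vec n (e m) \<in> W" using e Suc.prems by (auto simp: orth_def)
      ultimately show ?case using Suc W(3,4) by auto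
    qed
    from this[of k] have "Matrix.vec n (\<lambda>i. \<Sum>j<k. e j i * vec_index v j) \<in> W" by simp
    also have "Matrix.vec n (\<lambda>i. \<Sum>j<k. e j i * vec_index v j) = L *\<^sub>v v"
    proof (rule eq_vecI)
      fix i assume "i < dim_vec (L *\<^sub>v v)"
      then have "i < n" using L by simp
      then show "vec_index (Matrix.vec n (\<lambda>i. \<Sum>j<k. e j i * vec_index v j)) i = vec_index (L *\<^sub>v v) i"
        by (simp add: mult_mat_vec_index_sum[OF L v] Li del: index_mult_mat_vec)
    qed (use L in auto)
    finally show ?thesis .
  qed
  have fix_W: "L *\<^sub>v (mat_adjoint L *\<^sub>v v) = v" if vW: "v \<in> W" for v
  proof -
    have v: "v \<in> carrier_vec n" using vW W by auto
    have L'v: "mat_adjoint L *\<^sub>v v \<in> carrier_vec k" using L' v by auto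
    \<comment> \<open>The part of \<open>v\<close> orthogonal to the columns of \<open>L\<close>,
      written as a sum because \<open>W\<close> is known to be closed under sums and scalar
      multiples.\<close>
    define u where "u = v + (-1) \<cdot>\<^sub>v (L *\<^sub>v (mat_adjoint L *\<^sub>v v))"
    have uW: "u \<in> W" unfolding u_def using W vW in_W[OF L'v] by auto
    have u: "u \<in> carrier_vec n" using uW W by auto
    have "mat_adjoint L *\<^sub>v (L *\<^sub>v (mat_adjoint L *\<^sub>v v)) = mat_adjoint L *\<^sub>v v"
      using assoc_mult_mat_vec[OF L' L L'v] LL L'v by simp
    then have "mat_adjoint L *\<^sub>v u = mat_adjoint L *\<^sub>v v + (-1) \<cdot>\<^sub>v (mat_adjoint L *\<^sub>v v)"
      unfolding u_def using L L' v L'v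
      by (subst mult_add_distrib_mat_vec[OF L' v]) (auto simp: mult_mat_vec[OF L'])
    then have L'u: "mat_adjoint L *\<^sub>v u = 0\<^sub>v k" using L'v carrier_matD[OF L'] by (auto intro!: eq_vecI simp del: index_mult_mat_vec)
    have orth_u: "(\<Sum>i<n. cnj (e j i) * vec_index u i) = 0" if "j < k" for j
    proof -
      have "(\<Sum>i<n. cnj (e j i) * vec_index u i) = vec_index (mat_adjoint L *\<^sub>v u) j"
        by (subst mult_mat_vec_index_sum[OF L' u that]) (simp add: Li that)
      then show ?thesis using L'u that by simp
    qed
    have "u = 0\<^sub>v n"
    proof (rule ccontr)
      assume "u \<noteq> 0\<^sub>v n"
      then obtain i0 where i0: "i0 < n" "vec_index u i0 \<noteq> 0"
        using u by (metis carrier_vecD eq_vecI index_zero_vec)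
      define r where "r = (\<Sum>i<n. (cmod (vec_index u i))\<^sup>2)"
      have "r > 0"
        unfolding r_def using i0 by (intro sum_pos2[of _ i0]) auto
      define c where "c = complex_of_real (1 / sqrt r)"
      have c: "c * c * of_real r = 1"
      proof -
        have "1 / sqrt r * (1 / sqrt r) * r = 1" using \<open>r > 0\<close> by (simp add: field_simps)
        then show ?thesis unfolding c_def by (metis of_real_1 of_real_mult)
      qed
      have cr: "cnj c = c" by (simp add: c_def)
      \<comment> \<open>The normalised residual becomes vector number \<open>k\<close> of the
        family; the vectors 0 to \<open>k - 1\<close> are kept.\<close>
      define f where "f = e(k := \<lambda>i. c * vec_index u i)"
      have ff: "(\<Sum>i<n. cnj (c * vec_index u i) * (c * vec_index u i)) = 1"
      proof -
        have "(\<Sum>i<n. cnj (c * vec_index u i) * (c * vec_index u i)) =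
            (\<Sum>i<n. c * c * of_real ((cmod (vec_index u i))\<^sup>2))"
          by (intro sum.cong refl) (simp add: cr complex_norm_square mult_ac del: of_real_power)
        also have "\<dots> = c * c * of_real r"
          by (simp add: r_def sum_distrib_left)
        finally show ?thesis using c by simp
      qed
      have fe: "(\<Sum>i<n. cnj (e j i) * (c * vec_index u i)) = 0"
        and ef: "(\<Sum>i<n. cnj (c * vec_index u i) * e j i) = 0" if "j < k" for j
      proof -
        have *: "(\<Sum>i<n. cnj (e j i) * (c * vec_index u i)) = c * (\<Sum>i<n. cnj (e j i) * vec_index u i)"
          by (simp add: sum_distrib_left mult_ac)
        then show **: "(\<Sum>i<n. cnj (e j i) * (c * vec_index u i)) = 0"
          using orth_u[OF that] by simp
        have "(\<Sum>i<n. cnj (c * vec_index u i) * e j i) = cnj (\<Sum>i<n. cnj (e j i) * (c * vec_index u i))"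
          by (simp add: mult_ac)
        then show "(\<Sum>i<n. cnj (c * vec_index u i) * e j i) = 0" using ** by simp
      qed
      have "Matrix.vec n (\<lambda>i. c * vec_index u i) = c \<cdot>\<^sub>v u"
        using u by (intro eq_vecI) auto
      then have "Matrix.vec n (f j) \<in> W" if "j < Suc k" for j
        using that e uW W(4) by (auto simp: f_def orth_def less_Suc_eq)
      moreover have "(\<Sum>i<n. cnj (f j i) * f l i) = (if j = l then 1 else 0)"
        if "j < Suc k" "l < Suc k" for j l
        using that e ff fe ef by (auto simp: f_def orth_def less_Suc_eq)
      ultimately have "orth (Suc k) f" by (auto simp: orth_def)
      then show False using kmax[of "Suc k"] by auto
    qed
    then have "v = v - u" using v by auto
    also have "\<dots> = L *\<^sub>v (mat_adjoint L *\<^sub>v v)"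
      unfolding u_def using v L'v L by (intro eq_vecI) auto
    finally show ?thesis ..
  qed
  show thesis by (rule that[OF L LL fix_W in_W])
qed

text \<open>An idempotent factors through its image, and \<open>L\<close> embeds an orthonormal
  basis of that image. \<open>P\<close> may be an oblique projection, so the other factor is
  \<open>mat_adjoint L * P\<close> and not \<open>mat_adjoint L\<close>.\<close>

lemma idempotent_mat_factorization:
  fixes P :: "complex mat"
  assumes P: "P \<in> carrier_mat n n" and idem: "P * P = P"
  obtains k L M where "L \<in> carrier_mat n k" "M \<in> carrier_mat k n" "M * L = 1\<^sub>m k" "L * M = P"
proof -
  define W where "W = (\<lambda>v. P *\<^sub>v v) ` carrier_vec n"
  have "VectorSpace.subspace class_ring W (module_vec TYPE(complex) n)"
    unfolding subspace_module_vec_iff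
  proof (intro conjI ballI allI)
    show "W \<subseteq> carrier_vec n" using P by (auto simp: W_def)
    show "0\<^sub>v n \<in> W" unfolding W_def using P by (intro image_eqI[of _ _ "0\<^sub>v n"]) auto
    show "v + w \<in> W" if "v \<in> W" "w \<in> W" for v w
      using that P unfolding W_def by (auto simp flip: mult_add_distrib_mat_vec)
    show "c \<cdot>\<^sub>v v \<in> W" if "v \<in> W" for c v
      using that P unfolding W_def by (auto simp flip: mult_mat_vec)
  qed
  then obtain k L where L: "L \<in> carrier_mat n k" "mat_adjoint L * L = 1\<^sub>m k"
    "\<And>v. v \<in> W \<Longrightarrow> L *\<^sub>v (mat_adjoint L *\<^sub>v v) = v" "\<And>v. v \<in> carrier_vec k \<Longrightarrow> L *\<^sub>v v \<in> W"
    by (rule subspace_orthonormal_basis) blast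
  note L' = mat_adjoint_carrier[OF L(1)]
  have PL: "P * L = L"
  proof (rule eq_mat_mult_vecI)
    fix v :: "complex Matrix.vec" assume v: "v \<in> carrier_vec k"
    then obtain w where w: "w \<in> carrier_vec n" "L *\<^sub>v v = P *\<^sub>v w"
      using L(4) unfolding W_def by blast
    have "(P * L) *\<^sub>v v = P *\<^sub>v (P *\<^sub>v w)"
      using w(2) assoc_mult_mat_vec[OF P L(1) v] by simp
    also have "\<dots> = P *\<^sub>v w"
      using assoc_mult_mat_vec[OF P P w(1)] idem by simp
    finally show "(P * L) *\<^sub>v v = L *\<^sub>v v"
      using w(2) by simp
  qed (use P L in auto)
  have LP: "L * (mat_adjoint L * P) = P"
  proof (rule eq_mat_mult_vecI)
    fix v :: "complex Matrix.vec" assume v: "v \<in> carrier_vec n"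
    have "(L * (mat_adjoint L * P)) *\<^sub>v v = L *\<^sub>v (mat_adjoint L *\<^sub>v (P *\<^sub>v v))"
      using assoc_mult_mat_vec[OF L(1) mult_carrier_mat[OF L' P] v] assoc_mult_mat_vec[OF L' P v]
      by simp
    also have "\<dots> = P *\<^sub>v v" using L(3) v by (auto simp: W_def)
    finally show "(L * (mat_adjoint L * P)) *\<^sub>v v = P *\<^sub>v v" .
  qed (use P L L' in auto)
  have "mat_adjoint L * P * L = 1\<^sub>m k"
    using assoc_mult_mat[OF L' P L(1)] PL L(2) by simp
  then show thesis
    using that[of L k "mat_adjoint L * P"] LP L(1) L' P by auto
qed

text \<open>Matrices of all sizes share one type, so the size of the sum is an argument and is not
  read off from the summands.\<close>

definition mat_sum :: "nat \<Rightarrow> nat \<Rightarrow> ('g \<Rightarrow> complex mat) \<Rightarrow> 'g set \<Rightarrow> complex mat" where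
  "mat_sum a b f X = Matrix.mat a b (\<lambda>ij. \<Sum>g\<in>X. f g $$ ij)"

lemma mat_sum_carrier [simp]: "mat_sum a b f X \<in> carrier_mat a b"
  by (simp add: mat_sum_def)

lemma mat_sum_index: "i < a \<Longrightarrow> j < b \<Longrightarrow> mat_sum a b f X $$ (i, j) = (\<Sum>g\<in>X. f g $$ (i, j))"
  by (simp add: mat_sum_def)

lemma mult_mat_sum:
  assumes "C \<in> carrier_mat c a" "\<And>g. g \<in> X \<Longrightarrow> f g \<in> carrier_mat a b"
  shows "C * mat_sum a b f X = mat_sum c b (\<lambda>g. C * f g) X"
proof (rule eq_matI)
  fix i j assume "i < dim_row (mat_sum c b (\<lambda>g. C * f g) X)" "j < dim_col (mat_sum c b (\<lambda>g. C * f g) X)"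
  then have ij: "i < c" "j < b" by (auto simp: mat_sum_def)
  have "(C * mat_sum a b f X) $$ (i, j) = (\<Sum>l<a. \<Sum>g\<in>X. C $$ (i, l) * f g $$ (l, j))"
    using ij by (simp add: mult_mat_index_sum[OF assms(1) mat_sum_carrier] mat_sum_index sum_distrib_left)
  also have "\<dots> = (\<Sum>g\<in>X. (C * f g) $$ (i, j))"
    using ij by (subst sum.swap) (auto simp: mult_mat_index_sum[OF assms] intro!: sum.cong)
  finally show "(C * mat_sum a b f X) $$ (i, j) = mat_sum c b (\<lambda>g. C * f g) X $$ (i, j)"
    using ij by (simp add: mat_sum_index)
qed (use assms in \<open>auto simp: mat_sum_def\<close>)

lemma mat_sum_mult:
  assumes "C \<in> carrier_mat b c" "\<And>g. g \<in> X \<Longrightarrow> f g \<in> carrier_mat a b"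
  shows "mat_sum a b f X * C = mat_sum a c (\<lambda>g. f g * C) X"
proof (rule eq_matI)
  fix i j assume "i < dim_row (mat_sum a c (\<lambda>g. f g * C) X)" "j < dim_col (mat_sum a c (\<lambda>g. f g * C) X)"
  then have ij: "i < a" "j < c" by (auto simp: mat_sum_def)
  have "(mat_sum a b f X * C) $$ (i, j) = (\<Sum>l<b. \<Sum>g\<in>X. f g $$ (i, l) * C $$ (l, j))"
    using ij by (simp add: mult_mat_index_sum[OF mat_sum_carrier assms(1)] mat_sum_index sum_distrib_right)
  also have "\<dots> = (\<Sum>g\<in>X. (f g * C) $$ (i, j))"
    using ij by (subst sum.swap) (auto simp: mult_mat_index_sum[OF assms(2) assms(1)] intro!: sum.cong)
  finally show "(mat_sum a b f X * C) $$ (i, j) = mat_sum a c (\<lambda>g. f g * C) X $$ (i, j)"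
    using ij by (simp add: mat_sum_index)
qed (use assms in \<open>auto simp: mat_sum_def\<close>)

lemma mat_sum_cong: "(\<And>g. g \<in> X \<Longrightarrow> f g = h g) \<Longrightarrow> mat_sum a b f X = mat_sum a b h X"
  by (simp add: mat_sum_def)

lemma mat_sum_const:
  assumes "A \<in> carrier_mat a b"
  shows "mat_sum a b (\<lambda>_. A) X = of_nat (card X) \<cdot>\<^sub>m A"
  using assms by (auto simp: mat_sum_def intro!: eq_matI)

section \<open>Traces of block diagonal matrices\<close>

lemma mat_trace_four_block:
  assumes "A \<in> carrier_mat n n" "D \<in> carrier_mat m m"
  shows "mat_trace (four_block_mat A B C D) = mat_trace A + mat_trace D"
proof -
  have "mat_trace (four_block_mat A B C D) =
      (\<Sum>i\<in>{..<n} \<union> {n..<n + m}. four_block_mat A B C D $$ (i, i))"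
    using assms by (auto simp: mat_trace_def intro!: sum.cong)
  also have "\<dots> = (\<Sum>i<n. A $$ (i, i)) + (\<Sum>i\<in>{n..<n + m}. D $$ (i - n, i - n))"
    using assms by (subst sum.union_disjoint) (auto intro!: sum.cong)
  also have "(\<Sum>i\<in>{n..<n + m}. D $$ (i - n, i - n)) = (\<Sum>i<m. D $$ (i, i))"
    by (rule sum.reindex_bij_witness[of _ "\<lambda>i. i + n" "\<lambda>i. i - n"]) auto
  finally show ?thesis using assms by (simp add: mat_trace_def)
qed

lemma mat_trace_diag_block:
  assumes "\<And>A. A \<in> set As \<Longrightarrow> square_mat A"
  shows "mat_trace (diag_block_mat As) = (\<Sum>A\<leftarrow>As. mat_trace A)"
  using assms
proof (induction As)
  case Nil
  then show ?case by (simp add: mat_trace_def)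
next
  case (Cons A As)
  define D where "D = diag_block_mat As"
  have "square_mat D" unfolding D_def using Cons.prems by (intro diag_block_mat_square) auto
  then have D: "D \<in> carrier_mat (dim_row D) (dim_row D)" by auto
  have A: "A \<in> carrier_mat (dim_row A) (dim_row A)" using Cons.prems[of A] by auto
  have "mat_trace (diag_block_mat (A # As)) = mat_trace A + mat_trace D"
    unfolding diag_block_mat.simps Let_def D_def[symmetric] by (rule mat_trace_four_block[OF A D])
  then show ?case
    using Cons.IH Cons.prems by (simp add: D_def)
qed

section \<open>Representations of finite groups\<close>

abbreviation diag2_mat :: "complex mat \<Rightarrow> complex mat \<Rightarrow> complex mat" where
  "diag2_mat A B \<equiv> four_block_mat A (0\<^sub>m (dim_row A) (dim_col B)) (0\<^sub>m (dim_row B) (dim_col A)) B"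

lemma diag2_mat_mult:
  assumes "A \<in> carrier_mat a a" "A' \<in> carrier_mat a a" "B \<in> carrier_mat b b" "B' \<in> carrier_mat b b"
  shows "diag2_mat A B * diag2_mat A' B' = diag2_mat (A * A') (B * B')"
proof -
  have *: "dim_row A = a" "dim_col A = a" "dim_row A' = a" "dim_col A' = a"
    "dim_row B = b" "dim_col B = b" "dim_row B' = b" "dim_col B' = b"
    using assms by auto
  show ?thesis
    unfolding * index_mult_mat
    by (subst mult_four_block_mat[of _ a a _ b _ b _ _ a _ b]) (use assms in auto)
qed

locale fin_group = group G for G (structure) +
  assumes finite_carrier [simp]: "finite (carrier G)"
begin

abbreviation deg :: "('a \<Rightarrow> complex mat) \<Rightarrow> nat" where
  "deg \<equiv> rep_degree G"

text \<open>A homomorphism into invertible matrices sends the unit to an invertible idempotent,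
  which is the identity. Conversely, \<open>R (inv g)\<close> inverts \<open>R g\<close>.\<close>

lemma is_rep_iff:
  "is_rep G R \<longleftrightarrow> (\<forall>g\<in>carrier G. R g \<in> carrier_mat (deg R) (deg R)) \<and>
     (\<forall>g\<in>carrier G. \<forall>h\<in>carrier G. R (g \<otimes> h) = R g * R h) \<and> R \<one> = 1\<^sub>m (deg R)"
proof
  assume R: "is_rep G R"
  then have c: "R g \<in> carrier_mat (deg R) (deg R)" "invertible_mat (R g)" if "g \<in> carrier G" for g
    using that by (auto simp: is_rep_def hom_def GL_def)
  have m: "R (g \<otimes> h) = R g * R h" if "g \<in> carrier G" "h \<in> carrier G" for g h
    using R that by (auto simp: is_rep_def hom_def GL_def)
  obtain B where B: "B \<in> carrier_mat (deg R) (deg R)" "R \<one> * B = 1\<^sub>m (deg R)"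
    using c[of \<one>] invertible_mat_iff[of "R \<one>"] by auto
  have "R \<one> = R \<one> * (R \<one> * B)"
    using c[of \<one>] B by simp
  also have "\<dots> = R \<one> * B"
    using m[of \<one> \<one>] c(1)[of \<one>] B(1) assoc_mult_mat[of "R \<one>" "deg R" "deg R" "R \<one>" "deg R" B] by simp
  finally show "(\<forall>g\<in>carrier G. R g \<in> carrier_mat (deg R) (deg R)) \<and>
     (\<forall>g\<in>carrier G. \<forall>h\<in>carrier G. R (g \<otimes> h) = R g * R h) \<and> R \<one> = 1\<^sub>m (deg R)"
    using c m B by auto
next
  assume *: "(\<forall>g\<in>carrier G. R g \<in> carrier_mat (deg R) (deg R)) \<and>
     (\<forall>g\<in>carrier G. \<forall>h\<in>carrier G. R (g \<otimes> h) = R g * R h) \<and> R \<one> = 1\<^sub>m (deg R)"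
  have "invertible_mat (R g)" if "g \<in> carrier G" for g
  proof -
    have "R g * R (inv g) = 1\<^sub>m (deg R)" "R (inv g) * R g = 1\<^sub>m (deg R)"
      using * that by (metis inv_closed r_inv, metis inv_closed l_inv that *)
    then show ?thesis
      using * that invertible_mat_iff[of "R g" "deg R"] inv_closed by blast
  qed
  then show "is_rep G R"
    using * by (auto simp: is_rep_def hom_def GL_def)
qed

lemma is_repI:
  assumes "\<And>g. g \<in> carrier G \<Longrightarrow> R g \<in> carrier_mat n n"
    and "\<And>g h. g \<in> carrier G \<Longrightarrow> h \<in> carrier G \<Longrightarrow> R (g \<otimes> h) = R g * R h"
    and "R \<one> = 1\<^sub>m n"
  shows "is_rep G R" "deg R = n"
proof -
  show "deg R = n" using assms(3) by (simp add: rep_degree_def)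
  then show "is_rep G R" using assms by (auto simp: is_rep_iff)
qed

lemma rep_carrier: "is_rep G R \<Longrightarrow> g \<in> carrier G \<Longrightarrow> R g \<in> carrier_mat (deg R) (deg R)"
  by (simp add: is_rep_iff)

lemma rep_mult: "is_rep G R \<Longrightarrow> g \<in> carrier G \<Longrightarrow> h \<in> carrier G \<Longrightarrow> R (g \<otimes> h) = R g * R h"
  by (simp add: is_rep_iff)

lemma rep_one: "is_rep G R \<Longrightarrow> R \<one> = 1\<^sub>m (deg R)"
  by (simp add: is_rep_iff)

lemma rep_inv:
  assumes "is_rep G R" "g \<in> carrier G"
  shows "R g * R (inv g) = 1\<^sub>m (deg R)" "R (inv g) * R g = 1\<^sub>m (deg R)"
  using rep_mult[OF assms, of "inv g"] rep_mult[OF assms(1) inv_closed[OF assms(2)] assms(2)]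
    rep_one[OF assms(1)] assms(2) by simp_all

lemma irreducible_is_rep: "irreducible_rep G R \<Longrightarrow> is_rep G R"
  by (simp add: irreducible_rep_def)

lemma rep_isoI:
  assumes "deg R = n" "deg S = n" "P \<in> carrier_mat n n" "Q \<in> carrier_mat n n"
    "P * Q = 1\<^sub>m n" "Q * P = 1\<^sub>m n" "\<And>g. g \<in> carrier G \<Longrightarrow> P * R g = S g * P"
  shows "rep_iso G R S"
  using assms invertible_mat_iff[OF assms(3)] unfolding rep_iso_def by auto

lemma rep_isoE:
  assumes "rep_iso G R S"
  obtains P Q where "P \<in> carrier_mat (deg R) (deg R)" "Q \<in> carrier_mat (deg R) (deg R)"
    "P * Q = 1\<^sub>m (deg R)" "Q * P = 1\<^sub>m (deg R)" "\<And>g. g \<in> carrier G \<Longrightarrow> P * R g = S g * P"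
proof -
  obtain P where P: "P \<in> carrier_mat (deg R) (deg R)" "invertible_mat P"
      "\<And>g. g \<in> carrier G \<Longrightarrow> P * R g = S g * P"
    using assms unfolding rep_iso_def by blast
  then obtain Q where "Q \<in> carrier_mat (deg R) (deg R)" "P * Q = 1\<^sub>m (deg R)" "Q * P = 1\<^sub>m (deg R)"
    using invertible_mat_iff[OF P(1)] by blast
  then show thesis using P that by blast
qed

lemma rep_iso_refl: "is_rep G R \<Longrightarrow> rep_iso G R R"
  by (rule rep_isoI[of _ "deg R" _ "1\<^sub>m (deg R)" "1\<^sub>m (deg R)"]) (auto dest: rep_carrier)

lemma rep_iso_sym:
  assumes "is_rep G R" "is_rep G S" "rep_iso G R S"
  shows "rep_iso G S R"
proof -
  obtain P Q where PQ: "P \<in> carrier_mat (deg R) (deg R)" "Q \<in> carrier_mat (deg R) (deg R)"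
    "P * Q = 1\<^sub>m (deg R)" "Q * P = 1\<^sub>m (deg R)" "\<And>g. g \<in> carrier G \<Longrightarrow> P * R g = S g * P"
    using rep_isoE[OF assms(3)] by blast
  have d: "deg S = deg R" using assms(3) by (simp add: rep_iso_def)
  have "Q * S g = R g * Q" if "g \<in> carrier G" for g
  proof -
    have R: "R g \<in> carrier_mat (deg R) (deg R)" and S: "S g \<in> carrier_mat (deg R) (deg R)"
      using assms that rep_carrier d by metis+
    have "Q * S g = Q * (S g * (P * Q))" using S PQ by simp
    also have "\<dots> = Q * (S g * P * Q)" using S PQ(1,2) by simp
    also have "\<dots> = Q * (P * R g * Q)" using PQ(5)[OF that] by simp
    also have "\<dots> = Q * (P * (R g * Q))" using R PQ(1,2) by simp
    also have "\<dots> = R g * Q" using R PQ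
      by (subst assoc_mult_mat[OF PQ(2,1) mult_carrier_mat[OF R PQ(2)], symmetric]) simp
    finally show ?thesis .
  qed
  then show ?thesis using PQ d by (intro rep_isoI[of _ "deg R" _ Q P]) auto
qed

lemma rep_iso_trans:
  assumes "is_rep G R" "is_rep G S" "is_rep G T" "rep_iso G R S" "rep_iso G S T"
  shows "rep_iso G R T"
proof -
  have d: "deg S = deg R" "deg T = deg R" using assms(4,5) by (auto simp: rep_iso_def)
  obtain P Q where PQ: "P \<in> carrier_mat (deg R) (deg R)" "Q \<in> carrier_mat (deg R) (deg R)"
    "P * Q = 1\<^sub>m (deg R)" "Q * P = 1\<^sub>m (deg R)" "\<And>g. g \<in> carrier G \<Longrightarrow> P * R g = S g * P"
    using rep_isoE[OF assms(4)] by blast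
  obtain P' Q' where PQ': "P' \<in> carrier_mat (deg R) (deg R)" "Q' \<in> carrier_mat (deg R) (deg R)"
    "P' * Q' = 1\<^sub>m (deg R)" "Q' * P' = 1\<^sub>m (deg R)" "\<And>g. g \<in> carrier G \<Longrightarrow> P' * S g = T g * P'"
    using rep_isoE[OF assms(5)] d by metis
  show ?thesis
  proof (rule rep_isoI[of _ "deg R" _ "P' * P" "Q * Q'"])
    have "P' * P * (Q * Q') = P' * (P * Q * Q')"
      using PQ(1,2) PQ'(1,2) by (simp add: assoc_mult_mat[of _ "deg R" "deg R" _ "deg R" _ "deg R"])
    then show "P' * P * (Q * Q') = 1\<^sub>m (deg R)" using PQ PQ' by simp
    have "Q * Q' * (P' * P) = Q * (Q' * P' * P)"
      using PQ(1,2) PQ'(1,2) by (simp add: assoc_mult_mat[of _ "deg R" "deg R" _ "deg R" _ "deg R"])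
    then show "Q * Q' * (P' * P) = 1\<^sub>m (deg R)" using PQ PQ' by simp
    fix g assume g: "g \<in> carrier G"
    have c: "R g \<in> carrier_mat (deg R) (deg R)" "S g \<in> carrier_mat (deg R) (deg R)"
      "T g \<in> carrier_mat (deg R) (deg R)"
      using assms g rep_carrier d by metis+
    have "P' * P * R g = P' * (P * R g)" using c PQ(1) PQ'(1) by simp
    also have "\<dots> = P' * S g * P" using c PQ(1) PQ'(1) PQ(5)[OF g] by simp
    also have "\<dots> = T g * (P' * P)" using c PQ(1) PQ'(1) PQ'(5)[OF g] by simp
    finally show "P' * P * R g = T g * (P' * P)" .
  qed (use d PQ PQ' in auto)
qed

definition char :: "('a \<Rightarrow> complex mat) \<Rightarrow> 'a \<Rightarrow> complex" where
  "char R g = mat_trace (R g)"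

lemma direct_sum_carrier:
  assumes "\<And>Q. Q \<in> set Rs \<Longrightarrow> is_rep G Q" "g \<in> carrier G"
  shows "direct_sum_rep Rs g \<in> carrier_mat (sum_list (map deg Rs)) (sum_list (map deg Rs))"
proof -
  have "map (\<lambda>Q. dim_row (Q g)) Rs = map deg Rs" "map (\<lambda>Q. dim_col (Q g)) Rs = map deg Rs"
    using assms by (auto dest!: rep_carrier)
  then have "sum_list (map (\<lambda>Q. dim_row (Q g)) Rs) = sum_list (map deg Rs)"
    "sum_list (map (\<lambda>Q. dim_col (Q g)) Rs) = sum_list (map deg Rs)"
    by (simp_all only:)
  then show ?thesis
    unfolding direct_sum_rep_def by (intro carrier_matI) (simp_all add: dim_diag_block_mat o_def)
qed

lemma deg_direct_sum:
  assumes "\<And>Q. Q \<in> set Rs \<Longrightarrow> is_rep G Q"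
  shows "deg (direct_sum_rep Rs) = sum_list (map deg Rs)"
  using direct_sum_carrier[OF assms one_closed] unfolding rep_degree_def by auto

lemma char_direct_sum:
  assumes "\<And>Q. Q \<in> set Rs \<Longrightarrow> is_rep G Q" "g \<in> carrier G"
  shows "char (direct_sum_rep Rs) g = (\<Sum>Q\<leftarrow>Rs. char Q g)"
proof -
  have "square_mat (Q g)" if "Q \<in> set Rs" for Q
    using rep_carrier[of Q g] assms that by auto
  then show ?thesis
    unfolding char_def direct_sum_rep_def by (subst mat_trace_diag_block) (auto simp: o_def)
qed

lemma char_rep_iso:
  assumes "rep_iso G R S" "is_rep G R" "g \<in> carrier G" "S g \<in> carrier_mat (deg R) (deg R)"
  shows "char R g = char S g"
proof -
  obtain P Q where "P \<in> carrier_mat (deg R) (deg R)" "Q \<in> carrier_mat (deg R) (deg R)"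
    "P * Q = 1\<^sub>m (deg R)" "Q * P = 1\<^sub>m (deg R)" "\<And>g. g \<in> carrier G \<Longrightarrow> P * R g = S g * P"
    using rep_isoE[OF assms(1)] by blast
  then show ?thesis
    unfolding char_def using rep_carrier[OF assms(2,3)] assms(3,4)
    by (intro mat_trace_similar[of P "deg R" Q]) auto
qed

lemma char_eq_of_iso:
  assumes "rep_iso G R S" "is_rep G R" "is_rep G S" "g \<in> carrier G"
  shows "char R g = char S g"
  using assms rep_carrier[of S g] by (intro char_rep_iso) (auto simp: rep_iso_def)

section \<open>Averaging over the group\<close>

lemma sum_translate:
  assumes "h \<in> carrier G"
  shows "(\<Sum>g\<in>carrier G. f (h \<otimes> g)) = (\<Sum>g\<in>carrier G. f g)"
  by (rule sum.reindex_bij_witness[of _ "\<lambda>g. inv h \<otimes> g" "\<lambda>g. h \<otimes> g"])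
    (use assms in \<open>auto simp flip: m_assoc\<close>)

text \<open>Up to the factor of the group order, the average of \<open>A\<close> under the
  simultaneous action of the group on both sides. Orthogonality of characters takes \<open>A\<close>
  to be a matrix unit, complete reducibility takes it to be a projection.\<close>

definition conj_sum ::
  "('a \<Rightarrow> complex mat) \<Rightarrow> complex mat \<Rightarrow> ('a \<Rightarrow> complex mat) \<Rightarrow> complex mat" where
  "conj_sum R A S = mat_sum (deg R) (deg S) (\<lambda>g. R g * A * S (inv g)) (carrier G)"

text \<open>\<open>R h\<close> times the summand of \<open>g\<close> equals the summand of
  \<open>h \<otimes> g\<close> times \<open>S h\<close>, and translation by \<open>h\<close>
  permutes the summands.\<close>

lemma conj_sum_intertwines:
  assumes R: "is_rep G R" and S: "is_rep G S" and A: "A \<in> carrier_mat (deg R) (deg S)"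
    and h: "h \<in> carrier G"
  shows "R h * conj_sum R A S = conj_sum R A S * S h"
proof -
  let ?a = "deg R" and ?b = "deg S"
  have c: "R g * A * S (inv g) \<in> carrier_mat ?a ?b" if "g \<in> carrier G" for g
    using rep_carrier[OF R that] rep_carrier[OF S] that A by (meson inv_closed mult_carrier_mat)
  have "R h * conj_sum R A S = mat_sum ?a ?b (\<lambda>g. R h * (R g * A * S (inv g))) (carrier G)"
    unfolding conj_sum_def by (rule mult_mat_sum) (use rep_carrier[OF R h] c in auto)
  also have "\<dots> = mat_sum ?a ?b (\<lambda>g. R (h \<otimes> g) * A * S (inv (h \<otimes> g)) * S h) (carrier G)"
  proof (rule mat_sum_cong)
    fix g assume g: "g \<in> carrier G"
    have cs: "R h \<in> carrier_mat ?a ?a" "R g \<in> carrier_mat ?a ?a" "S (inv g) \<in> carrier_mat ?b ?b"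
      "S (inv (h \<otimes> g)) \<in> carrier_mat ?b ?b" "S h \<in> carrier_mat ?b ?b"
      using g h rep_carrier[OF R] rep_carrier[OF S] by auto
    have "S (inv (h \<otimes> g)) * S h = S (inv g)"
      using g h by (simp add: inv_mult_group m_assoc flip: rep_mult[OF S])
    then have "R (h \<otimes> g) * A * S (inv (h \<otimes> g)) * S h = R h * R g * A * S (inv g)"
      using assoc_mult_mat[of "R (h \<otimes> g) * A" ?a ?b "S (inv (h \<otimes> g))" ?b "S h" ?b] cs A
      by (simp add: rep_mult[OF R h g])
    also have "\<dots> = R h * (R g * A * S (inv g))"
      using cs A assoc_mult_mat[of "R h" ?a ?a "R g" ?a A ?b]
        assoc_mult_mat[of "R h" ?a ?a "R g * A" ?b "S (inv g)" ?b] by simp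
    finally show "R h * (R g * A * S (inv g)) = R (h \<otimes> g) * A * S (inv (h \<otimes> g)) * S h" ..
  qed
  also have "\<dots> = mat_sum ?a ?b (\<lambda>g. R g * A * S (inv g) * S h) (carrier G)"
    unfolding mat_sum_def using sum_translate[OF h, of "\<lambda>g. (R g * A * S (inv g) * S h) $$ _"] by simp
  also have "\<dots> = conj_sum R A S * S h"
    unfolding conj_sum_def by (rule mat_sum_mult[symmetric]) (use rep_carrier[OF S h] c in auto)
  finally show ?thesis .
qed

end

context fin_group
begin

subsection \<open>Schur's lemma and orthogonality of characters\<close>

text \<open>The kernel and the image of \<open>B\<close> are invariant, so irreducibility on both
  sides makes a nonzero \<open>B\<close> injective and surjective. The columns of \<open>X\<close>
  are preimages of the unit vectors, which gives a right inverse; injectivity of \<open>B\<close>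
  makes it a left inverse too. The degrees are not yet known to agree, hence both products are
  computed.\<close>

lemma schur:
  assumes R: "irreducible_rep G R" and S: "irreducible_rep G S"
    and B: "B \<in> carrier_mat (deg R) (deg S)"
    and comm: "\<And>g. g \<in> carrier G \<Longrightarrow> R g * B = B * S g"
    and nz: "B \<noteq> 0\<^sub>m (deg R) (deg S)"
  obtains X where "X \<in> carrier_mat (deg S) (deg R)" "B * X = 1\<^sub>m (deg R)" "X * B = 1\<^sub>m (deg S)"
proof -
  let ?a = "deg R" and ?b = "deg S"
  note Rc = rep_carrier[OF irreducible_is_rep[OF R]] and Sc = rep_carrier[OF irreducible_is_rep[OF S]]
  define K where "K = {v \<in> carrier_vec ?b. B *\<^sub>v v = 0\<^sub>v ?a}"
  have "invariant_subspace G S K"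
    unfolding invariant_subspace_def subspace_module_vec_iff
  proof (intro conjI ballI allI)
    show "v + w \<in> K" if "v \<in> K" "w \<in> K" for v w
      using that B by (auto simp: K_def mult_add_distrib_mat_vec[OF B])
    show "c \<cdot>\<^sub>v v \<in> K" if "v \<in> K" for c v
      using that B by (auto simp: K_def mult_mat_vec[OF B])
    fix g v assume g: "g \<in> carrier G" and v: "v \<in> K"
    have v': "v \<in> carrier_vec ?b" "B *\<^sub>v v = 0\<^sub>v ?a" using v by (auto simp: K_def)
    have "B *\<^sub>v (S g *\<^sub>v v) = (B * S g) *\<^sub>v v"
      using assoc_mult_mat_vec[OF B Sc[OF g] v'(1)] by simp
    also have "\<dots> = R g *\<^sub>v (B *\<^sub>v v)"
      using assoc_mult_mat_vec[OF Rc[OF g] B v'(1)] comm[OF g] by simp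
    also have "\<dots> = 0\<^sub>v ?a" using v'(2) Rc[OF g] by auto
    finally show "S g *\<^sub>v v \<in> K" using Sc[OF g] v' by (auto simp: K_def)
  qed (use B in \<open>auto simp: K_def\<close>)
  then consider "K = {0\<^sub>v ?b}" | "K = carrier_vec ?b"
    using S by (auto simp: irreducible_rep_def)
  then have K: "K = {0\<^sub>v ?b}"
  proof cases
    case 2
    have "B = 0\<^sub>m ?a ?b"
    proof (rule eq_mat_mult_vecI[OF B])
      fix v :: "complex Matrix.vec" assume "v \<in> carrier_vec ?b"
      then have "v \<in> K" using 2 by simp
      then show "B *\<^sub>v v = 0\<^sub>m ?a ?b *\<^sub>v v" by (auto simp: K_def)
    qed auto
    then show ?thesis using nz by simp
  qed
  define I where "I = (\<lambda>v. B *\<^sub>v v) ` carrier_vec ?b"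
  have "invariant_subspace G R I"
    unfolding invariant_subspace_def subspace_module_vec_iff
  proof (intro conjI ballI allI)
    show "I \<subseteq> carrier_vec ?a" using B by (auto simp: I_def)
    show "0\<^sub>v ?a \<in> I" unfolding I_def using B by (intro image_eqI[of _ _ "0\<^sub>v ?b"]) auto
    show "v + w \<in> I" if "v \<in> I" "w \<in> I" for v w
      using that B unfolding I_def by (auto simp flip: mult_add_distrib_mat_vec)
    show "c \<cdot>\<^sub>v v \<in> I" if "v \<in> I" for c v
      using that B unfolding I_def by (auto simp flip: mult_mat_vec)
    fix g v assume g: "g \<in> carrier G" and v: "v \<in> I"
    then obtain w where w: "w \<in> carrier_vec ?b" "v = B *\<^sub>v w" by (auto simp: I_def)
    have "R g *\<^sub>v v = B *\<^sub>v (S g *\<^sub>v w)"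
      using assoc_mult_mat_vec[OF B Sc[OF g] w(1)] assoc_mult_mat_vec[OF Rc[OF g] B w(1)] comm[OF g]
      by (simp add: w(2))
    then show "R g *\<^sub>v v \<in> I" using w(1) Sc[OF g] by (auto simp: I_def)
  qed
  then consider "I = {0\<^sub>v ?a}" | "I = carrier_vec ?a"
    using R by (auto simp: irreducible_rep_def)
  then have I: "I = carrier_vec ?a"
  proof cases
    case 1
    have "B = 0\<^sub>m ?a ?b"
    proof (rule eq_mat_mult_vecI[OF B])
      fix v :: "complex Matrix.vec" assume v: "v \<in> carrier_vec ?b"
      then have "B *\<^sub>v v \<in> I" by (auto simp: I_def)
      then show "B *\<^sub>v v = 0\<^sub>m ?a ?b *\<^sub>v v" using 1 v by auto
    qed auto
    then show ?thesis using nz by simp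
  qed
  have "\<exists>x. x \<in> carrier_vec ?b \<and> B *\<^sub>v x = unit_vec ?a j" if "j < ?a" for j
  proof -
    have "unit_vec ?a j \<in> I" unfolding I by simp
    then show ?thesis unfolding I_def by auto
  qed
  then obtain x where x: "\<And>j. j < ?a \<Longrightarrow> x j \<in> carrier_vec ?b \<and> B *\<^sub>v x j = unit_vec ?a j"
    by metis
  define X where "X = Matrix.mat ?b ?a (\<lambda>(i, j). vec_index (x j) i)"
  have X: "X \<in> carrier_mat ?b ?a" by (simp add: X_def)
  have BX: "B * X = 1\<^sub>m ?a"
  proof (rule eq_matI)
    fix i j assume "i < dim_row (1\<^sub>m ?a)" "j < dim_col (1\<^sub>m ?a)"
    then have ij: "i < ?a" "j < ?a" by auto
    have "(B * X) $$ (i, j) = vec_index (B *\<^sub>v x j) i"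
      using x[OF ij(2)] ij mult_mat_vec_index_sum[OF B, of "x j" i] mult_mat_index_sum[OF B X ij]
      by (simp add: X_def)
    then show "(B * X) $$ (i, j) = 1\<^sub>m ?a $$ (i, j)"
      using x ij by auto
  qed (use carrier_matD[OF B] carrier_matD[OF X] in auto)
  have "X * B = 1\<^sub>m ?b"
  proof (rule eq_mat_mult_vecI)
    fix v :: "complex Matrix.vec" assume v: "v \<in> carrier_vec ?b"
    have Bv: "B *\<^sub>v v \<in> carrier_vec ?a" and XBv: "X *\<^sub>v (B *\<^sub>v v) \<in> carrier_vec ?b"
      using B X v by auto
    have "B *\<^sub>v (X *\<^sub>v (B *\<^sub>v v)) = B *\<^sub>v v"
      using assoc_mult_mat_vec[OF B X Bv] BX Bv by simp
    then have "B *\<^sub>v (X *\<^sub>v (B *\<^sub>v v) - v) = 0\<^sub>v ?a"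
      using mult_minus_distrib_mat_vec[OF B XBv v] Bv by simp
    then have "X *\<^sub>v (B *\<^sub>v v) - v \<in> K"
      using XBv v unfolding K_def by auto
    then have *: "X *\<^sub>v (B *\<^sub>v v) - v = 0\<^sub>v ?b" using K by auto
    have "X *\<^sub>v (B *\<^sub>v v) = (X *\<^sub>v (B *\<^sub>v v) - v) + v"
      using XBv v X by (intro eq_vecI) auto
    then have "X *\<^sub>v (B *\<^sub>v v) = v" using * v by simp
    then show "(X * B) *\<^sub>v v = 1\<^sub>m ?b *\<^sub>v v"
      using assoc_mult_mat_vec[OF X B v] v by simp
  qed (use B X in auto)
  then show thesis using that X BX by blast
qed

lemma schur_zero:
  assumes R: "irreducible_rep G R" and S: "irreducible_rep G S"
    and B: "B \<in> carrier_mat (deg R) (deg S)"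
    and comm: "\<And>g. g \<in> carrier G \<Longrightarrow> R g * B = B * S g"
    and niso: "\<not> rep_iso G R S"
  shows "B = 0\<^sub>m (deg R) (deg S)"
proof (rule ccontr)
  assume "B \<noteq> 0\<^sub>m (deg R) (deg S)"
  then obtain X where X: "X \<in> carrier_mat (deg S) (deg R)" "B * X = 1\<^sub>m (deg R)" "X * B = 1\<^sub>m (deg S)"
    using schur[OF R S B comm] by blast
  then have d: "deg S = deg R"
    using inverse_mat_dims_eq[OF B X(1)] by simp
  \<comment> \<open>\<open>B\<close> maps the space of \<open>S\<close> to that of \<open>R\<close>,
    so the isomorphism obtained runs in the opposite direction and has to be inverted.\<close>
  have "rep_iso G S R"
    by (rule rep_isoI[of _ "deg R" _ B X]) (use d B X comm in auto)
  then show False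
    using niso rep_iso_sym R S irreducible_is_rep by blast
qed

text \<open>For an eigenvalue \<open>c\<close> of \<open>B\<close>, the difference of
  \<open>B\<close> and the scalar \<open>c\<close> still commutes with the group but kills an
  eigenvector, so it has no inverse and vanishes by \<open>schur\<close>. The positive degree
  guarantees an eigenvalue.\<close>

lemma schur_scalar:
  assumes R: "irreducible_rep G R" and B: "B \<in> carrier_mat (deg R) (deg R)"
    and comm: "\<And>g. g \<in> carrier G \<Longrightarrow> R g * B = B * R g"
  obtains c where "B = c \<cdot>\<^sub>m 1\<^sub>m (deg R)"
proof -
  let ?a = "deg R"
  note Rc = rep_carrier[OF irreducible_is_rep[OF R]]
  have "?a > 0" using R by (simp add: irreducible_rep_def)
  then obtain c where "eigenvalue B c"
    using spectrum_non_empty[OF B] by (auto simp: spectrum_def)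
  then obtain v where v: "v \<in> carrier_vec ?a" "v \<noteq> 0\<^sub>v ?a" "B *\<^sub>v v = c \<cdot>\<^sub>v v"
    using B by (auto simp: eigenvalue_def eigenvector_def)
  define C where "C = B - c \<cdot>\<^sub>m 1\<^sub>m ?a"
  have C: "C \<in> carrier_mat ?a ?a" unfolding C_def by (rule minus_carrier_mat) simp
  have Cv: "C *\<^sub>v v = 0\<^sub>v ?a"
  proof -
    have "C *\<^sub>v v = B *\<^sub>v v - (c \<cdot>\<^sub>m 1\<^sub>m ?a) *\<^sub>v v"
      unfolding C_def by (rule minus_mult_distrib_mat_vec[OF B _ v(1)]) simp
    also have "(c \<cdot>\<^sub>m 1\<^sub>m ?a) *\<^sub>v v = c \<cdot>\<^sub>v v"
      using v(1) by (intro eq_vecI) auto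
    finally show ?thesis using v by simp
  qed
  have "C = 0\<^sub>m ?a ?a"
  proof (rule ccontr)
    assume nz: "C \<noteq> 0\<^sub>m ?a ?a"
    have "R g * C = C * R g" if g: "g \<in> carrier G" for g
    proof -
      have "R g * C = R g * B - R g * (c \<cdot>\<^sub>m 1\<^sub>m ?a)"
        unfolding C_def by (rule mult_minus_distrib_mat[OF Rc[OF g] B]) simp
      moreover have "C * R g = B * R g - (c \<cdot>\<^sub>m 1\<^sub>m ?a) * R g"
        unfolding C_def by (rule minus_mult_distrib_mat[OF B _ Rc[OF g]]) simp
      moreover have "R g * (c \<cdot>\<^sub>m 1\<^sub>m ?a) = (c \<cdot>\<^sub>m 1\<^sub>m ?a) * R g"
        using Rc[OF g] mult_smult_distrib[OF Rc[OF g], of "1\<^sub>m ?a" ?a c]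
          mult_smult_assoc_mat[of "1\<^sub>m ?a" ?a ?a "R g" ?a c] by simp
      ultimately show ?thesis using comm[OF g] by simp
    qed
    then obtain X where X: "X \<in> carrier_mat ?a ?a" "X * C = 1\<^sub>m ?a"
      using schur[OF R R C _ nz] by blast
    have "v = X *\<^sub>v (C *\<^sub>v v)"
      using assoc_mult_mat_vec[OF X(1) C v(1)] X(2) v(1) by simp
    then show False using Cv X(1) v(2) by auto
  qed
  then have "(B - c \<cdot>\<^sub>m 1\<^sub>m ?a) $$ (i, j) = 0" if "i < ?a" "j < ?a" for i j
    using that by (simp add: C_def)
  then have "B = c \<cdot>\<^sub>m 1\<^sub>m ?a"
    using B by (intro eq_matI) auto
  then show thesis by (rule that)
qed

lemma conj_sum_carrier [simp]: "conj_sum R A S \<in> carrier_mat (deg R) (deg S)"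
  by (simp add: conj_sum_def)

text \<open>The matrix units: \<open>A * elem_mat a b j k * B\<close> involves only column
  \<open>j\<close> of \<open>A\<close> and row \<open>k\<close> of \<open>B\<close>, so averaging it
  yields sums of products of single matrix coefficients.\<close>

definition elem_mat :: "nat \<Rightarrow> nat \<Rightarrow> nat \<Rightarrow> nat \<Rightarrow> complex mat" where
  "elem_mat a b j k = Matrix.mat a b (\<lambda>(i, l). if i = j \<and> l = k then 1 else 0)"

lemma elem_mat_carrier [simp]: "elem_mat a b j k \<in> carrier_mat a b"
  by (simp add: elem_mat_def)

lemma mult_elem_mat_mult_index:
  assumes A: "A \<in> carrier_mat n a" and B: "B \<in> carrier_mat b m" and "j < a" "k < b" "i < n" "l < m"
  shows "(A * elem_mat a b j k * B) $$ (i, l) = A $$ (i, j) * B $$ (k, l)"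
proof -
  have *: "(A * elem_mat a b j k) $$ (i, q) = (if q = k then A $$ (i, j) else 0)" if "q < b" for q
  proof -
    have "(A * elem_mat a b j k) $$ (i, q) = (\<Sum>p<a. if p = j then (if q = k then A $$ (i, j) else 0) else 0)"
      using assms that
      by (subst mult_mat_index_sum[OF A elem_mat_carrier]) (auto simp: elem_mat_def mult_delta_right)
    then show ?thesis using assms by simp
  qed
  have "(A * elem_mat a b j k * B) $$ (i, l) = (\<Sum>q<b. if q = k then A $$ (i, j) * B $$ (k, l) else 0)"
    using assms by (subst mult_mat_index_sum[OF mult_carrier_mat[OF A elem_mat_carrier] B])
      (auto simp: * mult_delta_left)
  then show ?thesis using assms by simp
qed

lemma conj_sum_elem_index:
  assumes "is_rep G R" "is_rep G S" "j < deg R" "k < deg S" "i < deg R" "l < deg S"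
  shows "conj_sum R (elem_mat (deg R) (deg S) j k) S $$ (i, l) =
    (\<Sum>g\<in>carrier G. R g $$ (i, j) * S (inv g) $$ (k, l))"
  using assms mult_elem_mat_mult_index[OF rep_carrier[OF assms(1)] rep_carrier[OF assms(2)]]
  by (auto simp: conj_sum_def mat_sum_index intro!: sum.cong)

text \<open>Rewrites the pairing of two characters as a sum of entries of intertwiners, to which
  Schur's lemma applies.\<close>

lemma sum_char_mult_char_inv:
  assumes "is_rep G R" "is_rep G S"
  shows "(\<Sum>g\<in>carrier G. char R g * char S (inv g)) =
    (\<Sum>i<deg R. \<Sum>k<deg S. conj_sum R (elem_mat (deg R) (deg S) i k) S $$ (i, k))"
proof -
  have "(\<Sum>g\<in>carrier G. char R g * char S (inv g)) =
      (\<Sum>g\<in>carrier G. \<Sum>i<deg R. \<Sum>k<deg S. R g $$ (i, i) * S (inv g) $$ (k, k))"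
    using rep_carrier[OF assms(1)] rep_carrier[OF assms(2)]
    by (auto simp: char_def mat_trace_def sum_product intro!: sum.cong)
  also have "\<dots> = (\<Sum>i<deg R. \<Sum>k<deg S. \<Sum>g\<in>carrier G. R g $$ (i, i) * S (inv g) $$ (k, k))"
    by (subst sum.swap, rule sum.cong[OF refl], subst sum.swap, rule refl)
  finally show ?thesis
    by (simp add: conj_sum_elem_index[OF assms])
qed

text \<open>Without an isomorphism all averaged matrix units vanish. Otherwise \<open>S\<close> may
  be replaced by \<open>R\<close> and every averaged matrix unit is a scalar matrix, nonzero only
  for \<open>i = k\<close>; the \<open>deg R\<close> remaining entries each contribute the group
  order divided by \<open>deg R\<close>.\<close>

theorem char_orthogonality:
  assumes R: "irreducible_rep G R" and S: "irreducible_rep G S"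
  shows "(\<Sum>g\<in>carrier G. char R g * char S (inv g)) = (if rep_iso G R S then of_nat (card (carrier G)) else 0)"
proof (cases "rep_iso G R S")
  case False
  note r = irreducible_is_rep[OF R] irreducible_is_rep[OF S]
  have "conj_sum R (elem_mat (deg R) (deg S) i k) S = 0\<^sub>m (deg R) (deg S)" for i k
    by (rule schur_zero[OF R S _ _ False])
      (auto simp: conj_sum_intertwines[OF r])
  then show ?thesis
    using False by (simp add: sum_char_mult_char_inv[OF r])
next
  case True
  let ?a = "deg R"
  note r = irreducible_is_rep[OF R] irreducible_is_rep[OF S]
  have a: "?a > 0" using R by (simp add: irreducible_rep_def)
  have entry: "conj_sum R (elem_mat ?a ?a i k) R $$ (i, k) =
      (if i = k then of_nat (card (carrier G)) / of_nat ?a else 0)" if ik: "i < ?a" "k < ?a" for i k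
  proof -
    obtain c where c: "conj_sum R (elem_mat ?a ?a i k) R = c \<cdot>\<^sub>m 1\<^sub>m ?a"
      using schur_scalar[OF R conj_sum_carrier conj_sum_intertwines[OF r(1) r(1) elem_mat_carrier]]
      by blast
    \<comment> \<open>The scalar is found from its trace: summing the diagonal turns products of
      coefficients into entries of \<open>R (inv g) * R g\<close>, the identity.\<close>
    have "c * of_nat ?a = mat_trace (conj_sum R (elem_mat ?a ?a i k) R)"
      unfolding c by (simp add: mat_trace_smult[of _ ?a])
    also have "\<dots> = (\<Sum>l<?a. \<Sum>g\<in>carrier G. R g $$ (l, i) * R (inv g) $$ (k, l))"
      unfolding mat_trace_def carrier_matD(1)[OF conj_sum_carrier]
      by (simp add: conj_sum_elem_index[OF r(1) r(1)] ik)
    also have "\<dots> = (\<Sum>g\<in>carrier G. (R (inv g) * R g) $$ (k, i))"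
      by (subst sum.swap)
        (auto simp: mult_mat_index_sum[OF rep_carrier[OF r(1)] rep_carrier[OF r(1)]] ik mult.commute
          simp del: index_mult_mat(1) intro!: sum.cong)
    also have "\<dots> = (if i = k then of_nat (card (carrier G)) else 0)"
      using ik by (simp add: rep_inv[OF r(1)])
    finally have "c = (if i = k then of_nat (card (carrier G)) / of_nat ?a else 0)"
      using a by (auto simp: field_simps split: if_splits)
    then show ?thesis using ik by (simp add: c)
  qed
  have "(\<Sum>g\<in>carrier G. char R g * char S (inv g)) = (\<Sum>g\<in>carrier G. char R g * char R (inv g))"
    using char_eq_of_iso[OF True r] by simp
  also have "\<dots> = (\<Sum>i<?a. \<Sum>k<?a. if i = k then of_nat (card (carrier G)) / of_nat ?a else 0)"
    by (simp add: sum_char_mult_char_inv[OF r(1) r(1)] entry)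
  also have "\<dots> = of_nat (card (carrier G))"
    using a by simp
  finally show ?thesis using True by simp
qed

end

text \<open>Two matrices on top of each other are encoded as a \<open>four_block_mat\<close> whose
  right-hand blocks have width 0, so that the multiplication rule for four blocks applies.\<close>

lemma stack_mult:
  assumes "M1 \<in> carrier_mat a n" "M2 \<in> carrier_mat b n" "C \<in> carrier_mat n n"
  shows "four_block_mat M1 (0\<^sub>m a 0) M2 (0\<^sub>m b 0) * C = four_block_mat (M1 * C) (0\<^sub>m a 0) (M2 * C) (0\<^sub>m b 0)"
proof -
  have "C = four_block_mat C (0\<^sub>m n 0) (0\<^sub>m 0 n) (0\<^sub>m 0 0)"
    using assms by (intro eq_matI) auto
  then have "four_block_mat M1 (0\<^sub>m a 0) M2 (0\<^sub>m b 0) * C =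
      four_block_mat M1 (0\<^sub>m a 0) M2 (0\<^sub>m b 0) * four_block_mat C (0\<^sub>m n 0) (0\<^sub>m 0 n) (0\<^sub>m 0 0)"
    by simp
  also have "\<dots> = four_block_mat (M1 * C) (0\<^sub>m a 0) (M2 * C) (0\<^sub>m b 0)"
    by (subst mult_four_block_mat[of _ a n _ 0 _ b _ _ n _ 0]) (use assms in auto)
  finally show ?thesis .
qed

lemma diag2_mult_stack:
  assumes "M1 \<in> carrier_mat a n" "M2 \<in> carrier_mat b n" "A \<in> carrier_mat a a" "B \<in> carrier_mat b b"
  shows "diag2_mat A B * four_block_mat M1 (0\<^sub>m a 0) M2 (0\<^sub>m b 0) =
    four_block_mat (A * M1) (0\<^sub>m a 0) (B * M2) (0\<^sub>m b 0)"
  using assms by (subst mult_four_block_mat[of _ a a _ b _ b _ _ n _ 0]) auto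

lemma mat_dim_zero_mult:
  fixes A B :: "complex mat"
  assumes "A \<in> carrier_mat n 0" "B \<in> carrier_mat 0 m"
  shows "A * B = 0\<^sub>m n m"
  using assms by (intro eq_matI) (auto simp: scalar_prod_def)

context fin_group
begin

subsection \<open>Complete reducibility\<close>

lemma rep_split:
  assumes R: "is_rep G R" and pos: "deg R > 0" and red: "\<not> irreducible_rep G R"
  obtains R1 R2 P Q where "is_rep G R1" "is_rep G R2" "deg R1 < deg R" "deg R2 < deg R"
    "deg R1 + deg R2 = deg R" "P \<in> carrier_mat (deg R) (deg R)" "Q \<in> carrier_mat (deg R) (deg R)"
    "P * Q = 1\<^sub>m (deg R)" "Q * P = 1\<^sub>m (deg R)"
    "\<And>g. g \<in> carrier G \<Longrightarrow> P * R g = diag2_mat (R1 g) (R2 g) * P"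
proof -
  let ?n = "deg R" and ?N = "of_nat (card (carrier G)) :: complex"
  note Rc = rep_carrier[OF R]
  have N: "?N \<noteq> 0" using finite_carrier one_closed by (auto simp: card_eq_0_iff)
  obtain W where W: "invariant_subspace G R W" "W \<noteq> {0\<^sub>v ?n}" "W \<noteq> carrier_vec ?n"
    using R pos red by (auto simp: irreducible_rep_def)
  have sub: "VectorSpace.subspace class_ring W (module_vec TYPE(complex) ?n)"
    and inv: "\<And>g v. g \<in> carrier G \<Longrightarrow> v \<in> W \<Longrightarrow> R g *\<^sub>v v \<in> W"
    using W(1) by (auto simp: invariant_subspace_def)
  have Wn: "W \<subseteq> carrier_vec ?n" "0\<^sub>v ?n \<in> W" using sub by (auto simp: subspace_module_vec_iff)
  obtain k L where L: "L \<in> carrier_mat ?n k" "\<And>v. v \<in> W \<Longrightarrow> L *\<^sub>v (mat_adjoint L *\<^sub>v v) = v"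
    "\<And>v. v \<in> carrier_vec k \<Longrightarrow> L *\<^sub>v v \<in> W"
    using sub by (rule subspace_orthonormal_basis) blast
  define P0 where "P0 = L * mat_adjoint L"
  have P0: "P0 \<in> carrier_mat ?n ?n" using L(1) unfolding P0_def by (meson mat_adjoint_carrier mult_carrier_mat)
  have P0v: "P0 *\<^sub>v v = L *\<^sub>v (mat_adjoint L *\<^sub>v v)" if "v \<in> carrier_vec ?n" for v
    unfolding P0_def by (rule assoc_mult_mat_vec[OF L(1) mat_adjoint_carrier[OF L(1)] that])
  have P0_W: "P0 *\<^sub>v v \<in> W" if "v \<in> carrier_vec ?n" for v
    unfolding P0v[OF that] by (rule L(3)[OF mult_mat_vec_carrier[OF mat_adjoint_carrier[OF L(1)] that]])
  have P0_id: "P0 *\<^sub>v v = v" if "v \<in> W" for v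
    using P0v L(2) Wn that by auto
  \<comment> \<open>The image of \<open>P0\<close> is invariant and \<open>P0\<close> fixes it
    pointwise; this property makes the average of the conjugates of \<open>P0\<close> a projection
    again.\<close>
  have P0R: "P0 * (R g * P0) = R g * P0" if g: "g \<in> carrier G" for g
  proof (rule eq_mat_mult_vecI)
    fix v :: "complex Matrix.vec" assume v: "v \<in> carrier_vec ?n"
    have "R g *\<^sub>v (P0 *\<^sub>v v) \<in> W" using inv g P0_W v by blast
    then show "(P0 * (R g * P0)) *\<^sub>v v = (R g * P0) *\<^sub>v v"
      using assoc_mult_mat_vec[OF P0 mult_carrier_mat[OF Rc[OF g] P0] v]
        assoc_mult_mat_vec[OF Rc[OF g] P0 v] P0_id by simp
  qed (use P0 Rc[OF g] in auto)
  \<comment> \<open>Averaging a projection onto the invariant subspace makes it commute with the group.\<close>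
  define P where "P = (1 / ?N) \<cdot>\<^sub>m conj_sum R P0 R"
  have P: "P \<in> carrier_mat ?n ?n" by (simp add: P_def)
  have term_c: "R g * P0 * R (inv g) \<in> carrier_mat ?n ?n" if "g \<in> carrier G" for g
    using Rc that P0 by (meson inv_closed mult_carrier_mat)
  have "P0 * conj_sum R P0 R = mat_sum ?n ?n (\<lambda>g. P0 * (R g * P0 * R (inv g))) (carrier G)"
    unfolding conj_sum_def by (rule mult_mat_sum[OF P0 term_c])
  also have "\<dots> = conj_sum R P0 R"
    unfolding conj_sum_def
  proof (rule mat_sum_cong)
    fix g assume g: "g \<in> carrier G"
    show "P0 * (R g * P0 * R (inv g)) = R g * P0 * R (inv g)"
      using assoc_mult_mat[OF P0 mult_carrier_mat[OF Rc[OF g] P0] Rc[OF inv_closed[OF g]]] P0R[OF g]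
      by simp
  qed
  finally have P0P: "P0 * P = P"
    unfolding P_def using mult_smult_distrib[OF P0, of "conj_sum R P0 R" ?n "1 / ?N"] by simp
  have "conj_sum R P0 R * P0 = mat_sum ?n ?n (\<lambda>g. R g * P0 * R (inv g) * P0) (carrier G)"
    unfolding conj_sum_def by (rule mat_sum_mult[OF P0 term_c])
  also have "\<dots> = mat_sum ?n ?n (\<lambda>g. P0) (carrier G)"
  proof (rule mat_sum_cong)
    fix g assume g: "g \<in> carrier G"
    note c = Rc[OF g] Rc[OF inv_closed[OF g]]
    have "R g * P0 * R (inv g) * P0 = R g * (P0 * (R (inv g) * P0))"
      using c P0 by (simp add: assoc_mult_mat[of _ ?n ?n _ ?n _ ?n] mult_carrier_mat[of _ ?n ?n _ ?n])
    also have "\<dots> = R g * (R (inv g) * P0)"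
      using P0R[OF inv_closed[OF g]] by simp
    also have "\<dots> = P0"
      using assoc_mult_mat[OF c P0] rep_inv[OF R g] P0 by simp
    finally show "R g * P0 * R (inv g) * P0 = P0" .
  qed
  also have "\<dots> = ?N \<cdot>\<^sub>m P0" by (rule mat_sum_const[OF P0])
  finally have "conj_sum R P0 R * P0 = ?N \<cdot>\<^sub>m P0" .
  then have "P * P0 = (1 / ?N) \<cdot>\<^sub>m (?N \<cdot>\<^sub>m P0)"
    unfolding P_def using mult_smult_assoc_mat[of "conj_sum R P0 R" ?n ?n P0 ?n "1 / ?N"] P0 by simp
  also have "\<dots> = P0" using N P0 by (intro eq_matI) auto
  finally have PP0: "P * P0 = P0" .
  \<comment> \<open>\<open>P0 * P = P\<close> and \<open>P * P0 = P0\<close> express that both have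
    the same image, and together they give idempotence.\<close>
  have PP: "P * P = P"
    using assoc_mult_mat[OF P P0 P] PP0 P0P by simp
  have PR: "R g * P = P * R g" if g: "g \<in> carrier G" for g
    unfolding P_def
    using mult_smult_distrib[OF Rc[OF g], of "conj_sum R P0 R" ?n "1 / ?N"]
      mult_smult_assoc_mat[of "conj_sum R P0 R" ?n ?n "R g" ?n "1 / ?N"] Rc[OF g]
      conj_sum_intertwines[OF R R P0 g] by simp
  define P' where "P' = 1\<^sub>m ?n - P"
  have P': "P' \<in> carrier_mat ?n ?n" unfolding P'_def by (rule minus_carrier_mat[OF P])
  have PP': "P * P' = 0\<^sub>m ?n ?n" "P' * P = 0\<^sub>m ?n ?n"
    unfolding P'_def using mult_minus_distrib_mat[OF P one_carrier_mat P]
      minus_mult_distrib_mat[OF one_carrier_mat P P] P PP by auto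
  have P'P': "P' * P' = P'"
    using minus_mult_distrib_mat[OF one_carrier_mat P P'] PP'(1) P'
    by (auto simp: P'_def[symmetric] intro!: eq_matI)
  have P'R: "R g * P' = P' * R g" if g: "g \<in> carrier G" for g
    unfolding P'_def using mult_minus_distrib_mat[OF Rc[OF g] one_carrier_mat P]
      minus_mult_distrib_mat[OF one_carrier_mat P Rc[OF g]] PR[OF g] Rc[OF g] by simp
  have sum1: "P + P' = 1\<^sub>m ?n"
    unfolding P'_def using P by (intro eq_matI) auto
  obtain a L1 M1 where 1: "L1 \<in> carrier_mat ?n a" "M1 \<in> carrier_mat a ?n" "M1 * L1 = 1\<^sub>m a" "L1 * M1 = P"
    using P PP by (rule idempotent_mat_factorization)
  obtain b L2 M2 where 2: "L2 \<in> carrier_mat ?n b" "M2 \<in> carrier_mat b ?n" "M2 * L2 = 1\<^sub>m b" "L2 * M2 = P'"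
    using P' P'P' by (rule idempotent_mat_factorization)
  \<comment> \<open>For an idempotent \<open>E = L * M\<close> commuting with the group,
    \<open>M * R g * L\<close> is the action on the image of \<open>E\<close> in coordinates.
    Multiplicativity holds because an inner \<open>L * M\<close> can be moved to the left and
    absorbed by \<open>M * E = M\<close>.\<close>
  have sub_rep: "is_rep G (\<lambda>g. M * R g * L)" "deg (\<lambda>g. M * R g * L) = c"
      "\<And>g. g \<in> carrier G \<Longrightarrow> M * R g * L * M = M * R g"
    if LM: "L \<in> carrier_mat ?n c" "M \<in> carrier_mat c ?n" "M * L = 1\<^sub>m c" "L * M = E"
      and ER: "\<And>g. g \<in> carrier G \<Longrightarrow> R g * E = E * R g" for L M E c
  proof -
    have ME: "M * E = M"
      using assoc_mult_mat[OF LM(2,1,2)] LM by simp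
    show *: "M * R g * L * M = M * R g" if g: "g \<in> carrier G" for g
    proof -
      have "M * R g * L * M = M * (R g * E)"
        using assoc_mult_mat[OF mult_carrier_mat[OF LM(2) Rc[OF g]] LM(1,2)]
          assoc_mult_mat[OF LM(2) Rc[OF g] mult_carrier_mat[OF LM(1,2)]] LM(4) by simp
      also have "\<dots> = M * E * R g"
        using assoc_mult_mat[OF LM(2) mult_carrier_mat[OF LM(1,2)] Rc[OF g]] LM(4) ER[OF g] by simp
      finally show ?thesis using ME by simp
    qed
    have "M * R (g \<otimes> h) * L = (M * R g * L) * (M * R h * L)" if g: "g \<in> carrier G" and h: "h \<in> carrier G" for g h
    proof -
      have "(M * R g * L) * (M * R h * L) = M * R g * L * M * (R h * L)"
        using assoc_mult_mat[OF mult_carrier_mat[OF mult_carrier_mat[OF LM(2) Rc[OF g]] LM(1)] LM(2)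
            mult_carrier_mat[OF Rc[OF h] LM(1)]]
          assoc_mult_mat[OF LM(2) Rc[OF h] LM(1)] by simp
      also have "\<dots> = M * R g * (R h * L)" unfolding *[OF g] ..
      also have "\<dots> = M * R (g \<otimes> h) * L"
        using assoc_mult_mat[OF LM(2) Rc[OF g] mult_carrier_mat[OF Rc[OF h] LM(1)]]
          assoc_mult_mat[OF LM(2) mult_carrier_mat[OF Rc[OF g] Rc[OF h]] LM(1)]
          assoc_mult_mat[OF Rc[OF g] Rc[OF h] LM(1)] by (simp add: rep_mult[OF R g h])
      finally show ?thesis ..
    qed
    moreover have "M * R \<one> * L = 1\<^sub>m c" using LM by (simp add: rep_one[OF R])
    moreover have "M * R g * L \<in> carrier_mat c c" if "g \<in> carrier G" for g
      using LM Rc[OF that] by (meson mult_carrier_mat)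
    ultimately show "is_rep G (\<lambda>g. M * R g * L)" "deg (\<lambda>g. M * R g * L) = c"
      using is_repI[of "\<lambda>g. M * R g * L" c] by auto
  qed
  have s1: "is_rep G (\<lambda>g. M1 * R g * L1)" "deg (\<lambda>g. M1 * R g * L1) = a"
      "\<And>g. g \<in> carrier G \<Longrightarrow> M1 * R g * L1 * M1 = M1 * R g"
    by (rule sub_rep[OF 1 PR]; assumption)+
  have s2: "is_rep G (\<lambda>g. M2 * R g * L2)" "deg (\<lambda>g. M2 * R g * L2) = b"
      "\<And>g. g \<in> carrier G \<Longrightarrow> M2 * R g * L2 * M2 = M2 * R g"
    by (rule sub_rep[OF 2 P'R]; assumption)+
  have M1L2: "M1 * L2 = 0\<^sub>m a b"
  proof -
    have "M1 * L2 = M1 * P * (P' * L2)"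
      using assoc_mult_mat[OF 1(2,1,2)] assoc_mult_mat[OF 2(1,2,1)] 1 2 by simp
    also have "\<dots> = M1 * ((P * P') * L2)"
      using assoc_mult_mat[OF 1(2) P mult_carrier_mat[OF P' 2(1)]] assoc_mult_mat[OF P P' 2(1)] by simp
    also have "\<dots> = 0\<^sub>m a b" using PP' 1 2 by simp
    finally show ?thesis .
  qed
  have M2L1: "M2 * L1 = 0\<^sub>m b a"
  proof -
    have "M2 * L1 = M2 * P' * (P * L1)"
      using assoc_mult_mat[OF 1(1,2,1)] assoc_mult_mat[OF 2(2,1,2)] 1 2 by simp
    also have "\<dots> = M2 * ((P' * P) * L1)"
      using assoc_mult_mat[OF 2(2) P' mult_carrier_mat[OF P 1(1)]] assoc_mult_mat[OF P' P 1(1)] by simp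
    also have "\<dots> = 0\<^sub>m b a" using PP' 1 2 by simp
    finally show ?thesis .
  qed
  \<comment> \<open>\<open>PP\<close> takes a vector to its coordinates in both images and
    \<open>QQ\<close> recombines them; the blocks with a side of length 0 serve to stack and to
    juxtapose.\<close>
  define PP where "PP = four_block_mat M1 (0\<^sub>m a 0) M2 (0\<^sub>m b 0)"
  define QQ where "QQ = four_block_mat L1 L2 (0\<^sub>m 0 a) (0\<^sub>m 0 b)"
  have cPP: "PP \<in> carrier_mat (a + b) ?n" and cQQ: "QQ \<in> carrier_mat ?n (a + b)"
    using four_block_carrier_mat[OF 1(2), of "0\<^sub>m b 0" b 0 "0\<^sub>m a 0" M2]
      four_block_carrier_mat[OF 1(1), of "0\<^sub>m 0 b" 0 b L2 "0\<^sub>m 0 a"]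
    by (auto simp: PP_def QQ_def)
  have PQ: "PP * QQ = 1\<^sub>m (a + b)"
  proof -
    have "PP * QQ = four_block_mat (1\<^sub>m a) (0\<^sub>m a b) (0\<^sub>m b a) (1\<^sub>m b)"
      unfolding PP_def QQ_def
      by (subst mult_four_block_mat[of _ a ?n _ 0 _ b _ _ a _ b]) (use 1 2 M1L2 M2L1 in auto)
    then show ?thesis by simp
  qed
  have QP: "QQ * PP = 1\<^sub>m ?n"
  proof -
    have "QQ * PP = four_block_mat (1\<^sub>m ?n) (0\<^sub>m ?n 0) (0\<^sub>m 0 ?n) (1\<^sub>m 0)"
      unfolding PP_def QQ_def
      by (subst mult_four_block_mat[of _ ?n a _ b _ 0 _ _ ?n _ 0])
        (use 1 2 sum1 in \<open>auto simp: mat_dim_zero_mult intro!: arg_cong2[where f = "four_block_mat (1\<^sub>m ?n) (0\<^sub>m ?n 0)"] eq_matI\<close>)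
    then show ?thesis by simp
  qed
  have ab: "a + b = ?n"
    using inverse_mat_dims_eq[OF cPP cQQ PQ QP] .
  \<comment> \<open>If one part had dimension 0, then \<open>P0\<close> would be 0 or the identity
    and \<open>W\<close> would be a trivial subspace. Hence both degrees drop, as the later
    induction requires.\<close>
  have "a \<noteq> 0"
  proof
    assume "a = 0"
    then have "P = 0\<^sub>m ?n ?n" using mat_dim_zero_mult 1 by blast
    then have "P0 = 0\<^sub>m ?n ?n" using PP0 P0 by simp
    then have "v = 0\<^sub>v ?n" if "v \<in> W" for v
    proof -
      have "v \<in> carrier_vec ?n" using Wn(1) that by blast
      then have "0\<^sub>m ?n ?n *\<^sub>v v = 0\<^sub>v ?n" by auto
      then show ?thesis using P0_id[OF that] \<open>P0 = 0\<^sub>m ?n ?n\<close> by simp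
    qed
    then show False using W(2) Wn by blast
  qed
  moreover have "b \<noteq> 0"
  proof
    assume "b = 0"
    then have "P' = 0\<^sub>m ?n ?n" using mat_dim_zero_mult 2 by blast
    then have "P = 1\<^sub>m ?n" using sum1 P by simp
    then have "P0 = 1\<^sub>m ?n" using P0P P0 by simp
    then have "v \<in> W" if "v \<in> carrier_vec ?n" for v
      using P0_W[OF that] that by simp
    then show False using W(3) Wn by blast
  qed
  ultimately have lt: "a < ?n" "b < ?n" using ab by auto
  have comm: "PP * R g = diag2_mat (M1 * R g * L1) (M2 * R g * L2) * PP" if g: "g \<in> carrier G" for g
  proof -
    have c: "M1 * R g * L1 \<in> carrier_mat a a" "M2 * R g * L2 \<in> carrier_mat b b"
      using 1 2 Rc[OF g] by (meson mult_carrier_mat)+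
    have "PP * R g = four_block_mat (M1 * R g) (0\<^sub>m a 0) (M2 * R g) (0\<^sub>m b 0)"
      unfolding PP_def by (rule stack_mult[OF 1(2) 2(2) Rc[OF g]])
    also have "\<dots> = diag2_mat (M1 * R g * L1) (M2 * R g * L2) * PP"
      unfolding PP_def diag2_mult_stack[OF 1(2) 2(2) c] s1(3)[OF g] s2(3)[OF g] ..
    finally show ?thesis .
  qed
  show thesis
    by (rule that[OF s1(1) s2(1) _ _ _ _ _ _ QP comm])
      (use s1(2) s2(2) ab lt cPP cQQ PQ in auto)
qed

theorem maschke:
  assumes "is_rep G R"
  obtains Rs where "\<And>Q. Q \<in> set Rs \<Longrightarrow> irreducible_rep G Q" "rep_iso G R (direct_sum_rep Rs)"
proof -
  have "\<exists>Rs. (\<forall>Q\<in>set Rs. irreducible_rep G Q) \<and> rep_iso G R (direct_sum_rep Rs)"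
    using assms
  proof (induction "deg R" arbitrary: R rule: less_induct)
    case less
    note R = less.prems
    consider "deg R = 0" | "irreducible_rep G R" | "deg R > 0" "\<not> irreducible_rep G R" by blast
    then show ?case
    proof cases
      case 1
      \<comment> \<open>Degree 0 is excluded from irreducibility; it is the empty direct
        sum.\<close>
      have "rep_iso G R (direct_sum_rep [])"
      proof (rule rep_isoI[of _ 0 _ "1\<^sub>m 0" "1\<^sub>m 0"])
        show "1\<^sub>m 0 * R g = direct_sum_rep [] g * 1\<^sub>m 0" if "g \<in> carrier G" for g
          using rep_carrier[OF R that] 1 by (intro eq_matI) (auto simp: direct_sum_rep_def)
      qed (use 1 in \<open>auto simp: rep_degree_def direct_sum_rep_def\<close>)
      then show ?thesis by (intro exI[of _ "[]"]) auto
    next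
      case 2
      have "direct_sum_rep [R] = R" by (intro ext) (simp add: direct_sum_rep_def del: diag_block_mat.simps)
      then show ?thesis using 2 rep_iso_refl[OF R] by (intro exI[of _ "[R]"]) simp
    next
      case 3
      obtain R1 R2 P Q where s: "is_rep G R1" "is_rep G R2" "deg R1 < deg R" "deg R2 < deg R"
        "deg R1 + deg R2 = deg R" "P \<in> carrier_mat (deg R) (deg R)" "Q \<in> carrier_mat (deg R) (deg R)"
        "P * Q = 1\<^sub>m (deg R)" "Q * P = 1\<^sub>m (deg R)"
        "\<And>g. g \<in> carrier G \<Longrightarrow> P * R g = diag2_mat (R1 g) (R2 g) * P"
        using rep_split[OF R 3] by blast
      obtain Rs1 Rs2 where Rs1: "\<forall>Q\<in>set Rs1. irreducible_rep G Q" "rep_iso G R1 (direct_sum_rep Rs1)"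
        and Rs2: "\<forall>Q\<in>set Rs2. irreducible_rep G Q" "rep_iso G R2 (direct_sum_rep Rs2)"
        using less.hyps s by meson
      let ?a = "deg R1" and ?b = "deg R2" and ?n = "deg R"
      obtain P1 Q1 where 1: "P1 \<in> carrier_mat ?a ?a" "Q1 \<in> carrier_mat ?a ?a" "P1 * Q1 = 1\<^sub>m ?a"
        "Q1 * P1 = 1\<^sub>m ?a" "\<And>g. g \<in> carrier G \<Longrightarrow> P1 * R1 g = direct_sum_rep Rs1 g * P1"
        using rep_isoE[OF Rs1(2)] by blast
      obtain P2 Q2 where 2: "P2 \<in> carrier_mat ?b ?b" "Q2 \<in> carrier_mat ?b ?b" "P2 * Q2 = 1\<^sub>m ?b"
        "Q2 * P2 = 1\<^sub>m ?b" "\<And>g. g \<in> carrier G \<Longrightarrow> P2 * R2 g = direct_sum_rep Rs2 g * P2"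
        using rep_isoE[OF Rs2(2)] by blast
      have d: "deg (direct_sum_rep Rs1) = ?a" "deg (direct_sum_rep Rs2) = ?b"
        using Rs1(2) Rs2(2) by (auto simp: rep_iso_def)
      have ds: "direct_sum_rep (Rs1 @ Rs2) g = diag2_mat (direct_sum_rep Rs1 g) (direct_sum_rep Rs2 g)" for g
        by (simp add: direct_sum_rep_def diag_block_mat_append Let_def)
      have D1: "direct_sum_rep Rs1 g \<in> carrier_mat ?a ?a" and D2: "direct_sum_rep Rs2 g \<in> carrier_mat ?b ?b"
        if "g \<in> carrier G" for g
        using direct_sum_carrier[OF _ that, of Rs1] direct_sum_carrier[OF _ that, of Rs2]
          deg_direct_sum[of Rs1] deg_direct_sum[of Rs2] Rs1(1) Rs2(1) irreducible_is_rep d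
        by metis+
      define T where "T = diag2_mat P1 P2"
      define U where "U = diag2_mat Q1 Q2"
      have T: "T \<in> carrier_mat ?n ?n" and U: "U \<in> carrier_mat ?n ?n"
        using 1 2 s(5) four_block_carrier_mat[OF 1(1) 2(1)] four_block_carrier_mat[OF 1(2) 2(2)]
        by (auto simp: T_def U_def)
      have TU: "T * U = 1\<^sub>m ?n" and UT: "U * T = 1\<^sub>m ?n"
        unfolding T_def U_def diag2_mat_mult[OF 1(1,2) 2(1,2)] diag2_mat_mult[OF 1(2,1) 2(2,1)] 1(3,4) 2(3,4)
        using s(5) by auto
      have "rep_iso G R (direct_sum_rep (Rs1 @ Rs2))"
      proof (rule rep_isoI[of _ ?n _ "T * P" "Q * U"])
        show "deg (direct_sum_rep (Rs1 @ Rs2)) = ?n"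
          unfolding rep_degree_def[of _ "direct_sum_rep (Rs1 @ Rs2)"] ds
          using carrier_matD(1)[OF D1[OF one_closed]] carrier_matD(1)[OF D2[OF one_closed]] s(5) by simp
        have "T * P * (Q * U) = T * (P * Q * U)" using T U s(6,7)
          by (simp add: assoc_mult_mat[of _ ?n ?n _ ?n _ ?n] mult_carrier_mat[of _ ?n ?n _ ?n])
        then show "T * P * (Q * U) = 1\<^sub>m ?n" using T U s TU by simp
        have "Q * U * (T * P) = Q * (U * T * P)" using T U s(6,7)
          by (simp add: assoc_mult_mat[of _ ?n ?n _ ?n _ ?n] mult_carrier_mat[of _ ?n ?n _ ?n])
        then show "Q * U * (T * P) = 1\<^sub>m ?n" using T U s UT by simp
        fix g assume g: "g \<in> carrier G"
        note Rg = rep_carrier[OF R g] and R1g = rep_carrier[OF s(1) g] and R2g = rep_carrier[OF s(2) g]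
        define D where "D = diag2_mat (R1 g) (R2 g)"
        define D' where "D' = diag2_mat (direct_sum_rep Rs1 g) (direct_sum_rep Rs2 g)"
        have D: "D \<in> carrier_mat ?n ?n" and D': "D' \<in> carrier_mat ?n ?n"
          using four_block_carrier_mat[OF R1g R2g] four_block_carrier_mat[OF D1[OF g] D2[OF g]] s(5)
          by (auto simp: D_def D'_def)
        have "T * P * R g = T * (P * R g)" using T s(6) Rg by simp
        also have "\<dots> = T * D * P" using T s(6) D s(10)[OF g] by (simp add: D_def[symmetric])
        also have "T * D = D' * T"
          unfolding T_def D_def D'_def diag2_mat_mult[OF 1(1) R1g 2(1) R2g]
            diag2_mat_mult[OF D1[OF g] 1(1) D2[OF g] 2(1)] 1(5)[OF g] 2(5)[OF g] ..
        also have "D' * T * P = D' * (T * P)" using T s(6) D' by simp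
        finally show "T * P * R g = direct_sum_rep (Rs1 @ Rs2) g * (T * P)"
          by (simp add: ds D'_def)
      qed (use T U s(6,7) in auto)
      then show ?thesis using Rs1(1) Rs2(1) by (intro exI[of _ "Rs1 @ Rs2"]) auto
    qed
  qed
  then show thesis using that by blast
qed

end

subsection \<open>Tensor products\<close>

text \<open>Quotient and remainder by \<open>m\<close> enumerate all pairs exactly once; this is the
  numbering of basis vectors in \<open>kronecker\<close>.\<close>

lemma sum_div_mod:
  fixes f :: "nat \<Rightarrow> nat \<Rightarrow> 'a :: comm_monoid_add"
  shows "(\<Sum>l<n * m. f (l div m) (l mod m)) = (\<Sum>p<n. \<Sum>q<m. f p q)"
proof -
  have "(\<Sum>l<n * m. f (l div m) (l mod m)) = (\<Sum>(p, q)\<in>{..<n} \<times> {..<m}. f p q)"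
  proof (rule sum.reindex_bij_witness[of _ "\<lambda>(p, q). p * m + q" "\<lambda>l. (l div m, l mod m)"])
    fix l assume l: "l \<in> {..<n * m}"
    then have "m > 0" by (cases m) auto
    then show "(l div m, l mod m) \<in> {..<n} \<times> {..<m}"
      using l by (auto simp: less_mult_imp_div_less)
  next
    fix pq assume "pq \<in> {..<n} \<times> {..<m}"
    then obtain p q where pq: "pq = (p, q)" "p < n" "q < m" by auto
    have "p * m + q < Suc p * m" using pq by simp
    also have "\<dots> \<le> n * m" using pq by (intro mult_le_mono1) auto
    finally show "(case pq of (p, q) \<Rightarrow> p * m + q) \<in> {..<n * m}" by (simp add: pq)
    show "((case pq of (p, q) \<Rightarrow> p * m + q) div m, (case pq of (p, q) \<Rightarrow> p * m + q) mod m) = pq"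
      using pq by simp
  qed auto
  then show ?thesis by (simp add: sum.cartesian_product)
qed

lemma kronecker_carrier [simp]:
  "A \<in> carrier_mat a a' \<Longrightarrow> B \<in> carrier_mat b b' \<Longrightarrow> kronecker A B \<in> carrier_mat (a * b) (a' * b')"
  by (auto simp: kronecker_def)

lemma kronecker_index:
  assumes "A \<in> carrier_mat a a'" "B \<in> carrier_mat b b'" "i < a * b" "j < a' * b'"
  shows "kronecker A B $$ (i, j) = A $$ (i div b, j div b') * B $$ (i mod b, j mod b')"
  using assms by (auto simp: kronecker_def)

lemma div_mod_less_mult:
  fixes i a b :: nat
  assumes "i < a * b"
  shows "i div b < a" "i mod b < b"
proof -
  have "b > 0" using assms by (cases b) auto
  then show "i div b < a" "i mod b < b" using assms by (auto simp: less_mult_imp_div_less)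
qed

lemma kronecker_mult:
  assumes A: "A \<in> carrier_mat a n" and A': "A' \<in> carrier_mat n c"
    and B: "B \<in> carrier_mat b m" and B': "B' \<in> carrier_mat m d"
  shows "kronecker A B * kronecker A' B' = kronecker (A * A') (B * B')"
proof (rule eq_matI)
  note k = kronecker_carrier[OF A B] kronecker_carrier[OF A' B']
  note k' = kronecker_carrier[OF mult_carrier_mat[OF A A'] mult_carrier_mat[OF B B']]
  fix i j assume "i < dim_row (kronecker (A * A') (B * B'))" "j < dim_col (kronecker (A * A') (B * B'))"
  then have ij: "i < a * b" "j < c * d" using carrier_matD[OF k'] by auto
  note dm = div_mod_less_mult[OF ij(1)] div_mod_less_mult[OF ij(2)]
  have "(kronecker A B * kronecker A' B') $$ (i, j) =
      (\<Sum>l<n * m. A $$ (i div b, l div m) * B $$ (i mod b, l mod m) *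
        (A' $$ (l div m, j div d) * B' $$ (l mod m, j mod d)))"
    using ij by (auto simp: mult_mat_index_sum[OF k ij] kronecker_index[OF A B] kronecker_index[OF A' B'] intro!: sum.cong)
  also have "\<dots> = (\<Sum>p<n. \<Sum>q<m. A $$ (i div b, p) * B $$ (i mod b, q) * (A' $$ (p, j div d) * B' $$ (q, j mod d)))"
    by (rule sum_div_mod)
  also have "\<dots> = (A * A') $$ (i div b, j div d) * (B * B') $$ (i mod b, j mod d)"
    using dm by (simp add: mult_mat_index_sum[OF A A'] mult_mat_index_sum[OF B B'] sum_product mult_ac del: index_mult_mat(1))
  also have "\<dots> = kronecker (A * A') (B * B') $$ (i, j)"
    by (rule kronecker_index[OF mult_carrier_mat[OF A A'] mult_carrier_mat[OF B B'] ij, symmetric])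
  finally show "(kronecker A B * kronecker A' B') $$ (i, j) = kronecker (A * A') (B * B') $$ (i, j)" .
qed (use assms in \<open>auto simp: kronecker_def\<close>)

lemma kronecker_one: "kronecker (1\<^sub>m a) (1\<^sub>m b) = 1\<^sub>m (a * b)"
proof (rule eq_matI)
  fix i j assume "i < dim_row (1\<^sub>m (a * b))" "j < dim_col (1\<^sub>m (a * b))"
  then have ij: "i < a * b" "j < a * b" by auto
  have "i = j \<longleftrightarrow> i div b = j div b \<and> i mod b = j mod b"
    by (metis div_mult_mod_eq)
  then show "kronecker (1\<^sub>m a) (1\<^sub>m b) $$ (i, j) = 1\<^sub>m (a * b) $$ (i, j)"
    using ij div_mod_less_mult[OF ij(1)] div_mod_less_mult[OF ij(2)]
    by (auto simp: kronecker_index[of _ a a _ b b])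
qed (auto simp: kronecker_def)

lemma mat_trace_kronecker:
  assumes A: "A \<in> carrier_mat a a" and B: "B \<in> carrier_mat b b"
  shows "mat_trace (kronecker A B) = mat_trace A * mat_trace B"
proof -
  have "mat_trace (kronecker A B) = (\<Sum>l<a * b. A $$ (l div b, l div b) * B $$ (l mod b, l mod b))"
    unfolding mat_trace_def carrier_matD(1)[OF kronecker_carrier[OF A B]]
    by (auto simp: kronecker_index[OF A B] intro!: sum.cong)
  also have "\<dots> = (\<Sum>p<a. \<Sum>q<b. A $$ (p, p) * B $$ (q, q))"
    by (rule sum_div_mod)
  finally show ?thesis
    using carrier_matD(1)[OF A] carrier_matD(1)[OF B] by (simp add: mat_trace_def sum_product)
qed

context fin_group
begin

lemma is_rep_tensor:
  assumes R: "is_rep G R" and S: "is_rep G S"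
  shows "is_rep G (tensor_rep R S)"
proof -
  have c: "tensor_rep R S g \<in> carrier_mat (deg R * deg S) (deg R * deg S)" if "g \<in> carrier G" for g
    using rep_carrier[OF R that] rep_carrier[OF S that] by (simp add: tensor_rep_def)
  have m: "tensor_rep R S (g \<otimes> h) = tensor_rep R S g * tensor_rep R S h"
    if "g \<in> carrier G" "h \<in> carrier G" for g h
    unfolding tensor_rep_def rep_mult[OF R that] rep_mult[OF S that]
    by (rule kronecker_mult[symmetric, OF rep_carrier[OF R that(1)] rep_carrier[OF R that(2)]
          rep_carrier[OF S that(1)] rep_carrier[OF S that(2)]])
  have o: "tensor_rep R S \<one> = 1\<^sub>m (deg R * deg S)"
    by (simp add: tensor_rep_def rep_one[OF R] rep_one[OF S] kronecker_one)
  show "is_rep G (tensor_rep R S)" by (rule is_repI(1)[OF c m o])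
qed

lemma char_tensor:
  assumes "is_rep G R" "is_rep G S" "g \<in> carrier G"
  shows "char (tensor_rep R S) g = char R g * char S g"
  using mat_trace_kronecker[OF rep_carrier[OF assms(1,3)] rep_carrier[OF assms(2,3)]]
  by (simp add: char_def tensor_rep_def)

subsection \<open>Multiplicities\<close>

lemma card_carrier_nonzero: "(of_nat (card (carrier G)) :: complex) \<noteq> 0"
  using finite_carrier one_closed by (auto simp: card_eq_0_iff)

lemma sum_list_char_orthogonality:
  assumes "\<And>Q. Q \<in> set Rs \<Longrightarrow> irreducible_rep G Q" "irreducible_rep G S"
  shows "(\<Sum>g\<in>carrier G. (\<Sum>Q\<leftarrow>Rs. char Q g) * char S (inv g)) =
    of_nat (length (filter (rep_iso G S) Rs)) * of_nat (card (carrier G))"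
  using assms(1)
proof (induction Rs)
  case (Cons Q Rs)
  have Q: "irreducible_rep G Q" using Cons.prems by simp
  have "rep_iso G Q S \<longleftrightarrow> rep_iso G S Q"
    using rep_iso_sym irreducible_is_rep Q assms(2) by blast
  then show ?case
    using Cons.IH Cons.prems char_orthogonality[OF Q assms(2)]
    by (auto simp: distrib_right sum.distrib)
qed simp

lemma char_decomposition:
  assumes "is_rep G R" "\<And>Q. Q \<in> set Rs \<Longrightarrow> irreducible_rep G Q" "rep_iso G R (direct_sum_rep Rs)"
    "g \<in> carrier G"
  shows "char R g = (\<Sum>Q\<leftarrow>Rs. char Q g)"
proof -
  have irr: "\<And>Q. Q \<in> set Rs \<Longrightarrow> is_rep G Q" using assms(2) irreducible_is_rep by blast
  have "direct_sum_rep Rs g \<in> carrier_mat (deg R) (deg R)"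
    using direct_sum_carrier[OF irr assms(4)] deg_direct_sum[OF irr] assms(3)
    by (simp add: rep_iso_def)
  then show ?thesis
    using char_rep_iso[OF assms(3,1,4)] char_direct_sum[OF irr assms(4)] by simp
qed

lemma length_filter_iso:
  assumes "is_rep G R" "irreducible_rep G S" "\<And>Q. Q \<in> set Rs \<Longrightarrow> irreducible_rep G Q"
    "rep_iso G R (direct_sum_rep Rs)"
  shows "of_nat (length (filter (rep_iso G S) Rs)) * of_nat (card (carrier G)) =
    (\<Sum>g\<in>carrier G. char R g * char S (inv g))"
  using sum_list_char_orthogonality[OF assms(3,2)] char_decomposition[OF assms(1,3,4)] by simp

text \<open>The number of summands isomorphic to \<open>S\<close> is a pairing of characters divided
  by the group order, hence the same for every decomposition. This makes the description operator
  denote.\<close>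

lemma multiplicity_rep_eq:
  assumes R: "is_rep G R" and S: "irreducible_rep G S"
    and Rs: "\<And>Q. Q \<in> set Rs \<Longrightarrow> irreducible_rep G Q" "rep_iso G R (direct_sum_rep Rs)"
  shows "multiplicity_rep G S R = length (filter (rep_iso G S) Rs)"
  unfolding multiplicity_rep_def
proof (rule the_equality)
  show "\<exists>Rs'. (\<forall>Q\<in>set Rs'. irreducible_rep G Q) \<and> rep_iso G R (direct_sum_rep Rs') \<and>
     length (filter (rep_iso G S) Rs) = length (filter (rep_iso G S) Rs')"
    using Rs by blast
  fix k assume "\<exists>Rs'. (\<forall>Q\<in>set Rs'. irreducible_rep G Q) \<and> rep_iso G R (direct_sum_rep Rs') \<and>
     k = length (filter (rep_iso G S) Rs')"
  then obtain Rs' where Rs': "\<forall>Q\<in>set Rs'. irreducible_rep G Q" "rep_iso G R (direct_sum_rep Rs')"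
     "k = length (filter (rep_iso G S) Rs')" by blast
  have "(of_nat k :: complex) * of_nat (card (carrier G)) =
      of_nat (length (filter (rep_iso G S) Rs)) * of_nat (card (carrier G))"
    using length_filter_iso[OF R S Rs] length_filter_iso[OF R S _ Rs'(2)] Rs'(1,3) by simp
  then show "k = length (filter (rep_iso G S) Rs)"
    using card_carrier_nonzero by simp
qed

subsection \<open>Isomorphism classes of irreducible representations\<close>

definition irr_rel :: "(('a \<Rightarrow> complex mat) \<times> ('a \<Rightarrow> complex mat)) set" where
  "irr_rel = {(R, S). irreducible_rep G R \<and> irreducible_rep G S \<and> rep_iso G R S}"

lemma equiv_irr_rel: "equiv {R. irreducible_rep G R} irr_rel"
  using rep_iso_refl rep_iso_sym rep_iso_trans irreducible_is_rep
  unfolding equiv_def refl_on_def sym_def trans_def irr_rel_def by blast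

lemma irrep_classes_eq: "irrep_classes G = {R. irreducible_rep G R} // irr_rel"
  by (simp add: irrep_classes_def irr_rel_def)

text \<open>The same choice as in \<open>mckay_adjacency\<close>, so that adjacency unfolds to
  multiplicities between these representatives.\<close>

definition class_rep :: "('a \<Rightarrow> complex mat) set \<Rightarrow> 'a \<Rightarrow> complex mat" where
  "class_rep C = (SOME R. R \<in> C)"

lemma class_rep_in:
  assumes "C \<in> irrep_classes G"
  shows "class_rep C \<in> C" "irreducible_rep G (class_rep C)"
proof -
  have "C \<noteq> {}" using in_quotient_imp_non_empty[OF equiv_irr_rel] assms by (simp add: irrep_classes_eq)
  then show "class_rep C \<in> C" unfolding class_rep_def by (simp add: some_in_eq)
  then show "irreducible_rep G (class_rep C)"
    using in_quotient_imp_subset[OF equiv_irr_rel] assms by (auto simp: irrep_classes_eq)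
qed

lemma mem_class_iff:
  assumes C: "C \<in> irrep_classes G" and Q: "irreducible_rep G Q"
  shows "Q \<in> C \<longleftrightarrow> C = irr_rel `` {Q}"
proof
  assume "Q \<in> C"
  obtain R where R: "C = irr_rel `` {R}"
    using C unfolding irrep_classes_eq by (rule quotientE)
  then have "(R, Q) \<in> irr_rel" using \<open>Q \<in> C\<close> by blast
  then show "C = irr_rel `` {Q}"
    unfolding R by (rule equiv_class_eq[OF equiv_irr_rel])
qed (use equiv_class_self[OF equiv_irr_rel] Q in blast)

lemma rep_iso_class_rep_iff:
  assumes C: "C \<in> irrep_classes G" and Q: "irreducible_rep G Q"
  shows "rep_iso G (class_rep C) Q \<longleftrightarrow> C = irr_rel `` {Q}"
proof -
  have C': "C = irr_rel `` {class_rep C}"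
    using mem_class_iff[OF C class_rep_in(2)[OF C]] class_rep_in(1)[OF C] by simp
  have "rep_iso G (class_rep C) Q \<longleftrightarrow> (class_rep C, Q) \<in> irr_rel"
    using class_rep_in(2)[OF C] Q by (simp add: irr_rel_def)
  also have "\<dots> \<longleftrightarrow> Q \<in> C" using C' by blast
  finally show ?thesis unfolding mem_class_iff[OF C Q] .
qed

lemma class_of_irreducible: "irreducible_rep G Q \<Longrightarrow> irr_rel `` {Q} \<in> irrep_classes G"
  by (simp add: irrep_classes_eq quotientI)

lemma rep_iso_class_reps:
  assumes "C \<in> irrep_classes G" "D \<in> irrep_classes G"
  shows "rep_iso G (class_rep C) (class_rep D) \<longleftrightarrow> C = D"
  using rep_iso_class_rep_iff[OF assms(1) class_rep_in(2)[OF assms(2)]]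
    rep_iso_class_rep_iff[OF assms(2) class_rep_in(2)[OF assms(2)]]
    rep_iso_refl[OF irreducible_is_rep[OF class_rep_in(2)[OF assms(2)]]] by auto

definition class_char :: "('a \<Rightarrow> complex mat) set \<Rightarrow> 'a \<Rightarrow> complex" where
  "class_char C = char (class_rep C)"

lemma class_char_orthogonality:
  assumes "C \<in> irrep_classes G" "D \<in> irrep_classes G"
  shows "(\<Sum>g\<in>carrier G. class_char C g * class_char D (inv g)) =
    (if C = D then of_nat (card (carrier G)) else 0)"
  unfolding class_char_def char_orthogonality[OF class_rep_in(2)[OF assms(1)] class_rep_in(2)[OF assms(2)]]
    rep_iso_class_reps[OF assms] ..

text \<open>Every irreducible representation occurs in the regular representation.\<close>

lemma finite_irrep_classes: "finite (irrep_classes G)"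
proof -
  define N where "N = card (carrier G)"
  obtain e where e: "bij_betw e {..<N} (carrier G)"
    using ex_bij_betw_nat_finite[OF finite_carrier] unfolding N_def atLeast0LessThan by blast
  have e_in: "e i \<in> carrier G" if "i < N" for i using e that by (auto simp: bij_betw_def)
  have e_inj: "e i = e j \<longleftrightarrow> i = j" if "i < N" "j < N" for i j
    using e that by (auto simp: bij_betw_def inj_on_def)
  \<comment> \<open>The regular representation; the enumeration \<open>e\<close> turns group
    elements into matrix indices.\<close>
  define reg where "reg g = Matrix.mat N N (\<lambda>(i, j). if e i = g \<otimes> e j then 1 else 0 :: complex)" for g
  have regc: "reg g \<in> carrier_mat N N" for g by (simp add: reg_def)
  have "reg (g \<otimes> h) = reg g * reg h" if g: "g \<in> carrier G" and h: "h \<in> carrier G" for g h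
  proof (rule eq_matI)
    fix i j assume "i < dim_row (reg g * reg h)" "j < dim_col (reg g * reg h)"
    then have ij: "i < N" "j < N" by (auto simp: reg_def)
    have "(reg g * reg h) $$ (i, j) =
        (\<Sum>l<N. (if e i = g \<otimes> e l then 1 else 0) * (if e l = h \<otimes> e j then 1 else 0))"
      using ij by (subst mult_mat_index_sum[OF regc regc]) (auto simp: reg_def intro!: sum.cong)
    also have "\<dots> = (\<Sum>x\<in>carrier G. (if e i = g \<otimes> x then 1 else 0) * (if x = h \<otimes> e j then 1 else 0))"
      by (rule sum.reindex_bij_betw[OF e])
    also have "\<dots> = (if e i = g \<otimes> (h \<otimes> e j) then 1 else 0)"
      using h e_in ij by (simp add: mult_delta_right)
    finally show "reg (g \<otimes> h) $$ (i, j) = (reg g * reg h) $$ (i, j)"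
      using ij g h e_in by (simp add: reg_def m_assoc)
  qed (auto simp: reg_def)
  moreover have "reg \<one> = 1\<^sub>m N"
    using e_in e_inj by (intro eq_matI) (auto simp: reg_def)
  ultimately have reg: "is_rep G reg" using is_repI[of reg N] regc by blast
  have char_reg: "char reg g = (if g = \<one> then of_nat N else 0)" if "g \<in> carrier G" for g
  proof -
    have "char reg g = (\<Sum>i<N. if e i = g \<otimes> e i then 1 else 0)"
      by (auto simp: char_def mat_trace_def reg_def)
    also have "\<dots> = (\<Sum>i<N. if g = \<one> then 1 else 0)"
      using that e_in by (intro sum.cong refl) auto
    finally show ?thesis by simp
  qed
  obtain Rs where Rs: "\<And>Q. Q \<in> set Rs \<Longrightarrow> irreducible_rep G Q" "rep_iso G reg (direct_sum_rep Rs)"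
    using maschke[OF reg] by blast
  have "irrep_classes G \<subseteq> (\<lambda>Q. irr_rel `` {Q}) ` set Rs"
  proof
    fix C assume C: "C \<in> irrep_classes G"
    let ?S = "class_rep C"
    note S = class_rep_in(2)[OF C]
    have "of_nat (length (filter (rep_iso G ?S) Rs)) * of_nat N = (\<Sum>g\<in>carrier G. char reg g * char ?S (inv g))"
      unfolding N_def by (rule length_filter_iso[OF reg S Rs])
    also have "\<dots> = (\<Sum>g\<in>carrier G. if g = \<one> then of_nat N * char ?S (inv g) else 0)"
      by (intro sum.cong refl) (auto simp: char_reg)
    also have "\<dots> = of_nat N * of_nat (deg ?S)"
      by (simp add: char_def rep_one[OF irreducible_is_rep[OF S]])
    \<comment> \<open>The regular character is supported at the unit, so the multiplicity is the
      degree, which is positive for an irreducible representation.\<close>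
    finally have "length (filter (rep_iso G ?S) Rs) = deg ?S"
      using card_carrier_nonzero by (simp add: N_def)
    then have "filter (rep_iso G ?S) Rs \<noteq> []"
      using S by (auto simp: irreducible_rep_def)
    then obtain Q where "Q \<in> set Rs" "rep_iso G ?S Q" by (auto simp: filter_empty_conv)
    then show "C \<in> (\<lambda>Q. irr_rel `` {Q}) ` set Rs"
      using rep_iso_class_rep_iff[OF C Rs(1)] by blast
  qed
  then show ?thesis using finite_surj by blast
qed

text \<open>Each summand of a decomposition is counted for exactly one class and has the character
  of that class.\<close>

lemma sum_multiplicity_class_char:
  assumes R: "is_rep G R" and h: "h \<in> carrier G"
  shows "(\<Sum>D\<in>irrep_classes G. of_nat (multiplicity_rep G (class_rep D) R) * class_char D h) = char R h"
proof -
  obtain Rs where Rs: "\<And>Q. Q \<in> set Rs \<Longrightarrow> irreducible_rep G Q" "rep_iso G R (direct_sum_rep Rs)"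
    using maschke[OF R] by blast
  have "(\<Sum>D\<in>irrep_classes G. of_nat (length (filter (rep_iso G (class_rep D)) Rs)) * class_char D h) =
      (\<Sum>Q\<leftarrow>Rs. char Q h)"
    using Rs(1)
  proof (induction Rs)
    case (Cons Q Rs)
    have Q: "irreducible_rep G Q" using Cons.prems by simp
    let ?C = "irr_rel `` {Q}"
    note C = class_of_irreducible[OF Q]
    have "(\<Sum>D\<in>irrep_classes G. of_nat (length (filter (rep_iso G (class_rep D)) (Q # Rs))) * class_char D h) =
        (\<Sum>D\<in>irrep_classes G. (if D = ?C then class_char ?C h else 0) +
          of_nat (length (filter (rep_iso G (class_rep D)) Rs)) * class_char D h)"
      by (intro sum.cong refl) (auto simp: rep_iso_class_rep_iff[OF _ Q] distrib_right)
    also have "\<dots> = class_char ?C h + (\<Sum>Q\<leftarrow>Rs. char Q h)"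
      using Cons.IH Cons.prems C finite_irrep_classes by (simp add: sum.distrib)
    also have "class_char ?C h = char Q h"
      unfolding class_char_def using rep_iso_class_rep_iff[OF C Q] class_rep_in(2)[OF C] Q h
      by (intro char_eq_of_iso irreducible_is_rep) auto
    finally show ?case by simp
  qed simp
  then show ?thesis
    using char_decomposition[OF R Rs h] multiplicity_rep_eq[OF R class_rep_in(2) Rs] by simp
qed

end

subsection \<open>Moments of McKay graphs\<close>

context fin_group
begin

lemma irreducible_trivial_rep: "irreducible_rep G trivial_rep"
proof -
  have d: "deg trivial_rep = 1" and r: "is_rep G trivial_rep"
    using is_repI[of trivial_rep 1] by (auto simp: trivial_rep_def)
  have "W = carrier_vec 1" if W: "invariant_subspace G trivial_rep W" and nz: "W \<noteq> {0\<^sub>v 1}" for W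
  proof -
    have sub: "W \<subseteq> carrier_vec 1" "0\<^sub>v 1 \<in> W" "\<And>c v. v \<in> W \<Longrightarrow> c \<cdot>\<^sub>v v \<in> W"
      using W unfolding invariant_subspace_def subspace_module_vec_iff d by auto
    obtain v where v: "v \<in> W" "v \<noteq> 0\<^sub>v 1" using nz sub(2) by blast
    have v0: "vec_index v 0 \<noteq> 0"
    proof
      assume "vec_index v 0 = 0"
      then have "v = 0\<^sub>v 1" using v(1) sub(1) by (intro eq_vecI) auto
      then show False using v(2) by simp
    qed
    have "w \<in> W" if w: "w \<in> carrier_vec 1" for w
    proof -
      have "w = (vec_index w 0 / vec_index v 0) \<cdot>\<^sub>v v"
        using w v v0 sub(1) by (intro eq_vecI) auto
      then show ?thesis using sub(3)[OF v(1)] by metis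
    qed
    then show ?thesis using sub(1) by blast
  qed
  then show ?thesis using r d by (auto simp: irreducible_rep_def)
qed

lemma char_trivial_rep: "char trivial_rep g = 1"
  by (simp add: char_def trivial_rep_def)

definition expansion :: "(('a \<Rightarrow> complex mat) set \<Rightarrow> complex) \<Rightarrow> 'a \<Rightarrow> complex" where
  "expansion x h = (\<Sum>D\<in>irrep_classes G. x D * class_char D h)"

lemma expansion_trivial:
  assumes "h \<in> carrier G"
  shows "expansion (\<lambda>C. if trivial_rep \<in> C then 1 else 0) h = 1"
proof -
  let ?C = "irr_rel `` {trivial_rep}"
  note C = class_of_irreducible[OF irreducible_trivial_rep]
  have "expansion (\<lambda>C. if trivial_rep \<in> C then 1 else 0) h =
      (\<Sum>D\<in>irrep_classes G. if D = ?C then class_char ?C h else 0)"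
    unfolding expansion_def
    using mem_class_iff[OF _ irreducible_trivial_rep] by (intro sum.cong refl) auto
  also have "\<dots> = class_char ?C h"
    using C finite_irrep_classes by simp
  also have "\<dots> = char trivial_rep h"
    unfolding class_char_def
    using rep_iso_class_rep_iff[OF C irreducible_trivial_rep] class_rep_in(2)[OF C] assms
    by (intro char_eq_of_iso irreducible_is_rep irreducible_trivial_rep) auto
  finally show ?thesis by (simp add: char_trivial_rep)
qed

text \<open>Parseval's identity in bilinear form: the second expansion is evaluated at the inverse
  instead of being conjugated. It serves for the Hermitian inner product because the vectors in
  question have real coordinates.\<close>

lemma sum_mult_eq_expansion:
  "(\<Sum>C\<in>irrep_classes G. x C * y C) =
    (\<Sum>h\<in>carrier G. expansion x h * expansion y (inv h)) / of_nat (card (carrier G))"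
proof -
  let ?V = "irrep_classes G"
  have "(\<Sum>h\<in>carrier G. expansion x h * expansion y (inv h)) =
      (\<Sum>h\<in>carrier G. \<Sum>C\<in>?V. \<Sum>D\<in>?V. x C * y D * (class_char C h * class_char D (inv h)))"
    by (simp add: expansion_def sum_product mult_ac)
  also have "\<dots> = (\<Sum>C\<in>?V. \<Sum>D\<in>?V. \<Sum>h\<in>carrier G. x C * y D * (class_char C h * class_char D (inv h)))"
    by (subst sum.swap, rule sum.cong[OF refl], subst sum.swap, rule refl)
  also have "\<dots> = (\<Sum>C\<in>?V. \<Sum>D\<in>?V. x C * y D * (if C = D then of_nat (card (carrier G)) else 0))"
    by (intro sum.cong refl) (simp add: class_char_orthogonality flip: sum_distrib_left)
  also have "\<dots> = (\<Sum>C\<in>?V. x C * y C) * of_nat (card (carrier G))"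
    using finite_irrep_classes by (simp add: mult_delta_right sum_distrib_right)
  finally show ?thesis using card_carrier_nonzero by simp
qed

end

section \<open>Adjoints of matrices and the group SU(3)\<close>

lemma mat_adjoint_mult:
  fixes A B :: "complex mat"
  assumes A: "A \<in> carrier_mat n k" and B: "B \<in> carrier_mat k m"
  shows "mat_adjoint (A * B) = mat_adjoint B * mat_adjoint A"
proof (rule eq_matI)
  note c = mat_adjoint_carrier[OF A] mat_adjoint_carrier[OF B] mat_adjoint_carrier[OF mult_carrier_mat[OF A B]]
  show "dim_row (mat_adjoint (A * B)) = dim_row (mat_adjoint B * mat_adjoint A)"
    "dim_col (mat_adjoint (A * B)) = dim_col (mat_adjoint B * mat_adjoint A)"
    using carrier_matD[OF c(1)] carrier_matD[OF c(2)] carrier_matD[OF c(3)] by simp_all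
  fix i j assume "i < dim_row (mat_adjoint B * mat_adjoint A)" "j < dim_col (mat_adjoint B * mat_adjoint A)"
  then have ij: "i < m" "j < n" using carrier_matD[OF c(1)] carrier_matD[OF c(2)] by auto
  show "mat_adjoint (A * B) $$ (i, j) = (mat_adjoint B * mat_adjoint A) $$ (i, j)"
    using ij by (simp add: mat_adjoint_index[OF mult_carrier_mat[OF A B] ij] mult_mat_index_sum[OF A B ij(2,1)]
        mult_mat_index_sum[OF c(2,1) ij] mat_adjoint_index[OF A] mat_adjoint_index[OF B] mult.commute
        del: index_mult_mat(1))
qed

lemma mat_adjoint_adjoint:
  fixes A :: "complex mat"
  assumes A: "A \<in> carrier_mat n k"
  shows "mat_adjoint (mat_adjoint A) = A"
proof (rule eq_matI)
  note c = mat_adjoint_carrier[OF A]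
  show "dim_row (mat_adjoint (mat_adjoint A)) = dim_row A" "dim_col (mat_adjoint (mat_adjoint A)) = dim_col A"
    using carrier_matD[OF mat_adjoint_carrier[OF c]] carrier_matD[OF A] by simp_all
  fix i j assume "i < dim_row A" "j < dim_col A"
  then have ij: "i < n" "j < k" using A by auto
  then show "mat_adjoint (mat_adjoint A) $$ (i, j) = A $$ (i, j)"
    by (simp add: mat_adjoint_index[OF c ij] mat_adjoint_index[OF A])
qed

lemma mat_trace_adjoint:
  fixes A :: "complex mat"
  assumes A: "A \<in> carrier_mat n n"
  shows "mat_trace (mat_adjoint A) = cnj (mat_trace A)"
  unfolding mat_trace_def carrier_matD(1)[OF A] carrier_matD(1)[OF mat_adjoint_carrier[OF A]]
  by (simp add: mat_adjoint_index[OF A])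

lemma SU3_simps [simp]: "x \<otimes>\<^bsub>SU3\<^esub> y = x * y" "\<one>\<^bsub>SU3\<^esub> = 1\<^sub>m 3"
  by (simp_all add: SU3_def)

lemma SU3_carrier_iff:
  "A \<in> carrier SU3 \<longleftrightarrow> A \<in> carrier_mat 3 3 \<and> A * mat_adjoint A = 1\<^sub>m 3 \<and> Determinant.det A = 1"
  by (simp add: SU3_def)

lemma mat_adjoint_in_SU3:
  assumes "A \<in> carrier SU3"
  shows "mat_adjoint A \<in> carrier SU3" "mat_adjoint A * A = 1\<^sub>m 3"
proof -
  have A: "A \<in> carrier_mat 3 3" "A * mat_adjoint A = 1\<^sub>m 3" "Determinant.det A = 1"
    using assms by (auto simp: SU3_carrier_iff)
  note c = mat_adjoint_carrier[OF A(1)]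
  show i: "mat_adjoint A * A = 1\<^sub>m 3"
    by (rule mat_mult_left_right_inverse[OF A(1) c A(2)])
  have "Determinant.det (mat_adjoint A) = 1"
    using det_mult[OF A(1) c] A(2,3) by simp
  then show "mat_adjoint A \<in> carrier SU3"
    using c i by (simp add: SU3_carrier_iff mat_adjoint_adjoint[OF A(1)])
qed

lemma group_SU3: "group SU3"
proof (rule groupI)
  fix A B assume "A \<in> carrier SU3" "B \<in> carrier SU3"
  then have A: "A \<in> carrier_mat 3 3" "A * mat_adjoint A = 1\<^sub>m 3" "Determinant.det A = 1"
    and B: "B \<in> carrier_mat 3 3" "B * mat_adjoint B = 1\<^sub>m 3" "Determinant.det B = 1"
    by (auto simp: SU3_carrier_iff)
  note cA = mat_adjoint_carrier[OF A(1)] and cB = mat_adjoint_carrier[OF B(1)]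
  have "A * B * mat_adjoint (A * B) = A * (B * mat_adjoint B * mat_adjoint A)"
    unfolding mat_adjoint_mult[OF A(1) B(1)]
    using assoc_mult_mat[OF A(1) B(1) mult_carrier_mat[OF cB cA]] assoc_mult_mat[OF B(1) cB cA] by simp
  also have "\<dots> = 1\<^sub>m 3" using A(2) B(2) by (simp only: left_mult_one_mat[OF cA])
  finally show "A \<otimes>\<^bsub>SU3\<^esub> B \<in> carrier SU3"
    using A B det_mult[OF A(1) B(1)] by (simp add: SU3_carrier_iff)
next
  have "mat_adjoint (1\<^sub>m 3 :: complex mat) = 1\<^sub>m 3"
    using carrier_matD[OF mat_adjoint_carrier[of "1\<^sub>m 3 :: complex mat" 3 3]]
    by (intro eq_matI) (auto simp: mat_adjoint_index[of _ 3 3])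
  then show "\<one>\<^bsub>SU3\<^esub> \<in> carrier SU3" by (simp add: SU3_carrier_iff)
next
  fix A assume A: "A \<in> carrier SU3"
  then show "\<exists>y\<in>carrier SU3. y \<otimes>\<^bsub>SU3\<^esub> A = \<one>\<^bsub>SU3\<^esub>"
    using mat_adjoint_in_SU3[OF A] by auto
qed (auto simp: SU3_carrier_iff)

lemma inv_SU3: "A \<in> carrier SU3 \<Longrightarrow> inv\<^bsub>SU3\<^esub> A = mat_adjoint A"
  using group.inv_equality[OF group_SU3] mat_adjoint_in_SU3 by simp

text \<open>Adjacency entries are natural numbers and the initial vector has entries 0 and 1. This
  removes the conjugation from \<open>vertex_inner\<close>.\<close>

lemma cnj_mckay_op_adj_iterate:
  "cnj ((mckay_op_adj \<Gamma> ^^ n) trivial_basis_vec C) = (mckay_op_adj \<Gamma> ^^ n) trivial_basis_vec C"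
proof (induction n arbitrary: C)
  case 0
  show ?case by (simp add: trivial_basis_vec_def)
next
  case (Suc n)
  then show ?case by (simp add: mckay_op_adj_def)
qed

lemma vertex_inner_mckay_op: "vertex_inner \<Gamma> (mckay_op \<Gamma> x) y = vertex_inner \<Gamma> x (mckay_op_adj \<Gamma> y)"
proof -
  let ?A = "\<lambda>C D. of_nat (mckay_adjacency \<Gamma> C D) :: complex"
  have "vertex_inner \<Gamma> (mckay_op \<Gamma> x) y =
      (\<Sum>C\<in>mckay_vertices \<Gamma>. \<Sum>D\<in>mckay_vertices \<Gamma>. ?A C D * x D * cnj (y C))"
    by (simp add: vertex_inner_def mckay_op_def sum_distrib_right)
  also have "\<dots> = (\<Sum>D\<in>mckay_vertices \<Gamma>. \<Sum>C\<in>mckay_vertices \<Gamma>. ?A C D * x D * cnj (y C))"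
    by (rule sum.swap)
  also have "\<dots> = vertex_inner \<Gamma> x (mckay_op_adj \<Gamma> y)"
    by (simp add: vertex_inner_def mckay_op_adj_def sum_distrib_left mult_ac)
  finally show ?thesis .
qed

text \<open>Moves every \<open>mckay_op\<close> to the other argument, so that only
  \<open>mckay_op_adj\<close> is iterated, the operator that acts on expansions as multiplication by
  the character.\<close>

lemma vertex_inner_mckay_op_iterate:
  "vertex_inner \<Gamma> ((mckay_op \<Gamma> ^^ m) x) y = vertex_inner \<Gamma> x ((mckay_op_adj \<Gamma> ^^ m) y)"
proof (induction m arbitrary: y)
  case (Suc m)
  then show ?case by (simp add: vertex_inner_mckay_op) (simp add: funpow_swap1)
qed simp

theorem mckay_moment_eq_trace_moment:
  assumes sub: "subgroup \<Gamma> SU3" and fin: "finite \<Gamma>"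
  shows "mckay_moment \<Gamma> m n =
    (\<Sum>g\<in>\<Gamma>. mat_trace g ^ m * cnj (mat_trace g) ^ n) / of_nat (card \<Gamma>)"
proof -
  interpret SU: group SU3 by (rule group_SU3)
  let ?G = "subgroup_SU3 \<Gamma>"
  have "group ?G" using subgroup.subgroup_is_group[OF sub group_SU3] .
  then interpret fin_group ?G
    using fin by (simp add: fin_group_def fin_group_axioms_def)
  have \<Gamma>: "\<Gamma> \<subseteq> carrier SU3" using subgroup.subset[OF sub] .
  have \<rho>: "is_rep ?G inclusion_rep"
    by (rule is_repI[of _ 3]) (use \<Gamma> in \<open>auto simp: inclusion_rep_def SU3_carrier_iff\<close>)
  have char_inv: "char inclusion_rep (inv\<^bsub>?G\<^esub> g) = cnj (mat_trace g)" if "g \<in> \<Gamma>" for g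
  proof -
    have "g \<in> carrier SU3" using \<Gamma> that by blast
    then show ?thesis
      using SU.m_inv_consistent[OF sub that] mat_trace_adjoint[of g 3]
      by (simp add: char_def inclusion_rep_def inv_SU3 SU3_carrier_iff)
  qed
  let ?V = "irrep_classes ?G"
  have adj: "(\<Sum>C\<in>?V. of_nat (mckay_adjacency \<Gamma> D C) * class_char C h) =
      char inclusion_rep h * class_char D h" if "D \<in> ?V" "h \<in> \<Gamma>" for D h
  proof -
    note D = irreducible_is_rep[OF class_rep_in(2)[OF that(1)]]
    have "(\<Sum>C\<in>?V. of_nat (mckay_adjacency \<Gamma> D C) * class_char C h) =
        (\<Sum>C\<in>?V. of_nat (multiplicity_rep ?G (class_rep C) (tensor_rep inclusion_rep (class_rep D))) * class_char C h)"
      by (simp add: mckay_adjacency_def class_rep_def)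
    also have "\<dots> = char (tensor_rep inclusion_rep (class_rep D)) h"
      by (rule sum_multiplicity_class_char[OF is_rep_tensor[OF \<rho> D]]) (use that in simp)
    also have "\<dots> = char inclusion_rep h * class_char D h"
      using char_tensor[OF \<rho> D] that by (simp add: class_char_def)
    finally show ?thesis .
  qed
  have exp_op: "expansion (mckay_op_adj \<Gamma> x) h = char inclusion_rep h * expansion x h" if "h \<in> \<Gamma>" for x h
  proof -
    have "expansion (mckay_op_adj \<Gamma> x) h =
        (\<Sum>C\<in>?V. \<Sum>D\<in>?V. x D * (of_nat (mckay_adjacency \<Gamma> D C) * class_char C h))"
      by (simp add: expansion_def mckay_op_adj_def mckay_vertices_def sum_distrib_right sum_distrib_left mult_ac)
    also have "\<dots> = (\<Sum>D\<in>?V. x D * (\<Sum>C\<in>?V. of_nat (mckay_adjacency \<Gamma> D C) * class_char C h))"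
      by (subst sum.swap) (simp add: sum_distrib_left)
    also have "\<dots> = (\<Sum>D\<in>?V. x D * (char inclusion_rep h * class_char D h))"
      by (intro sum.cong refl) (simp add: adj that)
    also have "\<dots> = char inclusion_rep h * expansion x h"
      by (simp add: expansion_def sum_distrib_left mult_ac)
    finally show ?thesis .
  qed
  have e1: "trivial_basis_vec = (\<lambda>C. if trivial_rep \<in> C then 1 else 0)"
    by (simp add: trivial_basis_vec_def fun_eq_iff)
  have exp_pow: "expansion ((mckay_op_adj \<Gamma> ^^ k) trivial_basis_vec) h = char inclusion_rep h ^ k"
    if "h \<in> \<Gamma>" for h k
    by (induction k) (use that in \<open>simp_all add: exp_op expansion_trivial e1\<close>)
  have "mckay_moment \<Gamma> m n =
      vertex_inner \<Gamma> ((mckay_op_adj \<Gamma> ^^ n) trivial_basis_vec) ((mckay_op_adj \<Gamma> ^^ m) trivial_basis_vec)"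
    by (simp add: mckay_moment_def vertex_inner_mckay_op_iterate)
  \<comment> \<open>The two factors are interchanged so that the power \<open>m\<close> is evaluated
    at \<open>h\<close> and the power \<open>n\<close> at the inverse, where the character is
    conjugated.\<close>
  also have "\<dots> = (\<Sum>C\<in>?V. (mckay_op_adj \<Gamma> ^^ m) trivial_basis_vec C * (mckay_op_adj \<Gamma> ^^ n) trivial_basis_vec C)"
    by (simp add: vertex_inner_def cnj_mckay_op_adj_iterate mckay_vertices_def mult.commute)
  also have "\<dots> = (\<Sum>h\<in>\<Gamma>. char inclusion_rep h ^ m * char inclusion_rep (inv\<^bsub>?G\<^esub> h) ^ n) / of_nat (card \<Gamma>)"
    using inv_closed by (simp add: sum_mult_eq_expansion exp_pow)
  finally show ?thesis
    by (simp add: char_inv) (simp add: char_def inclusion_rep_def)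
qed

section \<open>The elements of the group of order 108\<close>

lemma omega_cube: "omega ^ 3 = 1"
  by (simp add: omega_def Complex.DeMoivre)

lemma omega_eq: "omega = Complex (- 1 / 2) (sqrt 3 / 2)"
  by (simp add: omega_def cis.ctr cos_120 sin_120)

lemma omega_sq: "omega * omega = - 1 - omega"
  by (simp add: omega_eq complex_eq_iff field_simps)

lemma omega_power_mod: "omega ^ n = omega ^ (n mod 3)"
proof -
  have "omega ^ n = omega ^ (3 * (n div 3) + n mod 3)" by simp
  also have "\<dots> = (omega ^ 3) ^ (n div 3) * omega ^ (n mod 3)"
    by (simp only: power_add power_mult)
  finally show ?thesis by (simp only: omega_cube power_one mult_1_left)
qed

lemma omega_power_cong: "m mod 3 = n mod 3 \<Longrightarrow> omega ^ m = omega ^ n"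
  using omega_power_mod[of m] omega_power_mod[of n] by simp

text \<open>The normalising factor of \<open>V\<close>. Since \<open>1 + 2 * omega\<close> is the
  square root of -3, it lies in the field generated by \<open>omega\<close>.\<close>

definition rt :: complex where "rt = 1 / (\<i> * of_real (sqrt 3))"

lemma rt_expr: "rt = - (1 + 2 * omega) / 3"
  by (simp add: rt_def omega_eq complex_eq_iff field_simps Re_divide Im_divide)

lemma rt_sq: "rt * rt = - 1 / 3"
proof -
  have "rt * rt = (1 + 4 * omega + 4 * (omega * omega)) / 9"
    unfolding rt_expr by (simp add: algebra_simps)
  then show ?thesis unfolding omega_sq by simp
qed

lemma omega_nonzero: "omega \<noteq> 0"
  by (simp add: omega_eq complex_eq_iff)

lemma rt_nonzero: "rt \<noteq> 0"
  by (simp add: rt_def)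

text \<open>\<open>V_pow_entry k m j\<close> is the entry of \<open>V\<^sup>k\<close> in row \<open>m mod 3\<close> and column \<open>j < 3\<close>: left multiplication by
  \<open>T\<^sup>b\<close> then amounts to replacing \<open>m\<close> by \<open>m + b\<close>.\<close>

definition V_pow_entry :: "nat \<Rightarrow> nat \<Rightarrow> nat \<Rightarrow> complex" where
  "V_pow_entry k m j =
     (if k = 0 then if (m + 2 * j) mod 3 = 0 then 1 else 0
      else if k = 1 then omega ^ (m * j) * rt
      else if k = 2 then if (m + j) mod 3 = 0 then - 1 else 0
      else - (omega ^ (2 * (m * j)) * rt))"

definition E_entry :: "nat \<Rightarrow> nat \<Rightarrow> nat \<Rightarrow> nat \<Rightarrow> nat \<Rightarrow> nat \<Rightarrow> complex" where
  "E_entry c a b k i j = omega ^ (c + a * i) * V_pow_entry k (i + b) j"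

text \<open>\<open>E_mat c a b k\<close> is the product \<open>\<omega>\<^sup>c S\<^sub>1\<^sup>a T\<^sup>b V\<^sup>k\<close>.\<close>

definition E_mat :: "nat \<Rightarrow> nat \<Rightarrow> nat \<Rightarrow> nat \<Rightarrow> complex mat" where
  "E_mat c a b k = Matrix.mat 3 3 (\<lambda>(i, j). E_entry c a b k i j)"

lemma E_mat_carrier [simp]: "E_mat c a b k \<in> carrier_mat 3 3"
  by (simp add: E_mat_def)

lemma E_mat_index: "i < 3 \<Longrightarrow> j < 3 \<Longrightarrow> E_mat c a b k $$ (i, j) = E_entry c a b k i j"
  by (simp add: E_mat_def)

lemma mod_3_mult_cong: "(m :: nat) mod 3 = m' mod 3 \<Longrightarrow> m * j mod 3 = m' * j mod 3"
  by (metis mod_mult_left_eq)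

lemma V_pow_entry_cong:
  assumes "m mod 3 = m' mod 3"
  shows "V_pow_entry k m j = V_pow_entry k m' j"
proof -
  have "omega ^ (m * j) = omega ^ (m' * j)"
    by (rule omega_power_cong[OF mod_3_mult_cong[OF assms]])
  moreover have "omega ^ (2 * (m * j)) = omega ^ (2 * (m' * j))"
    using omega_power_cong[OF mod_3_mult_cong[OF assms, of "2 * j"]] by (simp add: mult_ac)
  moreover have "(m + j) mod 3 = (m' + j) mod 3" "(m + 2 * j) mod 3 = (m' + 2 * j) mod 3"
    by (rule mod_add_cong[OF assms refl])+
  ultimately show ?thesis unfolding V_pow_entry_def by simp
qed

lemma less_3_cases: "(i :: nat) < 3 \<longleftrightarrow> i = 0 \<or> i = 1 \<or> i = 2"
  by auto

lemma less_4_cases: "(i :: nat) < 4 \<longleftrightarrow> i = 0 \<or> i = 1 \<or> i = 2 \<or> i = 3"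
  by auto

lemma sum_less_3: "(\<Sum>i<3. f i) = f 0 + f 1 + (f (2 :: nat) :: 'a :: comm_monoid_add)"
  by (simp add: numeral_3_eq_3 numeral_2_eq_2)

lemma omega_powers:
  "omega ^ 2 = - 1 - omega" "omega ^ 4 = omega" "omega ^ 8 = - 1 - omega" "omega ^ 6 = 1"
  "omega ^ 12 = 1" "omega ^ 16 = omega" "omega ^ 5 = - 1 - omega" "omega ^ 7 = omega" "omega ^ 9 = 1"
  "omega ^ 10 = omega" "omega ^ 24 = 1"
  using omega_sq omega_power_mod[of 4] omega_power_mod[of 8] omega_power_mod[of 6] omega_power_mod[of 12]
    omega_power_mod[of 16] omega_power_mod[of 5] omega_power_mod[of 7] omega_power_mod[of 9] omega_power_mod[of 10] omega_power_mod[of 24]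
  by (simp_all add: power2_eq_square)

lemma E_entry_cong:
  assumes "c mod 3 = c' mod 3" "a mod 3 = a' mod 3" "b mod 3 = b' mod 3"
  shows "E_entry c a b k i j = E_entry c' a' b' k i j"
proof -
  have "omega ^ (c + a * i) = omega ^ (c' + a' * i)"
    by (intro omega_power_cong mod_add_cong mod_3_mult_cong assms)
  moreover have "V_pow_entry k (i + b) j = V_pow_entry k (i + b') j"
    by (intro V_pow_entry_cong mod_add_cong assms refl)
  ultimately show ?thesis by (simp add: E_entry_def)
qed

lemma E_mat_mod: "E_mat c a b k = E_mat (c mod 3) (a mod 3) (b mod 3) k"
proof -
  have "E_entry c a b k = E_entry (c mod 3) (a mod 3) (b mod 3) k"
    by (intro ext E_entry_cong) simp_all
  then show ?thesis unfolding E_mat_def by (rule arg_cong)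
qed

lemma E_mat_eqI:
  assumes "A \<in> carrier_mat 3 3" "\<And>i j. i < 3 \<Longrightarrow> j < 3 \<Longrightarrow> A $$ (i, j) = E_entry c a b k i j"
  shows "A = E_mat c a b k"
  using assms by (intro eq_matI) (auto simp: E_mat_def)

section \<open>Left multiplication of normal forms by the generators\<close>

lemma E_generators_eq:
  "S1_mat = E_mat 0 1 0 0" "S2_mat = E_mat 1 0 0 0" "T_mat = E_mat 0 0 1 0" "V_mat = E_mat 0 0 0 1"
  "1\<^sub>m 3 = E_mat 0 0 0 0"
  by (rule E_mat_eqI;
      auto simp: S1_mat_def S2_mat_def T_mat_def V_mat_def mat_of_rows_list_def E_entry_def V_pow_entry_def
        less_3_cases rt_def omega_powers numeral_2_eq_2[symmetric])+

lemma S2_mult: "S2_mat * E_mat c a b k = E_mat (c + 1) a b k"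
proof (rule E_mat_eqI)
  fix i j :: nat assume ij: "i < 3" "j < 3"
  then show "(S2_mat * E_mat c a b k) $$ (i, j) = E_entry (c + 1) a b k i j"
    unfolding E_generators_eq mult_mat_index_sum[OF E_mat_carrier E_mat_carrier ij] sum_less_3
    by (auto simp: less_3_cases E_mat_index E_entry_def V_pow_entry_def[of 0])
qed (simp add: E_generators_eq mult_carrier_mat[of _ 3 3 _ 3])

lemma S1_mult: "S1_mat * E_mat c a b k = E_mat c (a + 1) b k"
proof (rule E_mat_eqI)
  fix i j :: nat assume ij: "i < 3" "j < 3"
  then show "(S1_mat * E_mat c a b k) $$ (i, j) = E_entry c (a + 1) b k i j"
    unfolding E_generators_eq mult_mat_index_sum[OF E_mat_carrier E_mat_carrier ij] sum_less_3
    by (auto simp: less_3_cases E_mat_index E_entry_def V_pow_entry_def[of 0] power_add)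
qed (simp add: E_generators_eq mult_carrier_mat[of _ 3 3 _ 3])

text \<open>\<open>T\<close> shifts the rows cyclically, which multiplies the diagonal factor by a
  scalar: T S1^a = omega^a S1^a T.\<close>

lemma T_mult: "T_mat * E_mat c a b k = E_mat (c + a) a (b + 1) k"
proof (rule E_mat_eqI)
  fix i j :: nat assume ij: "i < 3" "j < 3"
  have "(T_mat * E_mat c a b k) $$ (i, j) = E_entry c a b k ((i + 1) mod 3) j"
    using ij unfolding E_generators_eq mult_mat_index_sum[OF E_mat_carrier E_mat_carrier ij] sum_less_3
    by (auto simp: less_3_cases E_mat_index E_entry_def[of 0] V_pow_entry_def[of 0] numeral_2_eq_2[symmetric])
  also have "\<dots> = E_entry (c + a) a (b + 1) k i j"
  proof -
    have "a * ((i + 1) mod 3) mod 3 = a * (i + 1) mod 3" by (simp add: mod_mult_right_eq)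
    then have "(c + a * ((i + 1) mod 3)) mod 3 = (c + a * (i + 1)) mod 3"
      by (intro mod_add_cong refl)
    then have "omega ^ (c + a * ((i + 1) mod 3)) = omega ^ (c + a + a * i)"
      by (intro omega_power_cong) (simp add: algebra_simps)
    moreover have "V_pow_entry k ((i + 1) mod 3 + b) j = V_pow_entry k (i + (b + 1)) j"
      by (rule V_pow_entry_cong) (simp add: mod_simps)
    ultimately show ?thesis by (simp add: E_entry_def)
  qed
  finally show "(T_mat * E_mat c a b k) $$ (i, j) = E_entry (c + a) a (b + 1) k i j" .
qed (simp add: E_generators_eq mult_carrier_mat[of _ 3 3 _ 3])

lemma sum_omega_powers: "(\<Sum>m<3. omega ^ (q * m)) = (if q mod 3 = 0 then 3 else 0)"
proof -
  have "omega ^ (q * m) = omega ^ (q mod 3 * m)" for m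
    by (intro omega_power_cong mod_3_mult_cong) simp
  moreover have "q mod 3 = 0 \<or> q mod 3 = 1 \<or> q mod 3 = 2" by linarith
  ultimately show ?thesis by (auto simp: sum_less_3 omega_powers)
qed

text \<open>\<open>V\<close> is \<open>rt\<close> times the Fourier matrix of the integers mod 3.
  Its square is minus the permutation sending m to -m, because \<open>3 * rt * rt = - 1\<close>; so
  its cube is minus \<open>rt\<close> times the conjugate Fourier matrix, and its fourth power is
  the identity. \<open>V_pow_entry\<close> lists these four matrices, and this is the passage from
  \<open>k\<close> to \<open>k + 1\<close>.\<close>

lemma fourier_V_pow_entry:
  assumes "k < 4" "j < 3"
  shows "rt * (\<Sum>m<3. omega ^ (p * m) * V_pow_entry k m j) = V_pow_entry ((k + 1) mod 4) p j"
proof -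
  have jc: "j = 0 \<or> j = 1 \<or> j = 2" using assms by auto
  consider "k = 0" | "k = 1" | "k = 2" | "k = 3" using assms by linarith
  then show ?thesis
  proof cases
    case 1
    have "(\<Sum>m<3. omega ^ (p * m) * V_pow_entry 0 m j) = omega ^ (p * j)"
      unfolding sum_less_3 V_pow_entry_def using jc by (elim disjE) simp_all
    then show ?thesis by (simp add: 1 V_pow_entry_def)
  next
    case 2
    have "(\<Sum>m<3. omega ^ (p * m) * V_pow_entry 1 m j) = rt * (\<Sum>m<3. omega ^ ((p + j) * m))"
      unfolding add_mult_distrib power_add sum_distrib_left
      by (intro sum.cong refl) (simp add: V_pow_entry_def mult_ac)
    then have "rt * (\<Sum>m<3. omega ^ (p * m) * V_pow_entry 1 m j) = - 1 / 3 * (\<Sum>m<3. omega ^ ((p + j) * m))"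
      by (simp only: mult.assoc[symmetric] rt_sq)
    then show ?thesis by (simp add: 2 V_pow_entry_def sum_omega_powers)
  next
    case 3
    have "(\<Sum>m<3. omega ^ (p * m) * V_pow_entry 2 m j) = - (omega ^ (p * (2 * j mod 3)))"
      unfolding sum_less_3 V_pow_entry_def using jc by (elim disjE) simp_all
    also have "omega ^ (p * (2 * j mod 3)) = omega ^ (2 * (p * j))"
      by (rule omega_power_cong) (simp add: mod_mult_right_eq mult_ac)
    finally show ?thesis by (simp add: 3 V_pow_entry_def)
  next
    case 4
    have "(\<Sum>m<3. omega ^ (p * m) * V_pow_entry 3 m j) = - rt * (\<Sum>m<3. omega ^ ((p + 2 * j) * m))"
      unfolding add_mult_distrib power_add sum_distrib_left
      by (intro sum.cong refl) (simp add: V_pow_entry_def mult_ac)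
    then have "rt * (\<Sum>m<3. omega ^ (p * m) * V_pow_entry 3 m j) = 1 / 3 * (\<Sum>m<3. omega ^ ((p + 2 * j) * m))"
      by (simp only: mult.assoc[symmetric] mult_minus_right mult_minus_left rt_sq) simp
    also have "\<dots> = V_pow_entry 0 p j"
      by (simp add: sum_omega_powers V_pow_entry_def)
    finally show ?thesis by (simp add: 4)
  qed
qed

lemma sum_shift_mod_3:
  fixes g :: "nat \<Rightarrow> 'a :: ab_group_add"
  assumes "\<And>m. g (m + 3) = g m"
  shows "(\<Sum>l<3. g (l + b)) = (\<Sum>l<3. g l)"
proof (induction b)
  case (Suc b)
  have "(\<Sum>l<3. g (l + Suc b)) = (\<Sum>l<3. g (l + b))"
    using assms[of b] by (simp add: sum_less_3 numeral_3_eq_3 numeral_2_eq_2 add_ac)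
  then show ?case using Suc.IH by simp
qed simp

text \<open>The Fourier matrix exchanges multiplication by characters with translation: V S1^a T^b =
  omega^(2ab) S1^(2b) T^a V. The exponent \<open>2 * b\<close> stands for -b mod 3.\<close>

lemma V_mult:
  assumes "k < 4"
  shows "V_mat * E_mat c a b k = E_mat (c + 2 * a * b) (2 * b) a ((k + 1) mod 4)"
proof (rule E_mat_eqI)
  fix i j :: nat assume ij: "i < 3" "j < 3"
  \<comment> \<open>The summand after the substitution m = l + b. The value m - b appears as
    \<open>m + 2 * b\<close>, which agrees mod 3 and avoids subtraction of natural numbers;
    periodicity then moves the range of summation back to 0, 1, 2.\<close>
  define g where "g m = omega ^ ((i + a) * (m + 2 * b)) * V_pow_entry k m j" for m
  have g: "g (m + 3) = g m" for m
  proof -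
    have "(i + a) * (m + 3 + 2 * b) = (i + a) * (m + 2 * b) + (i + a) * 3"
      by (simp add: algebra_simps)
    then have "omega ^ ((i + a) * (m + 3 + 2 * b)) = omega ^ ((i + a) * (m + 2 * b))"
      by (intro omega_power_cong) (simp only: mod_mult_self1)
    moreover have "V_pow_entry k (m + 3) j = V_pow_entry k m j"
      by (rule V_pow_entry_cong) simp
    ultimately show ?thesis by (simp add: g_def)
  qed
  have gl: "g (l + b) = omega ^ ((i + a) * l) * V_pow_entry k (l + b) j" for l
  proof -
    have "(i + a) * (l + b + 2 * b) = (i + a) * l + (i + a) * b * 3"
      by (simp add: algebra_simps)
    then have "omega ^ ((i + a) * (l + b + 2 * b)) = omega ^ ((i + a) * l)"
      by (intro omega_power_cong) (simp only: mod_mult_self1)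
    then show ?thesis by (simp add: g_def)
  qed
  have "(V_mat * E_mat c a b k) $$ (i, j) =
      (\<Sum>l<3. omega ^ (i * l) * rt * (omega ^ (c + a * l) * V_pow_entry k (l + b) j))"
    unfolding E_generators_eq mult_mat_index_sum[OF E_mat_carrier E_mat_carrier ij]
    using ij by (intro sum.cong refl) (simp add: E_mat_index E_entry_def V_pow_entry_def[of 1, simplified])
  also have "\<dots> = omega ^ c * rt * (\<Sum>l<3. g (l + b))"
    unfolding gl sum_distrib_left add_mult_distrib power_add by (intro sum.cong refl) (simp only: mult_ac)
  also have "(\<Sum>l<3. g (l + b)) = (\<Sum>m<3. g m)"
    by (rule sum_shift_mod_3) (rule g)
  also have "\<dots> = omega ^ (2 * b * (i + a)) * (\<Sum>m<3. omega ^ ((i + a) * m) * V_pow_entry k m j)"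
  proof -
    have "omega ^ ((i + a) * (m + 2 * b)) = omega ^ (2 * b * (i + a)) * omega ^ ((i + a) * m)" for m
      by (subst power_add[symmetric]) (simp add: algebra_simps)
    then show ?thesis unfolding g_def sum_distrib_left by (simp only: mult.assoc)
  qed
  also have "omega ^ c * rt * (omega ^ (2 * b * (i + a)) * (\<Sum>m<3. omega ^ ((i + a) * m) * V_pow_entry k m j)) =
      omega ^ c * omega ^ (2 * b * (i + a)) * (rt * (\<Sum>m<3. omega ^ ((i + a) * m) * V_pow_entry k m j))"
    by (simp only: mult_ac)
  also have "\<dots> = omega ^ (c + 2 * a * b + 2 * b * i) * V_pow_entry ((k + 1) mod 4) (i + a) j"
  proof -
    have "omega ^ c * omega ^ (2 * b * (i + a)) = omega ^ (c + 2 * a * b + 2 * b * i)"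
      by (subst power_add[symmetric]) (simp add: algebra_simps)
    then show ?thesis unfolding fourier_V_pow_entry[OF assms ij(2)] by simp
  qed
  finally show "(V_mat * E_mat c a b k) $$ (i, j) = E_entry (c + 2 * a * b) (2 * b) a ((k + 1) mod 4) i j"
    by (simp add: E_entry_def)
qed (simp add: E_generators_eq mult_carrier_mat[of _ 3 3 _ 3])


text \<open>For \<open>k = 0\<close> the diagonal vanishes unless \<open>b = 0\<close>, and then it
  carries a character sum over the integers mod 3. For \<open>k = 2\<close> one diagonal entry
  survives, since 2i + b = 0 mod 3 has one solution. For \<open>k = 1\<close> and
  \<open>k = 3\<close> normalised quadratic Gauss sums arise, which are cube roots of unity. Which
  root occurs is left open because the later sum runs over all scalars
  \<open>omega ^ c\<close>.\<close>

lemma mat_trace_E_mat: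
  assumes "a < 3" "b < 3"
  shows "mat_trace (E_mat c a b 0) = (if a = 0 \<and> b = 0 then 3 * omega ^ c else 0)"
    and "\<exists>e<3. mat_trace (E_mat c a b 1) = omega ^ c * omega ^ e"
    and "\<exists>e<3. mat_trace (E_mat c a b 2) = - (omega ^ c * omega ^ e)"
    and "\<exists>e<3. mat_trace (E_mat c a b 3) = omega ^ c * omega ^ e"
proof -
  define t where "t k = (\<Sum>i<3. omega ^ (a * i) * V_pow_entry k (i + b) i)" for k
  have tr: "mat_trace (E_mat c a b k) = omega ^ c * t k" for k
    unfolding mat_trace_def carrier_matD(1)[OF E_mat_carrier] t_def sum_distrib_left
    by (intro sum.cong refl) (simp add: E_mat_index E_entry_def power_add)
  have ab: "a = 0 \<or> a = 1 \<or> a = 2" "b = 0 \<or> b = 1 \<or> b = 2" using assms by auto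
  have "t 0 = (if a = 0 \<and> b = 0 then 3 else 0)"
    using ab unfolding t_def sum_less_3
    by (elim disjE; simp add: V_pow_entry_def omega_powers)
  then show "mat_trace (E_mat c a b 0) = (if a = 0 \<and> b = 0 then 3 * omega ^ c else 0)"
    by (simp add: tr)
  have ex: "(\<exists>e<3. z = omega ^ e) \<longleftrightarrow> z = 1 \<or> z = omega \<or> z = - 1 - omega" for z
    unfolding less_3_cases by (auto simp: omega_powers)
  have "t 1 = (if (a + b) mod 3 = 0 then 1 else - 1 - omega)"
    using ab unfolding t_def sum_less_3
    by (elim disjE, simp_all add: V_pow_entry_def omega_powers omega_cube)
      (simp_all add: rt_expr omega_eq complex_eq_iff field_simps)
  moreover have "t 3 = (if (a + 2 * b) mod 3 = 0 then 1 else omega)"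
    using ab unfolding t_def sum_less_3
    by (elim disjE, simp_all add: V_pow_entry_def omega_powers omega_cube)
      (simp_all add: rt_expr omega_eq complex_eq_iff field_simps)
  ultimately have "\<exists>e<3. t 1 = omega ^ e" "\<exists>e<3. t 3 = omega ^ e"
    unfolding ex by auto
  moreover have "\<exists>e<3. - t 2 = omega ^ e"
    using ab unfolding t_def sum_less_3 ex
    by (elim disjE; simp add: V_pow_entry_def omega_powers)
  ultimately obtain e1 e2 e3 where "e1 < 3" "t 1 = omega ^ e1" "e2 < 3" "t 2 = - (omega ^ e2)" "e3 < 3" "t 3 = omega ^ e3"
    by (metis minus_minus)
  then show "\<exists>e<3. mat_trace (E_mat c a b 1) = omega ^ c * omega ^ e"
    "\<exists>e<3. mat_trace (E_mat c a b 2) = - (omega ^ c * omega ^ e)"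
    "\<exists>e<3. mat_trace (E_mat c a b 3) = omega ^ c * omega ^ e"
    unfolding tr by (metis, metis mult_minus_right, metis)
qed

lemma sum_omega_shift: "(\<Sum>c<3. f (omega ^ c * omega ^ e)) = (\<Sum>c<3. f (omega ^ c))"
  for f :: "complex \<Rightarrow> complex"
proof -
  have "f (omega ^ (m + 3)) = f (omega ^ m)" for m
    by (simp add: power_add omega_cube)
  from sum_shift_mod_3[of "\<lambda>c. f (omega ^ c)", OF this, of e] show ?thesis
    by (simp add: power_add)
qed

text \<open>For fixed \<open>a\<close>, \<open>b\<close>, \<open>k\<close> the scalar
  \<open>omega ^ c\<close> rotates the trace through all cube roots of unity. With
  \<open>k = 0\<close> the eight nonzero pairs (a, b) give 24 zeros; the nine pairs give 18 full
  rotations for \<open>k = 1\<close> and \<open>k = 3\<close> together, and 9 for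
  \<open>k = 2\<close>.\<close>

lemma sum_mat_trace_E_mat:
  fixes f :: "complex \<Rightarrow> complex"
  shows "(\<Sum>(c, a, b, k)\<in>{..<3} \<times> {..<3} \<times> {..<3} \<times> {..<4}. f (mat_trace (E_mat c a b k))) =
    (\<Sum>c<3. f (3 * omega ^ c)) + 24 * f 0 + 18 * (\<Sum>c<3. f (omega ^ c)) + 9 * (\<Sum>c<3. f (- (omega ^ c)))"
proof -
  have s1: "(\<Sum>c<3. f (mat_trace (E_mat c a b k))) = (\<Sum>c<3. f (omega ^ c))"
    if ab: "a < 3" "b < 3" "k = 1 \<or> k = 3" for a b k
  proof -
    define t where "t = (\<Sum>i<3. omega ^ (a * i) * V_pow_entry k (i + b) i)"
    have tr: "mat_trace (E_mat c a b k) = omega ^ c * t" for c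
      unfolding mat_trace_def carrier_matD(1)[OF E_mat_carrier] t_def sum_distrib_left
      by (intro sum.cong refl) (simp add: E_mat_index E_entry_def power_add)
    obtain e where "mat_trace (E_mat 0 a b k) = omega ^ e"
      using mat_trace_E_mat(2,4)[OF ab(1,2), of 0] ab(3) by auto
    then have "t = omega ^ e" using tr[of 0] by simp
    then show ?thesis using sum_omega_shift[of f e] tr by simp
  qed
  have s2: "(\<Sum>c<3. f (mat_trace (E_mat c a b 2))) = (\<Sum>c<3. f (- (omega ^ c)))"
    if ab: "a < 3" "b < 3" for a b
  proof -
    define t where "t = (\<Sum>i<3. omega ^ (a * i) * V_pow_entry 2 (i + b) i)"
    have tr: "mat_trace (E_mat c a b 2) = omega ^ c * t" for c
      unfolding mat_trace_def carrier_matD(1)[OF E_mat_carrier] t_def sum_distrib_left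
      by (intro sum.cong refl) (simp add: E_mat_index E_entry_def power_add)
    obtain e where "mat_trace (E_mat 0 a b 2) = - (omega ^ e)"
      using mat_trace_E_mat(3)[OF ab, of 0] by auto
    then have "t = - (omega ^ e)" using tr[of 0] by simp
    then show ?thesis using sum_omega_shift[of "\<lambda>z. f (- z)" e] tr by simp
  qed
  have s0: "(\<Sum>c<3. f (mat_trace (E_mat c a b 0))) = (if a = 0 \<and> b = 0 then \<Sum>c<3. f (3 * omega ^ c) else 3 * f 0)"
    if ab: "a < 3" "b < 3" for a b
    using mat_trace_E_mat(1)[OF ab] by auto
  have "(\<Sum>(c, a, b, k)\<in>{..<3} \<times> {..<3} \<times> {..<3} \<times> {..<4}. f (mat_trace (E_mat c a b k))) =
      (\<Sum>c<3. \<Sum>a<3. \<Sum>b<3. \<Sum>k<4. f (mat_trace (E_mat c a b k)))"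
    by (simp add: sum.cartesian_product)
  also have "\<dots> = (\<Sum>a<3. \<Sum>b<3. \<Sum>k<4. \<Sum>c<3. f (mat_trace (E_mat c a b k)))"
    by (subst sum.swap, rule sum.cong[OF refl], subst sum.swap, rule sum.cong[OF refl], rule sum.swap)
  also have "\<dots> = (\<Sum>a<3::nat. \<Sum>b<3::nat. (if a = 0 \<and> b = 0 then \<Sum>c<3. f (3 * omega ^ c) else 3 * f 0) +
      2 * (\<Sum>c<3. f (omega ^ c)) + (\<Sum>c<3. f (- (omega ^ c))))"
  proof (intro sum.cong refl)
    fix a b :: nat assume "a \<in> {..<3}" "b \<in> {..<3}"
    then have ab: "a < 3" "b < 3" by auto
    have "{..<4 :: nat} = {0, 1, 2, 3}" by auto
    then show "(\<Sum>k<4. \<Sum>c<3. f (mat_trace (E_mat c a b k))) =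
        (if a = 0 \<and> b = 0 then \<Sum>c<3. f (3 * omega ^ c) else 3 * f 0) +
        2 * (\<Sum>c<3. f (omega ^ c)) + (\<Sum>c<3. f (- (omega ^ c)))"
      using s0[OF ab] s1[OF ab, of 1] s1[OF ab, of 3] s2[OF ab] by simp
  qed
  also have "\<dots> = (\<Sum>c<3. f (3 * omega ^ c)) + 24 * f 0 + 18 * (\<Sum>c<3. f (omega ^ c)) + 9 * (\<Sum>c<3. f (- (omega ^ c)))"
    by (simp add: sum_less_3 algebra_simps)
  finally show ?thesis .
qed

section \<open>Distinctness of the 108 normal forms\<close>

definition E_index :: "(nat \<times> nat \<times> nat \<times> nat) set" where
  "E_index = {..<3} \<times> {..<3} \<times> {..<3} \<times> {..<4}"

definition E_set :: "complex mat set" where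
  "E_set = (\<lambda>(c, a, b, k). E_mat c a b k) ` E_index"

lemma E_set_iff: "A \<in> E_set \<longleftrightarrow> (\<exists>c a b k. k < 4 \<and> A = E_mat c a b k)"
proof
  assume "\<exists>c a b k. k < 4 \<and> A = E_mat c a b k"
  then obtain c a b k where "k < 4" "A = E_mat (c mod 3) (a mod 3) (b mod 3) k"
    using E_mat_mod by metis
  then show "A \<in> E_set" unfolding E_set_def E_index_def
    by (intro image_eqI[of _ _ "(c mod 3, a mod 3, b mod 3, k)"]) auto
qed (auto simp: E_set_def E_index_def)

lemma omega_power_inj: "omega ^ m = omega ^ n \<Longrightarrow> m < 3 \<Longrightarrow> n < 3 \<Longrightarrow> m = n"
  unfolding less_3_cases
  by (elim disjE) (simp_all add: omega_powers, simp_all add: omega_eq complex_eq_iff)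

lemma inj_on_E_mat: "inj_on (\<lambda>(c, a, b, k). E_mat c a b k) E_index"
proof (rule inj_onI)
  fix x x' assume "x \<in> E_index" "x' \<in> E_index"
  then obtain c a b k c' a' b' k' where x: "x = (c, a, b, k)" "x' = (c', a', b', k')"
    and lt: "c < 3" "a < 3" "b < 3" "k < 4" "c' < 3" "a' < 3" "b' < 3" "k' < 4"
    by (auto simp: E_index_def)
  assume "(case x of (c, a, b, k) \<Rightarrow> E_mat c a b k) = (case x' of (c, a, b, k) \<Rightarrow> E_mat c a b k)"
  then have eq: "E_mat c a b k = E_mat c' a' b' k'" by (simp add: x)
  have entry: "E_entry c a b k i j = E_entry c' a' b' k' i j" if "i < 3" "j < 3" for i j
    using arg_cong[OF eq, of "\<lambda>A. A $$ (i, j)"] that by (simp add: E_mat_index)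
  have cube3: "(omega ^ n) ^ 3 = 1" for n
    by (simp add: omega_cube flip: power_mult) (metis omega_cube power_mult power_one mult.commute)
  then have c2: "(- 1 - omega) ^ 3 = 1" using omega_powers(1) by metis
  \<comment> \<open>The sum of the cubes of the first row depends on \<open>k\<close> only and separates its four values.\<close>
  have cubes: "(\<Sum>j<3. (E_entry c a b k 0 j) ^ 3) = (if k = 0 then 1 else if k = 1 then - rt else if k = 2 then - 1 else rt)"
    if "b < 3" "k < 4" for c a b k
  proof -
    have "rt ^ 3 = - rt / 3" using rt_sq by (simp add: power3_eq_cube)
    moreover have "b = 0 \<or> b = 1 \<or> b = 2" "k = 0 \<or> k = 1 \<or> k = 2 \<or> k = 3" using that by auto
    ultimately show ?thesis
      unfolding sum_less_3 by (elim disjE) (simp_all add: E_entry_def V_pow_entry_def power_mult_distrib cube3 c2 omega_powers omega_cube)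
  qed
  have rt_im: "Re rt = 0" "Im rt \<noteq> 0" by (simp_all add: rt_expr omega_eq)
  have "(\<Sum>j<3. (E_entry c a b k 0 j) ^ 3) = (\<Sum>j<3. (E_entry c' a' b' k' 0 j) ^ 3)"
    using entry by simp
  then have k: "k = k'"
    unfolding cubes[OF lt(3,4)] cubes[OF lt(7,8)] using lt(4,8) rt_im rt_nonzero
    by (auto simp: less_4_cases complex_eq_iff split: if_splits)
  \<comment> \<open>For even \<open>k\<close> the position of the nonzero entry of row 0 gives
    \<open>b\<close> and its value gives \<open>c\<close>; for odd \<open>k\<close> the entries of
    row 0 in columns 0 and 1 do. Row 1 then carries \<open>omega ^ (c + a)\<close>.\<close>
  have "c = c' \<and> b = b' \<and> omega ^ (c + a) = omega ^ (c' + a')"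
  proof -
    consider "k = 0" | "k = 1" | "k = 2" | "k = 3" using lt(4) by linarith
    then show ?thesis
    proof cases
      case 1
      have "(b' + 2 * b) mod 3 = 0" "omega ^ c = omega ^ c'"
        using entry[of 0 b] lt(3) 1 k by (auto simp: E_entry_def V_pow_entry_def omega_nonzero split: if_splits)
      moreover from this have "b = b'" using lt by presburger
      moreover have "(1 + b + 2 * ((1 + b) mod 3)) mod 3 = 0" by presburger
      ultimately show ?thesis
        using entry[of 1 "(1 + b) mod 3"] lt(1,5) omega_power_inj 1 k
        by (auto simp: E_entry_def V_pow_entry_def)
    next
      case 2
      have "omega ^ c = omega ^ c'" "omega ^ (c + a) = omega ^ (c' + a')" "omega ^ c * omega ^ b = omega ^ c' * omega ^ b'"
        using entry[of 0 0] entry[of 1 0] entry[of 0 1] 2 k by (auto simp: E_entry_def V_pow_entry_def rt_nonzero)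
      then show ?thesis using omega_power_inj lt omega_nonzero by auto
    next
      case 3
      have b0: "(b + (2 * b) mod 3) mod 3 = 0" by presburger
      then have "(b' + (2 * b) mod 3) mod 3 = 0" "omega ^ c = omega ^ c'"
        using entry[of 0 "(2 * b) mod 3"] 3 k by (auto simp: E_entry_def V_pow_entry_def omega_nonzero split: if_splits)
      moreover from this have "b = b'" using lt by presburger
      moreover have "(1 + b + (2 * (1 + b)) mod 3) mod 3 = 0" by presburger
      ultimately show ?thesis
        using entry[of 1 "(2 * (1 + b)) mod 3"] lt(1,5) omega_power_inj 3 k
        by (auto simp: E_entry_def V_pow_entry_def)
    next
      case 4
      have "omega ^ c = omega ^ c'" "omega ^ (c + a) = omega ^ (c' + a')"
        "omega ^ c * omega ^ (2 * b) = omega ^ c' * omega ^ (2 * b')"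
        using entry[of 0 0] entry[of 1 0] entry[of 0 1] 4 k by (auto simp: E_entry_def V_pow_entry_def rt_nonzero)
      then have e: "c = c'" "omega ^ (2 * b) = omega ^ (2 * b')" "omega ^ (c + a) = omega ^ (c' + a')"
        using omega_power_inj lt omega_nonzero by auto
      \<comment> \<open>The exponents 4b and b agree mod 3, so squaring recovers
        \<open>omega ^ b\<close>.\<close>
      have sq: "omega ^ b = omega ^ (2 * b) * omega ^ (2 * b)" for b
        by (subst power_add[symmetric]) (rule omega_power_cong, presburger)
      have "omega ^ b = omega ^ b'" by (subst (1 2) sq) (simp only: e(2))
      then have "b = b'" using omega_power_inj lt by blast
      then show ?thesis using e by simp
    qed
  qed
  then show "x = x'"
    using omega_power_inj[of a a'] lt k omega_nonzero by (auto simp: x power_add)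
qed

lemma card_E_set: "card E_set = 108"
  unfolding E_set_def card_image[OF inj_on_E_mat] by (simp add: E_index_def)

lemma finite_E_set: "finite E_set"
  by (simp add: E_set_def E_index_def)

lemma sum_mat_trace_E_set:
  fixes f :: "complex \<Rightarrow> complex"
  shows "(\<Sum>g\<in>E_set. f (mat_trace g)) =
    (\<Sum>c<3. f (3 * omega ^ c)) + 24 * f 0 + 18 * (\<Sum>c<3. f (omega ^ c)) + 9 * (\<Sum>c<3. f (- (omega ^ c)))"
proof -
  have "(\<Sum>g\<in>E_set. f (mat_trace g)) = (\<Sum>(c, a, b, k)\<in>E_index. f (mat_trace (E_mat c a b k)))"
    unfolding E_set_def by (subst sum.reindex[OF inj_on_E_mat]) (simp add: case_prod_beta')
  then show ?thesis unfolding E_index_def sum_mat_trace_E_mat .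
qed

section \<open>Membership of the generators in SU(3) and generation of all normal forms\<close>

lemma det_2:
  fixes A :: "'a :: comm_ring_1 mat"
  assumes "A \<in> carrier_mat 2 2"
  shows "Determinant.det A = A $$ (0, 0) * A $$ (1, 1) - A $$ (0, 1) * A $$ (1, 0)"
proof -
  have d: "mat_delete A 0 j \<in> carrier_mat 1 1" for j
    using assms by (auto simp: mat_delete_def)
  have "Determinant.det A = (\<Sum>j<2. A $$ (0, j) * cofactor A 0 j)"
    by (rule laplace_expansion_row[OF assms]) simp
  also have "\<dots> = A $$ (0, 0) * mat_delete A 0 0 $$ (0, 0) - A $$ (0, 1) * mat_delete A 0 1 $$ (0, 0)"
    using d by (simp add: lessThan_Suc numeral_2_eq_2 cofactor_def det_single)
  finally show ?thesis
    using assms by (simp add: mat_delete_def)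
qed

lemma det_3:
  fixes A :: "'a :: comm_ring_1 mat"
  assumes A: "A \<in> carrier_mat 3 3"
  shows "Determinant.det A =
    A $$ (0, 0) * (A $$ (1, 1) * A $$ (2, 2) - A $$ (1, 2) * A $$ (2, 1)) -
    A $$ (0, 1) * (A $$ (1, 0) * A $$ (2, 2) - A $$ (1, 2) * A $$ (2, 0)) +
    A $$ (0, 2) * (A $$ (1, 0) * A $$ (2, 1) - A $$ (1, 1) * A $$ (2, 0))"
proof -
  have d: "mat_delete A 0 j \<in> carrier_mat 2 2" for j
    using assms by (auto simp: mat_delete_def)
  have "Determinant.det A = (\<Sum>j<3. A $$ (0, j) * cofactor A 0 j)"
    by (rule laplace_expansion_row[OF assms]) simp
  also have "\<dots> = A $$ (0, 0) * Determinant.det (mat_delete A 0 0) - A $$ (0, 1) * Determinant.det (mat_delete A 0 1) +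
      A $$ (0, 2) * Determinant.det (mat_delete A 0 2)"
    by (simp add: sum_less_3 cofactor_def)
  finally show ?thesis
    unfolding det_2[OF d] using assms by (simp add: mat_delete_def numeral_2_eq_2[symmetric])
qed

lemma E_generators_SU3: "{S1_mat, S2_mat, T_mat, V_mat} \<subseteq> carrier SU3"
proof -
  have "E_mat c a b k \<in> carrier SU3"
    if "(c, a, b, k) \<in> {(0, 1, 0, 0), (1, 0, 0, 0), (0, 0, 1, 0), (0, 0, 0, 1)}" for c a b k
  proof -
    have cnj: "cnj omega = - 1 - omega" "cnj rt = - rt"
      by (simp_all add: rt_expr omega_eq complex_eq_iff)
    have "E_mat c a b k * mat_adjoint (E_mat c a b k) = 1\<^sub>m 3"
    proof (rule eq_matI)
      note cr = mat_adjoint_carrier[OF E_mat_carrier]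
      fix i j assume "i < dim_row (1\<^sub>m 3)" "j < dim_col (1\<^sub>m 3)"
      then have ij: "i < 3" "j < 3" by auto
      have "(E_mat c a b k * mat_adjoint (E_mat c a b k)) $$ (i, j) =
          (\<Sum>l<3. E_entry c a b k i l * cnj (E_entry c a b k j l))"
        unfolding mult_mat_index_sum[OF E_mat_carrier cr ij]
        using ij by (intro sum.cong refl) (simp add: mat_adjoint_index[OF E_mat_carrier] E_mat_index)
      also have "\<dots> = 1\<^sub>m 3 $$ (i, j)"
        using that ij unfolding sum_less_3 less_3_cases
        by (elim insertE emptyE disjE Pair_inject; hypsubst;
            simp add: E_entry_def V_pow_entry_def omega_powers omega_cube;
            simp add: rt_expr omega_eq complex_eq_iff field_simps)
      finally show "(E_mat c a b k * mat_adjoint (E_mat c a b k)) $$ (i, j) = 1\<^sub>m 3 $$ (i, j)" .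
    qed (use carrier_matD[OF mat_adjoint_carrier[OF E_mat_carrier]] carrier_matD[OF E_mat_carrier] in auto)
    moreover have "Determinant.det (E_mat c a b k) = 1"
      unfolding det_3[OF E_mat_carrier] using that
      by (elim insertE emptyE Pair_inject; hypsubst;
          simp add: E_mat_index E_entry_def V_pow_entry_def omega_powers omega_cube omega_sq;
          simp add: rt_expr omega_eq complex_eq_iff field_simps)
    ultimately show ?thesis by (simp add: SU3_carrier_iff)
  qed
  then show ?thesis unfolding E_generators_eq by blast
qed

lemma generator_mult_E_set:
  assumes "h \<in> {S1_mat, S2_mat, T_mat, V_mat}" "x \<in> E_set"
  shows "h * x \<in> E_set"
proof -
  obtain c a b k where "k < 4" "x = E_mat c a b k" using assms(2) E_set_iff by blast
  then show ?thesis
    using assms(1) S1_mult S2_mult T_mult V_mult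
    by (auto simp: E_set_iff) (metis mod_less_divisor zero_less_numeral)+
qed

lemma E_group_eq: "E_group = E_set"
proof
  interpret SU: group SU3 by (rule group_SU3)
  note gen = E_generators_SU3
  have carr: "x \<in> carrier_mat 3 3" if "x \<in> E_set" for x
    using that by (auto simp: E_set_iff)
  have one: "1\<^sub>m 3 \<in> E_set" unfolding E_generators_eq(5) E_set_iff by (intro exI[of _ 0]) simp
  \<comment> \<open>The induction shows that left multiplication preserves \<open>E_set\<close>,
    instead of membership in \<open>E_set\<close>. In this form products compose at once, and
    membership follows by applying it to the identity matrix.\<close>
  have closed: "h \<in> carrier SU3 \<and> (\<forall>x\<in>E_set. h * x \<in> E_set)" if "h \<in> E_group" for h
    using that unfolding E_group_def
  proof (induction rule: generate.induct)
    case one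
    show ?case using SU.one_closed left_mult_one_mat[OF carr] by simp
  next
    case (incl h)
    then show ?case using generator_mult_E_set gen by blast
  next
    case (inv h)
    then have h: "h \<in> carrier SU3" "h \<in> carrier_mat 3 3" using gen by (auto simp: SU3_carrier_iff)
    have i: "inv\<^bsub>SU3\<^esub> h \<in> carrier SU3" "inv\<^bsub>SU3\<^esub> h \<in> carrier_mat 3 3" "inv\<^bsub>SU3\<^esub> h * h = 1\<^sub>m 3"
      using h SU.inv_closed[OF h(1)] SU.l_inv[OF h(1)] by (auto simp: SU3_carrier_iff)
    have cancel: "inv\<^bsub>SU3\<^esub> h * (h * x) = x" if "x \<in> E_set" for x
      using assoc_mult_mat[OF i(2) h(2) carr[OF that]] i(3) carr[OF that] by simp
    \<comment> \<open>Left multiplication by a generator is injective on a finite set, hence onto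
      it, so the inverse preserves the set as well.\<close>
    have "inj_on (\<lambda>x. h * x) E_set"
      by (rule inj_on_inverseI[of _ "\<lambda>x. inv\<^bsub>SU3\<^esub> h * x"]) (rule cancel)
    moreover have "(\<lambda>x. h * x) ` E_set \<subseteq> E_set"
      using generator_mult_E_set inv by blast
    ultimately have "(\<lambda>x. h * x) ` E_set = E_set"
      using endo_inj_surj[OF finite_E_set] by blast
    then have "inv\<^bsub>SU3\<^esub> h * x \<in> E_set" if "x \<in> E_set" for x
      using that cancel by (metis imageE)
    then show ?case using i by blast
  next
    case (eng h1 h2)
    have "h1 * h2 * x = h1 * (h2 * x)" if "x \<in> E_set" for x
      using eng.IH carr[OF that] by (auto simp: SU3_carrier_iff intro!: assoc_mult_mat)
    then show ?case using eng.IH SU.m_closed[of h1 h2] by auto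
  qed
  show "E_group \<subseteq> E_set"
  proof
    fix h assume "h \<in> E_group"
    then have "h * 1\<^sub>m 3 \<in> E_set" "h \<in> carrier_mat 3 3" using closed one by (auto simp: SU3_carrier_iff)
    then show "h \<in> E_set" by simp
  qed
  have mult: "h * x \<in> E_group" if "h \<in> {S1_mat, S2_mat, T_mat, V_mat}" "x \<in> E_group" for h x
    using generate.eng[OF generate.incl[OF that(1), of SU3]] that(2) unfolding E_group_def by simp
  \<comment> \<open>Normal forms are built from the right: powers of \<open>V\<close>, then
    \<open>T\<close>, \<open>S1\<close> and \<open>S2\<close> multiplied on the left.
    \<open>T\<close> is applied while the exponent of \<open>S1\<close> is 0, so no scalar
    arises.\<close>
  have V: "E_mat 0 0 0 k \<in> E_group" if "k < 4" for k
    using that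
  proof (induction k)
    case 0
    show ?case using generate.one[of SU3] by (simp add: E_group_def flip: E_generators_eq(5))
  next
    case (Suc k)
    then show ?case using mult[of V_mat "E_mat 0 0 0 k"] V_mult[of k 0 0 0] by simp
  qed
  have T: "E_mat 0 0 b k \<in> E_group" if "k < 4" for b k
  proof (induction b)
    case (Suc b)
    then show ?case using mult[of T_mat "E_mat 0 0 b k"] T_mult[of 0 0 b k] by simp
  qed (use V that in simp)
  have S1: "E_mat 0 a b k \<in> E_group" if "k < 4" for a b k
  proof (induction a)
    case (Suc a)
    then show ?case using mult[of S1_mat "E_mat 0 a b k"] S1_mult[of 0 a b k] by simp
  qed (use T that in simp)
  have "E_mat c a b k \<in> E_group" if "k < 4" for c a b k
  proof (induction c)
    case (Suc c)
    then show ?case using mult[of S2_mat "E_mat c a b k"] S2_mult[of c a b k] by simp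
  qed (use S1 that in simp)
  then show "E_set \<subseteq> E_group" by (auto simp: E_set_iff)
qed

lemma subgroup_E_group: "subgroup E_group SU3"
  unfolding E_group_def by (rule group.generate_is_subgroup[OF group_SU3 E_generators_SU3])

text \<open>The term with 0 has to stay: it vanishes unless \<open>m = n = 0\<close>, where it
  equals 24 because \<open>0 ^ 0 = 1\<close>.\<close>

theorem mckay_moment_E_group:
  "mckay_moment E_group m n = ((\<Sum>c<3. (3 * omega ^ c) ^ m * cnj (3 * omega ^ c) ^ n) + 24 * (0 ^ m * cnj 0 ^ n) +
     18 * (\<Sum>c<3. (omega ^ c) ^ m * cnj (omega ^ c) ^ n) +
     9 * (\<Sum>c<3. (- (omega ^ c)) ^ m * cnj (- (omega ^ c)) ^ n)) / 108"
proof -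
  have "finite E_group" by (simp add: E_group_eq finite_E_set)
  from mckay_moment_eq_trace_moment[OF subgroup_E_group this, of m n] show ?thesis
    unfolding E_group_eq card_E_set sum_mat_trace_E_set[of "\<lambda>t. t ^ m * cnj t ^ n"] by simp
qed

section \<open>Measures supported on torus grids\<close>

lemma torus_grid_subset: "torus_grid N \<subseteq> torus2"
  by (auto simp: torus_grid_def torus2_def)

lemma finite_torus_grid [simp]: "finite (torus_grid N)"
proof -
  have "torus_grid N \<subseteq> (\<lambda>(q1, q2). (cis (2 * pi * real q1 / (3 * real N)), cis (2 * pi * real q2 / (3 * real N)))) `
      ({..<3 * N} \<times> {..<3 * N})"
    by (auto simp: torus_grid_def)
  then show ?thesis by (rule finite_subset) auto
qed

lemma space_torus2_borel [simp]: "space torus2_borel = torus2"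
  by (simp add: torus2_borel_def space_restrict_space)

text \<open>\<open>Arg\<close> jumps, so the definition does not show continuity; on the torus,
  however, \<open>J_fun\<close> is a polynomial expression in the coordinates and their
  conjugates.\<close>

lemma J_fun_measurable [measurable]: "J_fun \<in> borel_measurable torus2_borel"
proof -
  have "(\<lambda>x. 4 * pi\<^sup>2 * (Im (fst x * snd x) - Im ((fst x)\<^sup>2 * cnj (snd x)) - Im ((snd x)\<^sup>2 * cnj (fst x))))
      \<in> borel_measurable (borel :: (complex \<times> complex) measure)"
    by (intro borel_measurable_continuous_onI continuous_intros)
  then have "(\<lambda>x. 4 * pi\<^sup>2 * (Im (fst x * snd x) - Im ((fst x)\<^sup>2 * cnj (snd x)) - Im ((snd x)\<^sup>2 * cnj (fst x))))
      \<in> borel_measurable torus2_borel"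
    unfolding torus2_borel_def by (rule measurable_restrict_space1)
  then show ?thesis
    by (rule measurable_cong[THEN iffD1, rotated]) (auto simp: torus2_def J_fun_unit)
qed

lemma R_fun_measurable [measurable]: "R_fun m n \<in> borel_measurable torus2_borel"
proof -
  have [measurable]: "fst \<in> borel_measurable (borel :: (complex \<times> complex) measure)"
    "snd \<in> borel_measurable (borel :: (complex \<times> complex) measure)"
    by (intro borel_measurable_continuous_onI continuous_intros)+
  have "R_fun m n \<in> borel_measurable borel"
    unfolding R_fun_def case_prod_beta by measurable
  then show ?thesis
    unfolding torus2_borel_def by (rule measurable_restrict_space1)
qed

text \<open>A measure with real weights on a finite set can hold all four grids at once. The
  negative coefficient forces the weights to be added as real numbers before they pass to
  \<open>ennreal\<close>, which is faithful only for nonnegative weights.\<close>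

definition grid_measure :: "(complex \<times> complex) set \<Rightarrow> (complex \<times> complex \<Rightarrow> real) \<Rightarrow> (complex \<times> complex) measure" where
  "grid_measure X w = distr (point_measure X (\<lambda>x. ennreal (w x))) torus2_borel (\<lambda>x. x)"

lemma sets_grid_measure [simp]: "sets (grid_measure X w) = sets torus2_borel"
  by (simp add: grid_measure_def)

context
  fixes X :: "(complex \<times> complex) set" and w :: "complex \<times> complex \<Rightarrow> real"
  assumes X: "finite X" "X \<subseteq> torus2" and w: "\<And>x. x \<in> X \<Longrightarrow> w x \<ge> 0"
begin

lemma id_measurable_point_measure: "(\<lambda>x. x) \<in> measurable (point_measure X (\<lambda>x. ennreal (w x))) torus2_borel"
  using X by auto

lemma nn_integral_grid_measure:
  assumes "f \<in> borel_measurable torus2_borel"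
  shows "(\<integral>\<^sup>+ x. f x \<partial>grid_measure X w) = (\<Sum>x\<in>X. ennreal (w x) * f x)"
  unfolding grid_measure_def
  using X assms by (simp add: nn_integral_distr[OF id_measurable_point_measure] nn_integral_point_measure_finite mult.commute)

lemma emeasure_grid_measure:
  assumes "A \<in> sets torus2_borel"
  shows "emeasure (grid_measure X w) A = ennreal (\<Sum>x\<in>X. w x * indicat_real A x)"
proof -
  have "emeasure (grid_measure X w) A = (\<integral>\<^sup>+ x. indicator A x \<partial>grid_measure X w)"
    using assms by simp
  also have "\<dots> = (\<Sum>x\<in>X. ennreal (w x) * indicator A x)"
    using assms by (intro nn_integral_grid_measure) simp
  also have "\<dots> = (\<Sum>x\<in>X. ennreal (w x * indicat_real A x))"
    using w by (intro sum.cong refl) (auto simp: indicator_def)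
  also have "\<dots> = ennreal (\<Sum>x\<in>X. w x * indicat_real A x)"
    using w by (intro sum_ennreal) auto
  finally show ?thesis .
qed

lemma measure_grid_measure:
  assumes "A \<in> sets torus2_borel"
  shows "measure (grid_measure X w) A = (\<Sum>x\<in>X. w x * indicat_real A x)"
  using emeasure_grid_measure[OF assms] w
  by (simp add: measure_def sum_nonneg)

lemma finite_grid_measure: "finite_measure (grid_measure X w)"
proof (rule finite_measureI)
  have "emeasure (grid_measure X w) torus2 < \<infinity>"
    using sets.top[of torus2_borel] by (subst emeasure_grid_measure) auto
  then show "emeasure (grid_measure X w) (space (grid_measure X w)) \<noteq> \<infinity>"
    by (simp add: grid_measure_def)
qed

lemma has_bochner_integral_grid_measure:
  fixes f :: "complex \<times> complex \<Rightarrow> complex"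
  assumes f: "f \<in> borel_measurable torus2_borel"
  shows "has_bochner_integral (grid_measure X w) f (\<Sum>x\<in>X. w x *\<^sub>R f x)"
proof -
  have "has_bochner_integral (count_space X) (\<lambda>x. w x *\<^sub>R f x) (\<Sum>x\<in>X. w x *\<^sub>R f x)"
    using X by (simp add: has_bochner_integral_iff integrable_count_space lebesgue_integral_count_space_finite)
  then have "has_bochner_integral (point_measure X (\<lambda>x. ennreal (w x))) f (\<Sum>x\<in>X. w x *\<^sub>R f x)"
    unfolding point_measure_def using w by (intro has_bochner_integral_density) (auto simp: AE_count_space)
  then show ?thesis
    unfolding grid_measure_def
    by (intro has_bochner_integral_distr[OF f id_measurable_point_measure])
qed

end

text \<open>The identity is not measurable from the discrete measure into \<open>torus2_borel\<close>, whose space is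
  smaller, so the generic lemmas on \<open>distr\<close> do not apply to \<open>d_measure\<close>.\<close>

lemma emeasure_d_measure:
  assumes "A \<in> sets torus2_borel"
  shows "emeasure (d_measure N) A = emeasure (measure_pmf (pmf_of_set (torus_grid N))) A"
proof -
  let ?p = "measure_pmf (pmf_of_set (torus_grid N))"
  have "d_measure N = measure_of (space torus2_borel) (sets torus2_borel) (emeasure ?p)"
    by (simp add: d_measure_def distr_def)
  moreover have "countably_additive (sets torus2_borel) (emeasure ?p)"
    by (rule countably_additiveI) (auto intro!: suminf_emeasure)
  ultimately show ?thesis
    using assms sets.sigma_algebra_axioms[of torus2_borel]
    by (simp only:, intro emeasure_measure_of_sigma) (auto simp: positive_def)
qed

text \<open>Replaces the discrete measure on all pairs of complex numbers by a point measure living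
  on the grid, whose inclusion into the torus is measurable.\<close>

lemma d_measure_eq_grid_measure:
  assumes "torus_grid N \<noteq> {}"
  shows "d_measure N = grid_measure (torus_grid N) (\<lambda>_. 1 / card (torus_grid N))"
proof (rule measure_eqI)
  show "sets (d_measure N) = sets (grid_measure (torus_grid N) (\<lambda>_. 1 / card (torus_grid N)))"
    by (simp add: d_measure_def)
  fix A assume "A \<in> sets (d_measure N)"
  then have A: "A \<in> sets torus2_borel" by (simp add: d_measure_def)
  have "emeasure (measure_pmf (pmf_of_set (torus_grid N))) A = ennreal (card (torus_grid N \<inter> A) / card (torus_grid N))"
    using assms by (simp add: measure_pmf.emeasure_eq_measure measure_pmf_of_set)
  also have "card (torus_grid N \<inter> A) / card (torus_grid N) =
      (\<Sum>x\<in>torus_grid N. 1 / card (torus_grid N) * indicat_real A x)"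
  proof -
    have "(\<Sum>x\<in>torus_grid N. 1 / card (torus_grid N) * indicat_real A x) =
        (\<Sum>x\<in>torus_grid N \<inter> A. 1 / card (torus_grid N))"
      by (rule sum.mono_neutral_cong_right) (auto simp: indicator_def)
    then show ?thesis by simp
  qed
  also have "ennreal \<dots> = emeasure (grid_measure (torus_grid N) (\<lambda>_. 1 / card (torus_grid N))) A"
    by (rule emeasure_grid_measure[symmetric]) (use A torus_grid_subset in auto)
  finally show "emeasure (d_measure N) A = emeasure (grid_measure (torus_grid N) (\<lambda>_. 1 / card (torus_grid N))) A"
    by (simp add: emeasure_d_measure[OF A])
qed

lemma measure_d_measure:
  assumes "torus_grid N \<noteq> {}" "A \<in> sets torus2_borel"
  shows "measure (d_measure N) A = (\<Sum>x\<in>torus_grid N. 1 / card (torus_grid N) * indicat_real A x)"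
  unfolding d_measure_eq_grid_measure[OF assms(1)]
  by (rule measure_grid_measure) (use assms torus_grid_subset in auto)

lemma measure_J2d_measure:
  assumes "torus_grid N \<noteq> {}" and A: "A \<in> sets torus2_borel"
  shows "measure (J2d_measure N) A = (\<Sum>x\<in>torus_grid N. (J_fun x)\<^sup>2 / card (torus_grid N) * indicat_real A x)"
proof -
  let ?w = "\<lambda>_ :: complex \<times> complex. 1 / card (torus_grid N)"
  have [measurable]: "J_fun \<in> borel_measurable (d_measure N)"
    using J_fun_measurable measurable_cong_sets[of "d_measure N" torus2_borel] by (auto simp: d_measure_def)
  have "emeasure (J2d_measure N) A = (\<integral>\<^sup>+ x. ennreal ((J_fun x)\<^sup>2) * indicator A x \<partial>d_measure N)"
    unfolding J2d_measure_def using A by (intro emeasure_density) (auto simp: d_measure_def)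
  also have "\<dots> = (\<Sum>x\<in>torus_grid N. ennreal (?w x) * (ennreal ((J_fun x)\<^sup>2) * indicator A x))"
    unfolding d_measure_eq_grid_measure[OF assms(1)]
    by (rule nn_integral_grid_measure) (use A torus_grid_subset in auto)
  also have "\<dots> = (\<Sum>x\<in>torus_grid N. ennreal ((J_fun x)\<^sup>2 / card (torus_grid N) * indicat_real A x))"
    by (intro sum.cong refl) (auto simp: indicator_def simp flip: ennreal_mult)
  also have "\<dots> = ennreal (\<Sum>x\<in>torus_grid N. (J_fun x)\<^sup>2 / card (torus_grid N) * indicat_real A x)"
    by (intro sum_ennreal) auto
  finally show ?thesis
    by (simp add: measure_def sum_nonneg)
qed

section \<open>Sums over torus grids\<close>

definition unity_pt :: "nat \<Rightarrow> nat \<Rightarrow> complex" where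
  "unity_pt M q = cis (2 * pi * real q / real M)"

lemma unity_pt_power: "unity_pt M q = unity_pt M 1 ^ q"
  by (simp add: unity_pt_def Complex.DeMoivre mult.commute)

lemma unity_pt_add: "unity_pt M (q + r) = unity_pt M q * unity_pt M r"
  by (subst (1 2 3) unity_pt_power) (simp add: power_add)

lemma unity_pt_self: "M > 0 \<Longrightarrow> unity_pt M (M * k) = 1"
proof -
  assume "M > 0"
  then have "2 * pi * real (M * k) / real M = 2 * pi * real k" by simp
  then show ?thesis unfolding unity_pt_def by (simp only: cis_multiple_2pi[OF Ints_of_nat])
qed

lemma unity_pt_mod: "M > 0 \<Longrightarrow> unity_pt M (q mod M) = unity_pt M q"
  using unity_pt_add[of M "M * (q div M)" "q mod M"] unity_pt_self[of M "q div M"] by simp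

lemma unity_pt_mult_cancel: "k > 0 \<Longrightarrow> unity_pt (k * M) (k * q) = unity_pt M q"
  by (simp add: unity_pt_def field_simps)

lemma unity_pt_eq_1: "M > 0 \<Longrightarrow> M dvd q \<Longrightarrow> unity_pt M q = 1"
  by (auto simp: unity_pt_self)

lemma norm_unity_pt [simp]: "norm (unity_pt M q) = 1"
  by (simp add: unity_pt_def)

lemma inj_on_unity_pt: "M > 0 \<Longrightarrow> inj_on (unity_pt M) {..<M}"
  using Complex.bij_betw_roots_unity[of M] by (simp add: bij_betw_def unity_pt_def[abs_def])

definition grid_index :: "nat \<Rightarrow> (nat \<times> nat) set" where
  "grid_index N = {(q1, q2). q1 < 3 * N \<and> q2 < 3 * N \<and> 3 dvd (q1 + q2)}"

lemma bij_betw_torus_grid: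
  assumes "N > 0"
  shows "bij_betw (\<lambda>(q1, q2). (unity_pt (3 * N) q1, unity_pt (3 * N) q2)) (grid_index N) (torus_grid N)"
  unfolding bij_betw_def
proof
  show "inj_on (\<lambda>(q1, q2). (unity_pt (3 * N) q1, unity_pt (3 * N) q2)) (grid_index N)"
    using inj_on_unity_pt[of "3 * N"] assms by (auto simp: inj_on_def grid_index_def)
  show "(\<lambda>(q1, q2). (unity_pt (3 * N) q1, unity_pt (3 * N) q2)) ` grid_index N = torus_grid N"
    by (fastforce simp: torus_grid_def grid_index_def unity_pt_def)
qed

lemma sum_torus_grid:
  assumes "N > 0"
  shows "(\<Sum>x\<in>torus_grid N. f x) = (\<Sum>(q1, q2)\<in>grid_index N. f (unity_pt (3 * N) q1, unity_pt (3 * N) q2))"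
  using sum.reindex_bij_betw[OF bij_betw_torus_grid[OF assms], of f] by (simp add: case_prod_beta')

lemma card_torus_grid: "N > 0 \<Longrightarrow> card (torus_grid N) = card (grid_index N)"
  using bij_betw_same_card[OF bij_betw_torus_grid] by metis

lemma omega_unity_pt: "omega ^ c = unity_pt 3 c"
  unfolding omega_def by (subst unity_pt_power) (simp add: unity_pt_def)

text \<open>For \<open>N\<close> prime to 3 the grid splits by the Chinese remainder theorem.\<close>

lemma sum_grid_index:
  assumes "N = 1 \<or> N = 2 \<or> N = 4"
  shows "(\<Sum>(q1, q2)\<in>grid_index N. f (q1, q2)) =
    (\<Sum>(c, a, b)\<in>{..<3} \<times> {..<N} \<times> {..<N}. f ((N * c + 3 * a) mod (3 * N), (2 * N * c + 3 * b) mod (3 * N)))"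
proof -
  have A: "\<forall>N\<in>set [1, 2, 4]. \<forall>q1\<in>set [0..<3 * N]. \<forall>q2\<in>set [0..<3 * N]. 3 dvd q1 + q2 \<longrightarrow>
      (N * (N * q1 mod 3) + 3 * (3 * q1 mod N)) mod (3 * N) = q1 \<and>
      (2 * N * (N * q1 mod 3) + 3 * (3 * q2 mod N)) mod (3 * N) = q2"
    by code_simp
  have B: "\<forall>N\<in>set [1, 2, 4]. \<forall>c\<in>set [0..<3]. \<forall>a\<in>set [0..<N]. \<forall>b\<in>set [0..<N].
      N * ((N * c + 3 * a) mod (3 * N)) mod 3 = c \<and> 3 * ((N * c + 3 * a) mod (3 * N)) mod N = a \<and>
      3 * ((2 * N * c + 3 * b) mod (3 * N)) mod N = b \<and>
      3 dvd (N * c + 3 * a) mod (3 * N) + (2 * N * c + 3 * b) mod (3 * N)"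
    by code_simp
  have N: "N \<in> set [1, 2, 4]" using assms by auto
  define i where "i = (\<lambda>(c, a, b). ((N * c + 3 * a) mod (3 * N), (2 * N * c + 3 * b) mod (3 * N)))"
  \<comment> \<open>For these \<open>N\<close> both \<open>N * N = 1\<close> mod 3 and
    \<open>3 * 3 = 1\<close> mod \<open>N\<close> hold, so multiplication by \<open>N\<close> and by
    3 inverts the Chinese remainder map. The residue of \<open>q2\<close> mod 3 is the negative of
    that of \<open>q1\<close>, hence the factor 2 in \<open>i\<close>.\<close>
  define j :: "nat \<times> nat \<Rightarrow> nat \<times> nat \<times> nat"
    where "j = (\<lambda>(q1, q2). (N * q1 mod 3, 3 * q1 mod N, 3 * q2 mod N))"
  have "(\<Sum>x\<in>grid_index N. f x) = (\<Sum>x\<in>{..<3} \<times> {..<N} \<times> {..<N}. f (i x))"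
  proof (rule sum.reindex_bij_witness[of _ i j])
    fix x assume "x \<in> grid_index N"
    then obtain q1 q2 where x: "x = (q1, q2)" "q1 < 3 * N" "q2 < 3 * N" "3 dvd q1 + q2"
      by (auto simp: grid_index_def)
    show *: "i (j x) = x"
      using A[rule_format, OF N, of q1 q2] x by (simp add: i_def j_def)
    show "j x \<in> {..<3} \<times> {..<N} \<times> {..<N}" using assms by (auto simp: x j_def)
    show "f (i (j x)) = f x" by (simp add: *)
  next
    fix y :: "nat \<times> nat \<times> nat" assume "y \<in> {..<3} \<times> {..<N} \<times> {..<N}"
    then obtain c a b where y: "y = (c, a, b)" "c < 3" "a < N" "b < N" by auto
    have "N > 0" using assms by auto
    then show "j (i y) = y" "i y \<in> grid_index N"
      using B[rule_format, OF N, of c a b] y by (simp_all add: i_def j_def grid_index_def)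
  qed
  then show ?thesis by (simp add: i_def case_prod_beta')
qed

text \<open>The grid is the product of the centre of SU(3) and the points of order dividing
  \<open>N\<close>: the scalar \<open>omega ^ c\<close> has second coordinate
  \<open>omega ^ (2 * c)\<close>, the inverse of \<open>omega ^ c\<close>.\<close>

lemma sum_torus_grid_coprime:
  assumes N: "N = 1 \<or> N = 2 \<or> N = 4"
  shows "(\<Sum>x\<in>torus_grid N. f x) =
    (\<Sum>c<3. \<Sum>a<N. \<Sum>b<N. f (omega ^ c * unity_pt N a, omega ^ (2 * c) * unity_pt N b))"
proof -
  have pos: "N > 0" using N by auto
  have e: "unity_pt (3 * N) ((N * c + 3 * a) mod (3 * N)) = omega ^ c * unity_pt N a" for c a
    using pos unity_pt_mult_cancel[of N 3 c] unity_pt_mult_cancel[of 3 N a]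
    by (simp add: unity_pt_mod unity_pt_add omega_unity_pt mult.commute)
  have e2: "unity_pt (3 * N) ((2 * N * c + 3 * b) mod (3 * N)) = omega ^ (2 * c) * unity_pt N b" for c b
    using e[of "2 * c" b] by (simp add: mult_ac)
  have "(\<Sum>x\<in>torus_grid N. f x) =
      (\<Sum>(c, a, b)\<in>{..<3} \<times> {..<N} \<times> {..<N}. f (omega ^ c * unity_pt N a, omega ^ (2 * c) * unity_pt N b))"
    unfolding sum_torus_grid[OF pos]
    using sum_grid_index[OF N, of "\<lambda>(q1, q2). f (unity_pt (3 * N) q1, unity_pt (3 * N) q2)"]
    by (simp only: prod.case e e2)
  then show ?thesis by (simp add: sum.cartesian_product case_prod_beta')
qed

lemma card_torus_grid_coprime: "N = 1 \<or> N = 2 \<or> N = 4 \<Longrightarrow> card (torus_grid N) = 3 * N * N"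
  using sum_torus_grid_coprime[of N "\<lambda>_. 1 :: nat"] by simp

definition torus_trace :: "complex \<times> complex \<Rightarrow> complex" where
  "torus_trace = (\<lambda>(w1, w2). w1 + inverse w2 + inverse w1 * w2)"

lemma R_fun_torus_trace:
  assumes "x \<in> torus2"
  shows "R_fun m n x = torus_trace x ^ m * cnj (torus_trace x) ^ n"
proof -
  obtain z w where x: "x = (z, w)" "norm z = 1" "norm w = 1" using assms by (auto simp: torus2_def)
  have inv: "inverse u = cnj u" if "norm u = 1" for u :: complex
    using complex_norm_square[of u] that by (intro inverse_unique) simp
  show ?thesis
    unfolding x(1) R_fun_def torus_trace_def prod.case inv[OF x(2)] inv[OF x(3)] by simp
qed

lemma norm_omega [simp]: "norm omega = 1"
  by (simp add: omega_def)

text \<open>All three eigenvalues are multiplied by the same scalar, because the inverse of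
  \<open>omega ^ (2 * c)\<close> is \<open>omega ^ c\<close>.\<close>

lemma torus_trace_rotate:
  "torus_trace (omega ^ c * z, omega ^ (2 * c) * w) = omega ^ c * torus_trace (z, w)"
proof -
  have "omega ^ (3 * c) = 1" by (simp add: power_mult omega_cube)
  then have *: "omega ^ c * omega ^ (2 * c) = 1" by (simp flip: power_add)
  have nz: "omega \<noteq> 0" using norm_omega by (metis norm_zero zero_neq_one)
  have "inverse (omega ^ (2 * c)) = omega ^ c" using * by (metis inverse_unique mult.commute)
  moreover have "inverse (omega ^ c) * omega ^ (2 * c) = omega ^ c"
    using nz by (simp only: mult_2 power_add) (simp add: field_simps)
  ultimately show ?thesis
    by (simp add: torus_trace_def inverse_mult_distrib distrib_left mult_ac)
qed

text \<open>In the monomials z w, z^2 / w and w^2 / z the factor \<open>omega ^ c\<close> enters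
  with the exponents 3, 0 and 3.\<close>

lemma J_fun_rotate:
  assumes "norm z = 1" "norm w = 1"
  shows "J_fun (omega ^ c * z, omega ^ (2 * c) * w) = J_fun (z, w)"
proof -
  let ?v = "omega ^ c"
  have v: "?v * cnj ?v = 1" using complex_norm_square[of ?v] by (simp add: norm_power)
  have "?v ^ 3 = (omega ^ 3) ^ c" by (simp only: power_mult[symmetric] mult.commute)
  then have "?v ^ 3 = 1" by (simp add: omega_cube)
  then have v3: "?v * ?v * ?v = 1" by (simp add: power3_eq_cube)
  have e: "omega ^ (2 * c) = ?v * ?v" by (simp add: mult_2 power_add)
  have "?v * z * (omega ^ (2 * c) * w) = (?v * ?v * ?v) * (z * w)"
    unfolding e by (simp only: mult_ac)
  moreover have "(?v * z)\<^sup>2 * cnj (omega ^ (2 * c) * w) = (?v * cnj ?v) * (?v * cnj ?v) * (z\<^sup>2 * cnj w)"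
    unfolding e power2_eq_square complex_cnj_mult by (simp only: mult_ac)
  moreover have "(omega ^ (2 * c) * w)\<^sup>2 * cnj (?v * z) = (?v * ?v * ?v) * (?v * cnj ?v) * (w\<^sup>2 * cnj z)"
    unfolding e power2_eq_square complex_cnj_mult by (simp only: mult_ac)
  moreover have "norm (?v * z) = 1" "norm (omega ^ (2 * c) * w) = 1"
    using assms by (simp_all add: norm_mult norm_power)
  ultimately show ?thesis
    using assms by (simp only: J_fun_unit v v3 mult_1_left)
qed

lemma unity_pt_4:
  "unity_pt 4 0 = 1" "unity_pt 4 1 = \<i>" "unity_pt 4 2 = -1" "unity_pt 4 3 = -\<i>"
proof -
  show "unity_pt 4 0 = 1" by (simp add: unity_pt_def)
  show 1: "unity_pt 4 1 = \<i>" by (simp add: unity_pt_def)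
  show "unity_pt 4 2 = -1" "unity_pt 4 3 = -\<i>"
    by (simp_all only: unity_pt_power[of 4 2] unity_pt_power[of 4 3] 1, simp_all add: power3_eq_cube)
qed

lemma unity_pt_2: "unity_pt 2 0 = 1" "unity_pt 2 1 = -1"
  by (simp_all add: unity_pt_def)

lemma sum_torus_grid_1:
  "(\<Sum>x\<in>torus_grid 1. h (torus_trace x)) = (\<Sum>c<3. h (3 * omega ^ c))" for h :: "complex \<Rightarrow> complex"
  by (subst sum_torus_grid_coprime)
     (simp_all add: torus_trace_rotate, simp add: unity_pt_def torus_trace_def mult.commute)

text \<open>The points of order dividing 2 are the diagonal sign matrices of determinant 1: the
  identity with trace 3, and three matrices with two entries -1 and hence trace -1.\<close>

lemma sum_torus_grid_2:
  "(\<Sum>x\<in>torus_grid 2. h (torus_trace x)) = (\<Sum>c<3. h (3 * omega ^ c) + 3 * h (- (omega ^ c)))"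
  for h :: "complex \<Rightarrow> complex"
proof -
  have "(\<Sum>a<2. \<Sum>b<2. h (v * torus_trace (unity_pt 2 a, unity_pt 2 b))) = h (3 * v) + 3 * h (- v)" for v
    by (simp add: numeral_2_eq_2 unity_pt_2[unfolded One_nat_def numeral_2_eq_2] torus_trace_def mult.commute)
  then show ?thesis
    by (subst sum_torus_grid_coprime) (simp_all add: torus_trace_rotate)
qed

text \<open>Three distinct fourth roots of unity with product 1 must be 1, i and -i. Their sum is 1,
  they occur in six orders, and the square of \<open>J_fun\<close> is 64 pi^4 there; 6 * 64 =
  384.\<close>

lemma sum_torus_grid_4:
  "(\<Sum>x\<in>torus_grid 4. (J_fun x)\<^sup>2 *\<^sub>R h (torus_trace x)) = (384 * pi ^ 4) *\<^sub>R (\<Sum>c<3. h (omega ^ c))"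
  for h :: "complex \<Rightarrow> complex"
proof -
  have four: "{..<4::nat} = {0, 1, 2, 3}" by auto
  have "(\<Sum>a<4. \<Sum>b<4. (J_fun (unity_pt 4 a, unity_pt 4 b))\<^sup>2 *\<^sub>R h (v * torus_trace (unity_pt 4 a, unity_pt 4 b))) =
      (384 * pi ^ 4) *\<^sub>R h v" for v
    unfolding four
    by (simp add: unity_pt_4 unity_pt_4(2)[unfolded One_nat_def] J_fun_unit torus_trace_def power_mult_distrib)
       (simp add: scaleR_conv_of_real)
  then show ?thesis
    by (subst sum_torus_grid_coprime) (simp_all add: torus_trace_rotate J_fun_rotate scaleR_sum_right)
qed

lemma omega_square: "omega\<^sup>2 = cnj omega"
  by (simp add: omega_eq power2_eq_square complex_eq_iff field_simps)

lemma inverse_omega: "inverse omega = cnj omega" "inverse (cnj omega) = omega"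
proof -
  have "omega * cnj omega = 1" using complex_norm_square[of omega] by simp
  then show "inverse omega = cnj omega" "inverse (cnj omega) = omega"
    by (auto intro!: inverse_unique simp: mult.commute)
qed

lemma sum_torus_grid_3:
  "(\<Sum>x\<in>torus_grid 3. (J_fun x)\<^sup>2 *\<^sub>R h (torus_trace x)) = (648 * pi ^ 4) *\<^sub>R h 0"
  for h :: "complex \<Rightarrow> complex"
proof -
  define F where "F = (\<lambda>(q1, q2). (J_fun (unity_pt 9 q1, unity_pt 9 q2))\<^sup>2 *\<^sub>R h (torus_trace (unity_pt 9 q1, unity_pt 9 q2)))"
  define S :: "(nat \<times> nat) list" where "S = [(0, 3), (0, 6), (3, 0), (6, 0), (3, 3), (6, 6)]"
  \<comment> \<open>Off \<open>S\<close> two of the three eigenvalues coincide, so \<open>J\<close> vanishes.\<close>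
  have cases: "\<forall>q1\<in>set [0..<9]. \<forall>q2\<in>set [0..<9]. 3 dvd q1 + q2 \<longrightarrow>
      (q1, q2) \<in> set [(0, 3), (0, 6), (3, 0), (6, 0), (3, 3), (6, 6)] \<or>
      (q1 + q2) mod 9 = 0 \<or> q2 = (q1 + q1) mod 9 \<or> q1 = (q2 + q2) mod 9"
    by code_simp
  have zero: "F x = 0" if x: "x \<in> grid_index 3 - set S" for x
  proof -
    obtain q1 q2 where q: "x = (q1, q2)" "q1 < 9" "q2 < 9" "3 dvd q1 + q2"
      using x by (auto simp: grid_index_def)
    define z w where "z = unity_pt 9 q1" and "w = unity_pt 9 q2"
    have n: "norm z = 1" "norm w = 1" by (simp_all add: z_def w_def)
    have c: "z * cnj z = 1" "w * cnj w = 1"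
      using complex_norm_square[of z] complex_norm_square[of w] n by simp_all
    have "(q1 + q2) mod 9 = 0 \<or> q2 = (q1 + q1) mod 9 \<or> q1 = (q2 + q2) mod 9"
      using cases[rule_format, of q1 q2, folded S_def] q x by auto
    \<comment> \<open>The three possible coincidences among the eigenvalues z, 1 / w and w / z,
      cleared of denominators.\<close>
    then consider "z * w = 1" | "w = z * z" | "z = w * w"
      using unity_pt_mod[of 9 "q1 + q2"] unity_pt_mod[of 9 "q1 + q1"] unity_pt_mod[of 9 "q2 + q2"]
      by (auto simp: z_def w_def unity_pt_add unity_pt_eq_1)
    then have "Im (z * w) - Im (z\<^sup>2 * cnj w) - Im (w\<^sup>2 * cnj z) = 0"
    proof cases
      case 1
      then have w: "w = cnj z" using inverse_unique[OF 1] inverse_unique[OF c(1)] by simp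
      have "z\<^sup>2 * cnj w = z ^ 3" "w\<^sup>2 * cnj z = cnj (z ^ 3)"
        by (simp_all add: w power2_eq_square power3_eq_cube)
      then show ?thesis using 1 by (simp only: cnj.simps one_complex.simps)
    next
      case 2
      have "z\<^sup>2 * cnj w = (z * cnj z) * (z * cnj z)" "w\<^sup>2 * cnj z = z * w * (z * cnj z)"
        by (simp_all add: 2 power2_eq_square mult_ac)
      then show ?thesis using c by simp
    next
      case 3
      have "w\<^sup>2 * cnj z = (w * cnj w) * (w * cnj w)" "z\<^sup>2 * cnj w = z * w * (w * cnj w)"
        by (simp_all add: 3 power2_eq_square mult_ac)
      then show ?thesis using c by simp
    qed
    then show ?thesis using n by (simp add: F_def q(1) J_fun_unit flip: z_def w_def)
  qed
  have e: "unity_pt 9 0 = 1" "unity_pt 9 3 = omega" "unity_pt 9 6 = cnj omega"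
    using unity_pt_mult_cancel[of 3 3 0] unity_pt_mult_cancel[of 3 3 1] unity_pt_mult_cancel[of 3 3 2]
      omega_unity_pt[of 0] omega_unity_pt[of 1] omega_unity_pt[of 2] omega_square by simp_all
  \<comment> \<open>The eigenvalues are 1, \<open>omega\<close> and \<open>cnj omega\<close> in some
    order, with all squared distances equal to 3; so the square of \<open>J_fun\<close> is 4 pi^4 *
    27, and six orders give 648 pi^4.\<close>
  have J: "J_fun (z, w) ^ 2 = 108 * pi ^ 4" and tr: "torus_trace (z, w) = 0"
    if zw: "(z, w) \<in> {(1, omega), (1, cnj omega), (omega, 1), (cnj omega, 1), (omega, omega), (cnj omega, cnj omega)}"
    for z w
  proof -
    have n: "norm z = 1" "norm w = 1" using zw by auto
    show "J_fun (z, w) ^ 2 = 108 * pi ^ 4"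
      unfolding J_fun_unit[OF n] using zw
      by (auto simp: omega_eq power2_eq_square complex_mult field_simps power4_eq_xxxx)
    show "torus_trace (z, w) = 0"
      using zw by (auto simp: torus_trace_def inverse_omega) (auto simp: omega_eq complex_eq_iff)
  qed
  have "(\<Sum>x\<in>torus_grid 3. (J_fun x)\<^sup>2 *\<^sub>R h (torus_trace x)) = (\<Sum>x\<in>grid_index 3. F x)"
    using sum_torus_grid[of 3 "\<lambda>x. (J_fun x)\<^sup>2 *\<^sub>R h (torus_trace x)"] by (simp add: F_def case_prod_beta')
  also have "\<dots> = (\<Sum>x\<in>set S. F x)"
  proof (rule sum.mono_neutral_right)
    show "finite (grid_index 3)"
      by (rule finite_subset[of _ "{..<9} \<times> {..<9}"]) (auto simp: grid_index_def)
    show "set S \<subseteq> grid_index 3" by (auto simp: S_def grid_index_def)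
  qed (use zero in auto)
  also have "\<dots> = (\<Sum>x\<in>set S. (108 * pi ^ 4) *\<^sub>R h 0)"
    by (intro sum.cong refl) (auto simp: S_def F_def e J tr)
  also have "\<dots> = (648 * pi ^ 4) *\<^sub>R h 0"
    by (simp add: S_def) (simp add: scaleR_conv_of_real)
  finally show ?thesis .
qed

text \<open>The Chinese remainder splitting covers only grids prime to 3, so these points are
  counted by enumeration.\<close>

lemma card_torus_grid_3: "card (torus_grid 3) = 27"
proof -
  have "grid_index 3 = set (filter (\<lambda>(q1, q2). 3 dvd q1 + q2) (List.product [0..<9] [0..<9]))"
    by (auto simp: grid_index_def)
  moreover have "length (remdups (filter (\<lambda>(q1, q2). 3 dvd q1 + q2) (List.product [0..<9] [0..<9]))) = 27"
    by code_simp
  ultimately have "card (grid_index 3) = 27"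
    by (metis length_remdups_card_conv)
  then show ?thesis by (simp add: card_torus_grid)
qed

section \<open>The spectral measure\<close>

text \<open>Where the negative term is supported, the second grid contributes 1/36, more than the
  1/54 that is subtracted; this keeps the combined measure positive.\<close>

lemma torus_grid_1_subset_2: "torus_grid 1 \<subseteq> torus_grid 2"
proof
  fix x assume "x \<in> torus_grid 1"
  then obtain q1 q2 where q: "x = (cis (2 * pi * real q1 / 3), cis (2 * pi * real q2 / 3))"
    "q1 < 3" "q2 < 3" "3 dvd q1 + q2"
    by (auto simp: torus_grid_def)
  then have "x = (cis (2 * pi * real (2 * q1) / (3 * real 2)), cis (2 * pi * real (2 * q2) / (3 * real 2)))"
    "2 * q1 < 3 * 2" "2 * q2 < 3 * 2" "3 dvd 2 * q1 + 2 * q2"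
    by (simp_all add: field_simps, presburger)
  then show "x \<in> torus_grid 2"
    unfolding torus_grid_def by blast
qed

text \<open>One coefficient is negative, so the combination is not a sum of measures; its value is
  prescribed set by set for a finite measure.\<close>

theorem theorem3p5:
  shows "\<exists>\<epsilon>. finite_measure \<epsilon> \<and> sets \<epsilon> = sets torus2_borel \<and>
    (\<forall>A\<in>sets torus2_borel. measure \<epsilon> A =
        1 / (48 * pi ^ 4) * measure (J2d_measure 4) A
      + 1 / (108 * pi ^ 4) * measure (J2d_measure 3) A
      + 1 / 3 * measure (d_measure 2) A
      - 1 / 18 * measure (d_measure 1) A) \<and>
    spectral_measure_T2 E_group \<epsilon>"
proof -
  have card: "card (torus_grid 1) = 3" "card (torus_grid 2) = 12" "card (torus_grid 3) = 27" "card (torus_grid 4) = 48"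
    using card_torus_grid_coprime[of 1] card_torus_grid_coprime[of 2] card_torus_grid_coprime[of 4] card_torus_grid_3
    by simp_all
  then have ne: "torus_grid 1 \<noteq> {}" "torus_grid 2 \<noteq> {}" "torus_grid 3 \<noteq> {}" "torus_grid 4 \<noteq> {}"
    by auto
  define X where "X = torus_grid 1 \<union> torus_grid 2 \<union> torus_grid 3 \<union> torus_grid 4"
  have X: "finite X" "X \<subseteq> torus2" using torus_grid_subset by (auto simp: X_def)
  \<comment> \<open>Weights of single points; the divisors 48, 27, 12 and 3 are the sizes of the
    grids.\<close>
  define w where "w x = 1 / (48 * pi ^ 4) * ((J_fun x)\<^sup>2 / 48 * indicat_real (torus_grid 4) x)
    + 1 / (108 * pi ^ 4) * ((J_fun x)\<^sup>2 / 27 * indicat_real (torus_grid 3) x)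
    + 1 / 3 * (1 / 12 * indicat_real (torus_grid 2) x) - 1 / 18 * (1 / 3 * indicat_real (torus_grid 1) x)" for x
  have w: "w x \<ge> 0" for x
  proof -
    have "1 / 18 * (1 / 3 * indicat_real (torus_grid 1) x) \<le> 1 / 3 * (1 / 12 * indicat_real (torus_grid 2) x)"
      using torus_grid_1_subset_2 by (auto simp: indicator_def)
    moreover have "0 \<le> 1 / (48 * pi ^ 4) * ((J_fun x)\<^sup>2 / 48 * indicat_real (torus_grid 4) x)"
      "0 \<le> 1 / (108 * pi ^ 4) * ((J_fun x)\<^sup>2 / 27 * indicat_real (torus_grid 3) x)"
      by simp_all
    ultimately show ?thesis unfolding w_def by linarith
  qed
  have restrict: "(\<Sum>x\<in>X. indicat_real (torus_grid N) x *\<^sub>R g x) = (\<Sum>x\<in>torus_grid N. g x)"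
    if "torus_grid N \<subseteq> X" for N and g :: "complex \<times> complex \<Rightarrow> 'b :: real_vector"
    using X(1) that by (intro sum.mono_neutral_cong_right) (auto simp: indicator_def)
  have sub: "torus_grid 1 \<subseteq> X" "torus_grid 2 \<subseteq> X" "torus_grid 3 \<subseteq> X" "torus_grid 4 \<subseteq> X"
    by (auto simp: X_def)
  \<comment> \<open>Values in an arbitrary real vector space, since the identity serves both for
    real indicator functions and for complex integrands.\<close>
  have sum_w: "(\<Sum>x\<in>X. w x *\<^sub>R g x) =
      (1 / (48 * pi ^ 4 * 48)) *\<^sub>R (\<Sum>x\<in>torus_grid 4. (J_fun x)\<^sup>2 *\<^sub>R g x) +
      (1 / (108 * pi ^ 4 * 27)) *\<^sub>R (\<Sum>x\<in>torus_grid 3. (J_fun x)\<^sup>2 *\<^sub>R g x) +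
      (1 / 36) *\<^sub>R (\<Sum>x\<in>torus_grid 2. g x) - (1 / 54) *\<^sub>R (\<Sum>x\<in>torus_grid 1. g x)"
    for g :: "complex \<times> complex \<Rightarrow> 'b :: real_vector"
    unfolding restrict[OF sub(1), symmetric] restrict[OF sub(2), symmetric]
      restrict[OF sub(3), symmetric] restrict[OF sub(4), symmetric]
      scaleR_sum_right sum.distrib[symmetric] sum_subtractf[symmetric]
    by (intro sum.cong refl) (simp add: w_def scaleR_add_left scaleR_diff_left mult_ac)
  define \<epsilon> where "\<epsilon> = grid_measure X w"
  have "measure \<epsilon> A = 1 / (48 * pi ^ 4) * measure (J2d_measure 4) A
      + 1 / (108 * pi ^ 4) * measure (J2d_measure 3) A
      + 1 / 3 * measure (d_measure 2) A - 1 / 18 * measure (d_measure 1) A" if A: "A \<in> sets torus2_borel" for A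
  proof -
    define ind where "ind = indicat_real A"
    have "measure \<epsilon> A = (\<Sum>x\<in>X. w x *\<^sub>R ind x)"
      unfolding \<epsilon>_def ind_def using measure_grid_measure[OF X w A] by simp
    then show ?thesis
      unfolding sum_w measure_J2d_measure[OF ne(3) A] measure_J2d_measure[OF ne(4) A]
        measure_d_measure[OF ne(1) A] measure_d_measure[OF ne(2) A] card ind_def[symmetric]
      by (simp add: sum_distrib_left sum_divide_distrib mult_ac)
  qed
  moreover have "has_bochner_integral \<epsilon> (R_fun m n) (mckay_moment E_group m n)" for m n
  proof -
    define h where "h t = t ^ m * cnj t ^ n" for t :: complex
    have "has_bochner_integral \<epsilon> (R_fun m n) (\<Sum>x\<in>X. w x *\<^sub>R R_fun m n x)"
      unfolding \<epsilon>_def by (rule has_bochner_integral_grid_measure[OF X w R_fun_measurable])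
    also have "(\<Sum>x\<in>X. w x *\<^sub>R R_fun m n x) = (\<Sum>x\<in>X. w x *\<^sub>R h (torus_trace x))"
      using X(2) by (intro sum.cong refl) (auto simp: R_fun_torus_trace h_def)
    also have "\<dots> = (1 / (48 * pi ^ 4 * 48)) *\<^sub>R ((384 * pi ^ 4) *\<^sub>R (\<Sum>c<3. h (omega ^ c))) +
        (1 / (108 * pi ^ 4 * 27)) *\<^sub>R ((648 * pi ^ 4) *\<^sub>R h 0) +
        (1 / 36) *\<^sub>R (\<Sum>c<3. h (3 * omega ^ c) + 3 * h (- (omega ^ c))) - (1 / 54) *\<^sub>R (\<Sum>c<3. h (3 * omega ^ c))"
      unfolding sum_w sum_torus_grid_1 sum_torus_grid_2 sum_torus_grid_3 sum_torus_grid_4 ..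
    \<comment> \<open>The coefficients match the trace counts: 384 / (48 * 48) = 18 / 108, 648 /
      (108 * 27) = 24 / 108, 3 / 36 = 9 / 108 and 1 / 36 - 1 / 54 = 1 / 108.\<close>
    also have "\<dots> = ((\<Sum>c<3. h (3 * omega ^ c)) + 24 * h 0 + 18 * (\<Sum>c<3. h (omega ^ c)) +
        9 * (\<Sum>c<3. h (- (omega ^ c)))) / 108"
      by (simp add: scaleR_conv_of_real sum.distrib field_simps flip: sum_distrib_left)
    also have "\<dots> = mckay_moment E_group m n"
      unfolding mckay_moment_E_group h_def ..
    finally show ?thesis .
  qed
  ultimately show ?thesis
    using finite_grid_measure[OF X w] unfolding spectral_measure_T2_def
    by (intro exI[of _ \<epsilon>]) (auto simp: \<epsilon>_def)
qed

end
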